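(* Let $s\ge 2$ and $r\ge 4$ be integers, let $n_1>n_2>\cdots>n_s\ge 2$ be integers, and put $S=\{n_1,n_2,\ldots,n_s\}$. Let $\delta_r(S)$ be the minimum number of vertices of an $r$-uniform bi-hypergraph which is a one-realization of $S$ (assuming such bi-hypergraphs exist, so that $\delta_r(S)$ is defined). Then $n_s\ge r-1$. Moreover, $$\delta_r(S)=\begin{cases} (n_1-2)r-(n_1-r-1)\lfloor\frac r2\rfloor+2, & \text{if } n_1>n_2+1,\\ (n_1-3)r-(n_1-r-3)\lfloor\frac r2\rfloor+2, & \text{if } n_1=n_2+1>r+2,\\ r(r-1)-1, & \text{if } n_1=r, \text{ or } s\ge 3 \text{ and } n_1=n_3+2=r+1>5,\\ (n_1-2)(r-1)+3, & \text{otherwise.} \end{cases}$$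
   Context: An $r$-uniform bi-hypergraph $\mathcal H=(X,\mathcal B)$ consists of a finite vertex set $X$ and a family $\mathcal B$ of $r$-element subsets of $X$, called bi-edges. A strict $k$-coloring of $\mathcal H$ is a coloring of $X$ using exactly $k$ colors (all of them used) such that every bi-edge contains two distinct vertices with a common color and also two vertices with distinct colors. Colorings are identified with the partitions of $X$ into (nonempty) color classes, called feasible partitions. The feasible set of $\mathcal H$ is the set of all $k$ such that $\mathcal H$ has a strict $k$-coloring. $\mathcal H$ is a one-realization of a finite set $S$ of positive integers if its feasible set is $S$ and for every $k\in S$ there is exactly one feasible partition of $X$ into $k$ classes. *)

theory Defs
  imports Main
begin

definition uniform_bi_hypergraph :: "nat \<Rightarrow> 'a set \<Rightarrow> 'a set set \<Rightarrow> bool" where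
  "uniform_bi_hypergraph r X B \<longleftrightarrow>
     finite X \<and> (\<forall>e\<in>B. e \<subseteq> X \<and> card e = r)"

definition strict_coloring :: "'a set \<Rightarrow> 'a set set \<Rightarrow> nat \<Rightarrow> ('a \<Rightarrow> nat) \<Rightarrow> bool" where
  "strict_coloring X B k c \<longleftrightarrow>
     c ` X = {1..k} \<and>
     (\<forall>e\<in>B. (\<exists>x\<in>e. \<exists>y\<in>e. x \<noteq> y \<and> c x = c y) \<and> (\<exists>x\<in>e. \<exists>y\<in>e. c x \<noteq> c y))"

definition color_classes :: "'a set \<Rightarrow> ('a \<Rightarrow> nat) \<Rightarrow> 'a set set" where
  "color_classes X c = (\<lambda>i. {x \<in> X. c x = i}) ` (c ` X)"

definition feasible_partitions :: "'a set \<Rightarrow> 'a set set \<Rightarrow> nat \<Rightarrow> 'a set set set" where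
  "feasible_partitions X B k = {color_classes X c | c. strict_coloring X B k c}"

definition feasible_set :: "'a set \<Rightarrow> 'a set set \<Rightarrow> nat set" where
  "feasible_set X B = {k. \<exists>c. strict_coloring X B k c}"

definition one_realization :: "'a set \<Rightarrow> 'a set set \<Rightarrow> nat set \<Rightarrow> bool" where
  "one_realization X B S \<longleftrightarrow>
     feasible_set X B = S \<and> (\<forall>k\<in>S. \<exists>!P. P \<in> feasible_partitions X B k)"

(* Vertices are natural numbers, without loss of generality: vertex sets are finite and
   all notions above are invariant under renaming of vertices.  The least number is
   meaningful only if some r-uniform one-realization of S exists. *)
definition delta :: "nat \<Rightarrow> nat set \<Rightarrow> nat" where
  "delta r S = (LEAST m. \<exists>(X :: nat set) B.
     uniform_bi_hypergraph r X B \<and> one_realization X B S \<and> card X = m)"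

end

theory Submission
  imports Defs "HOL-Library.Nat_Bijection"
begin

text \<open>
  A colouring with fewer than \<open>r\<close> colours has no rainbow \<open>r\<close>-set. So if \<open>X\<close> can be covered by \<open>r - 1\<close>
  rows, each of size less than \<open>r\<close> or rainbow in the top colouring \<open>P\<^sub>1\<close>, these rows are a proper
  colouring. The rows can moreover be perturbed, which contradicts uniqueness; hence
  \<open>\<Sum>\<^sub>v min a\<^sub>v p + (r - 1) (r - 1 - p) < |X|\<close> for the class sizes \<open>a\<^sub>v\<close> of \<open>P\<^sub>1\<close> and every \<open>p < r\<close>. Two
  classes of \<open>P\<^sub>1\<close> with less than \<open>r\<close> vertices altogether can be merged, so that such a pair is unique
  and exists only if \<open>n\<^sub>2 = n\<^sub>1 - 1\<close>. A good choice of \<open>p\<close> yields all bounds except \<open>r (r - 1) - 1\<close>, which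
  holds as soon as \<open>r - 1 \<in> S\<close>: then exchanging two vertices between classes of size less than \<open>r\<close> would
  keep the colouring proper.

  Conversely, take \<open>r - 1\<close> core classes of size \<open>r - 1\<close> or \<open>r\<close> and some smaller blocks, and let the
  colouring with \<open>n\<close> colours arise from \<open>P\<^sub>1\<close> by distributing the vertices of all blocks from the \<open>n\<close>-th on
  to the core classes. With all \<open>r\<close>-sets that are neither rainbow nor monochromatic in any of these
  colourings as edges, no other colouring is proper: a colouring with at least \<open>r\<close> colours cannot split
  the core classes because of its transversals, and one with fewer colours cannot split them by
  counting core vertices.
\<close>

subsection \<open>Proper colourings and their kernels\<close>

text \<open>The cases of the formula and the block sizes have one source. If \<open>t\<close> is the
  size of a smallest class of the top colouring with \<open>n\<close> colours, covering with
  \<open>p = r - t\<close> gives a bound linear in \<open>t\<close>: its slope is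
  \<open>-(n - r - 1)\<close> if any two classes have at least \<open>r\<close> vertices together,
  and \<open>-(n - r - 3)\<close> otherwise. So large \<open>n\<close> is matched by blocks of about
  \<open>r div 2\<close> vertices, and \<open>n\<close> at most \<open>r + 2\<close> by singletons.
  The obstacle for the constructions is a block that is moved only partially, or moved without the
  later blocks. Two vertices of a block that go to different core classes let transversals detect
  this; a singleton offers no such pair, which is why it needs a construction of its own. Taking the
  largest possible edge set loses nothing, since additional edges only remove colourings.\<close>

definition monochromatic :: "('a \<Rightarrow> nat) \<Rightarrow> 'a set \<Rightarrow> bool" where
  "monochromatic c e \<longleftrightarrow> (\<forall>x\<in>e. \<forall>y\<in>e. c x = c y)"

text \<open>The edge condition of \<open>strict_coloring\<close> without normalised colour names, so
  that colours can be changed freely; the number of colours is the size of the image.\<close>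

definition proper :: "'a set set \<Rightarrow> ('a \<Rightarrow> nat) \<Rightarrow> bool" where
  "proper B c \<longleftrightarrow> (\<forall>e\<in>B. \<not> inj_on c e \<and> \<not> monochromatic c e)"

definition same_kernel :: "'a set \<Rightarrow> ('a \<Rightarrow> nat) \<Rightarrow> ('a \<Rightarrow> nat) \<Rightarrow> bool" where
  "same_kernel X c c' \<longleftrightarrow> (\<forall>x\<in>X. \<forall>y\<in>X. c x = c y \<longleftrightarrow> c' x = c' y)"

abbreviation degenerate :: "('a \<Rightarrow> nat) \<Rightarrow> 'a set \<Rightarrow> bool" where
  "degenerate c e \<equiv> inj_on c e \<or> monochromatic c e"

abbreviation cls :: "'a set \<Rightarrow> ('a \<Rightarrow> nat) \<Rightarrow> nat \<Rightarrow> 'a set" where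
  "cls X c v \<equiv> {x \<in> X. c x = v}"

abbreviation (input) realizes :: "nat \<Rightarrow> 'a set \<Rightarrow> 'a set set \<Rightarrow> nat set \<Rightarrow> bool" where
  "realizes r X B S \<equiv> uniform_bi_hypergraph r X B \<and> one_realization X B S"

lemma monochromaticD: "monochromatic c e \<Longrightarrow> x \<in> e \<Longrightarrow> y \<in> e \<Longrightarrow> c x = c y"
  unfolding monochromatic_def by blast

lemma monochromaticI: "(\<And>x. x \<in> e \<Longrightarrow> c x = k) \<Longrightarrow> monochromatic c e"
  unfolding monochromatic_def by simp

lemma same_kernelD: "same_kernel X c c' \<Longrightarrow> x \<in> X \<Longrightarrow> y \<in> X \<Longrightarrow> c x = c y \<longleftrightarrow> c' x = c' y"
  by (auto simp: same_kernel_def)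

lemma same_kernel_sym: "same_kernel X c c' \<Longrightarrow> same_kernel X c' c"
  by (auto simp: same_kernel_def)

lemma same_kernel_trans: "same_kernel X c c' \<Longrightarrow> same_kernel X c' c'' \<Longrightarrow> same_kernel X c c''"
  by (auto simp: same_kernel_def)

lemma strict_coloring_iff:
  "strict_coloring X B k c \<longleftrightarrow> c ` X = {1..k} \<and> proper B c"
  unfolding strict_coloring_def proper_def monochromatic_def inj_on_def by blast

lemma color_classes_eq_iff:
  "color_classes X c = color_classes X c' \<longleftrightarrow> same_kernel X c c'"
proof -
  have cc: "color_classes X f = (\<lambda>x. {y \<in> X. f y = f x}) ` X" for f :: "'a \<Rightarrow> nat"
    unfolding color_classes_def by auto
  show ?thesis
  proof
    assume eq: "color_classes X c = color_classes X c'"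
    have "{y \<in> X. c y = c x} = {y \<in> X. c' y = c' x}" if x: "x \<in> X" for x
    proof -
      have "{y \<in> X. c y = c x} \<in> (\<lambda>x. {y \<in> X. c' y = c' x}) ` X"
        using eq x unfolding cc by blast
      then obtain z where z: "z \<in> X" "{y \<in> X. c y = c x} = {y \<in> X. c' y = c' z}" by auto
      then have "c' x = c' z" using x by blast
      then show ?thesis using z by simp
    qed
    then show "same_kernel X c c'"
      unfolding same_kernel_def by blast
  next
    assume "same_kernel X c c'"
    then have "{y \<in> X. c y = c x} = {y \<in> X. c' y = c' x}" if "x \<in> X" for x
      using that by (auto simp: same_kernel_def)
    then show "color_classes X c = color_classes X c'"
      unfolding cc by (intro image_cong) auto
  qed
qed

lemma card_image_same_kernel_le:
  assumes "finite X" "same_kernel X c c'"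
  shows "card (c' ` X) \<le> card (c ` X)"
proof -
  have "c' x = c' (inv_into X c (c x))" if "x \<in> X" for x
    using that same_kernelD[OF assms(2), of x "inv_into X c (c x)"]
      f_inv_into_f[of "c x" c X] inv_into_into[of "c x" c X] by simp
  then have "c' ` X = (\<lambda>v. c' (inv_into X c v)) ` (c ` X)"
    by (simp add: image_image cong: image_cong)
  then show ?thesis using card_image_le[of "c ` X"] assms(1) by simp
qed

lemma card_image_same_kernel:
  "finite X \<Longrightarrow> same_kernel X c c' \<Longrightarrow> card (c ` X) = card (c' ` X)"
  using card_image_same_kernel_le[of X c c'] card_image_same_kernel_le[of X c' c] same_kernel_sym[of X c c']
  by simp

lemma proper_same_kernel:
  assumes "same_kernel X c c'" "\<forall>e\<in>B. e \<subseteq> X" "proper B c"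
  shows "proper B c'"
  using assms unfolding proper_def same_kernel_def inj_on_def monochromatic_def
  by (metis subsetD)

lemma proper_imp_strict:
  assumes "finite X" "\<forall>e\<in>B. e \<subseteq> X" "proper B c"
  shows "\<exists>c'. strict_coloring X B (card (c ` X)) c' \<and> same_kernel X c c'"
proof -
  obtain h where h: "bij_betw h (c ` X) {1..card (c ` X)}"
    using finite_same_card_bij[of "c ` X" "{1..card (c ` X)}"] assms(1) by auto
  have k: "same_kernel X c (h \<circ> c)"
    using bij_betw_imp_inj_on[OF h] unfolding same_kernel_def inj_on_def by auto
  have "(h \<circ> c) ` X = {1..card (c ` X)}"
    using h unfolding bij_betw_def by (simp add: image_comp)
  then show ?thesis
    using k proper_same_kernel[OF k assms(2,3)] strict_coloring_iff by blast
qed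

text \<open>Partitions are traded for kernels. Renaming colours affects neither, so colourings onto
  \<open>{1..k}\<close> may be replaced by arbitrary proper maps.\<close>

lemma one_realization_iff:
  assumes "finite X" "\<forall>e\<in>B. e \<subseteq> X"
  shows "one_realization X B S \<longleftrightarrow>
    (\<forall>c. proper B c \<longrightarrow> card (c ` X) \<in> S) \<and>
    (\<forall>k\<in>S. \<exists>c. proper B c \<and> card (c ` X) = k) \<and>
    (\<forall>c c'. proper B c \<longrightarrow> proper B c' \<longrightarrow> card (c ` X) = card (c' ` X) \<longrightarrow> same_kernel X c c')"
    (is "?L \<longleftrightarrow> ?R")
proof
  assume L: ?L
  then have fs: "feasible_set X B = S"
    and uniq: "\<And>k P P'. k \<in> S \<Longrightarrow> P \<in> feasible_partitions X B k \<Longrightarrow>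
      P' \<in> feasible_partitions X B k \<Longrightarrow> P = P'"
    unfolding one_realization_def by blast+
  have 1: "card (c ` X) \<in> S" if "proper B c" for c
    using proper_imp_strict[OF assms that] fs unfolding feasible_set_def by blast
  have 2: "\<exists>c. proper B c \<and> card (c ` X) = k" if "k \<in> S" for k
    using that fs unfolding feasible_set_def strict_coloring_iff by force
  have 3: "same_kernel X c c'"
    if c: "proper B c" and c': "proper B c'" and eq: "card (c ` X) = card (c' ` X)" for c c'
  proof -
    obtain f where f: "strict_coloring X B (card (c ` X)) f" "same_kernel X c f"
      using proper_imp_strict[OF assms c] by blast
    obtain f' where f': "strict_coloring X B (card (c ` X)) f'" "same_kernel X c' f'"
      using proper_imp_strict[OF assms c'] eq by auto
    have "color_classes X f = color_classes X f'"
      using f f' uniq[OF 1[OF c]] unfolding feasible_partitions_def by blast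
    then show ?thesis
      using f f' color_classes_eq_iff same_kernel_sym same_kernel_trans by metis
  qed
  show ?R using 1 2 3 by blast
next
  assume R: ?R
  have st: "proper B c \<and> card (c ` X) = k" if "strict_coloring X B k c" for k c
    using that unfolding strict_coloring_iff by auto
  have ex: "\<exists>c. strict_coloring X B k c" if k: "k \<in> S" for k
  proof -
    obtain c where "proper B c" "card (c ` X) = k" using R k by blast
    then show ?thesis using proper_imp_strict[OF assms, of c] by blast
  qed
  have "feasible_set X B = S"
    using R st ex unfolding feasible_set_def by blast
  moreover have "\<exists>!P. P \<in> feasible_partitions X B k" if "k \<in> S" for k
  proof (rule ex_ex1I)
    show "\<exists>P. P \<in> feasible_partitions X B k"
      using ex[OF that] unfolding feasible_partitions_def by blast
    fix P P' assume "P \<in> feasible_partitions X B k" "P' \<in> feasible_partitions X B k"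
    then obtain c c' where "strict_coloring X B k c" "P = color_classes X c"
      "strict_coloring X B k c'" "P' = color_classes X c'"
      unfolding feasible_partitions_def by blast
    then show "P = P'" using R st color_classes_eq_iff by metis
  qed
  ultimately show ?L unfolding one_realization_def by blast
qed

text \<open>The edges are all \<open>r\<close>-sets on which no member of \<open>F\<close> is
  degenerate. An \<open>r\<close>-set that is degenerate for a proper \<open>c\<close> is then no
  edge, hence degenerate for some member of \<open>F\<close>; this is all that \<open>rigid\<close>
  may use about \<open>c\<close>.\<close>

lemma one_realizationI_rigid:
  fixes F :: "('a \<Rightarrow> nat) set"
  assumes fin: "finite X"
    and rigid: "\<And>c. (\<And>e. e \<subseteq> X \<Longrightarrow> card e = r \<Longrightarrow> degenerate c e \<Longrightarrow> \<exists>f\<in>F. degenerate f e) \<Longrightarrow> \<exists>f\<in>F. same_kernel X c f"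
    and uniq: "\<And>f f'. f \<in> F \<Longrightarrow> f' \<in> F \<Longrightarrow> card (f ` X) = card (f' ` X) \<Longrightarrow> f = f'"
  shows "\<exists>B. uniform_bi_hypergraph r X B \<and> one_realization X B ((\<lambda>f. card (f ` X)) ` F)"
proof -
  define B where "B = {e. e \<subseteq> X \<and> card e = r \<and> (\<forall>f\<in>F. \<not> inj_on f e \<and> \<not> monochromatic f e)}"
  have sub: "\<forall>e\<in>B. e \<subseteq> X" unfolding B_def by auto
  have un: "uniform_bi_hypergraph r X B"
    using fin unfolding uniform_bi_hypergraph_def B_def by auto
  have pF: "proper B f" if "f \<in> F" for f using that unfolding proper_def B_def by auto
  have P: "\<exists>f\<in>F. same_kernel X c f" if "proper B c" for c
  proof (rule rigid)
    fix e assume "e \<subseteq> X" "card e = r" "degenerate c e"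
    then show "\<exists>f\<in>F. degenerate f e"
      using that unfolding proper_def B_def by blast
  qed
  have "one_realization X B ((\<lambda>f. card (f ` X)) ` F)"
    unfolding one_realization_iff[OF fin sub]
  proof (intro conjI allI impI ballI)
    fix c assume "proper B c"
    then show "card (c ` X) \<in> (\<lambda>f. card (f ` X)) ` F"
      using P card_image_same_kernel[OF fin] by blast
  next
    fix k assume "k \<in> (\<lambda>f. card (f ` X)) ` F"
    then show "\<exists>c. proper B c \<and> card (c ` X) = k" using pF by blast
  next
    fix c c' assume c: "proper B c" and c': "proper B c'" and eq: "card (c ` X) = card (c' ` X)"
    obtain f f' where f: "f \<in> F" "same_kernel X c f" "f' \<in> F" "same_kernel X c' f'"
      using P c c' by blast
    then have "f = f'" using uniq eq card_image_same_kernel[OF fin] by metis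
    then show "same_kernel X c c'" using f same_kernel_sym same_kernel_trans by blast
  qed
  then show ?thesis using un by blast
qed

lemma sum_card_cls:
  assumes "finite X" "finite V" "c ` X \<subseteq> V"
  shows "(\<Sum>v\<in>V. card (cls X c v)) = card X"
proof -
  have "card X = card (\<Union>v\<in>V. cls X c v)" using assms by (intro arg_cong[where f = card]) auto
  also have "\<dots> = (\<Sum>v\<in>V. card (cls X c v))"
    using assms by (intro card_UN_disjoint) auto
  finally show ?thesis by simp
qed

lemma card_exchange:
  assumes "finite M" "x \<in> M" "y \<notin> M"
  shows "card (insert y (M - {x})) = card M"
proof -
  have "card (insert y (M - {x})) = Suc (card (M - {x}))" using assms by simp
  then show ?thesis using card_Suc_Diff1[OF assms(1,2)] by simp
qed

section \<open>First consequences of uniqueness: recolouring and merging\<close>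

locale realized =
  fixes r :: nat and X :: "'a set" and B :: "'a set set" and S :: "nat set"
  assumes r4: "4 \<le> r"
    and unif: "uniform_bi_hypergraph r X B"
    and real: "one_realization X B S"
    and S2: "\<And>k. k \<in> S \<Longrightarrow> 2 \<le> k"
begin

lemma finX: "finite X" and edges: "e \<in> B \<Longrightarrow> e \<subseteq> X" "e \<in> B \<Longrightarrow> card e = r"
  using unif unfolding uniform_bi_hypergraph_def by auto

lemma edges_sub: "\<forall>e\<in>B. e \<subseteq> X"
  using edges(1) by blast

lemmas real_iff = real[unfolded one_realization_iff[OF finX edges_sub]]

lemma card_in: "proper B c \<Longrightarrow> card (c ` X) \<in> S"
  using real_iff[THEN conjunct1] by blast

lemma ex_colouring: "k \<in> S \<Longrightarrow> \<exists>c. proper B c \<and> card (c ` X) = k"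
  using real_iff[THEN conjunct2, THEN conjunct1] by blast

lemma unique: "proper B c \<Longrightarrow> proper B c' \<Longrightarrow> card (c ` X) = card (c' ` X) \<Longrightarrow> same_kernel X c c'"
  using real_iff[THEN conjunct2, THEN conjunct2] by blast

text \<open>The proper colouring \<open>g\<close> is only a witness against monochromatic edges:
  whatever is degenerate for \<open>g\<close> is not an edge.\<close>

lemma proper_few:
  assumes g: "proper B g" and few: "card (c ` X) < r"
    and m: "\<And>e. e \<in> B \<Longrightarrow> monochromatic c e \<Longrightarrow> degenerate g e"
  shows "proper B c"
  unfolding proper_def
proof (intro ballI conjI)
  fix e assume e: "e \<in> B"
  show "\<not> inj_on c e"
  proof
    assume "inj_on c e"
    then have "card (c ` e) = r" using edges(2)[OF e] by (simp add: card_image)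
    moreover have "card (c ` e) \<le> card (c ` X)"
      using edges(1)[OF e] finX by (intro card_mono) auto
    ultimately show False using few by simp
  qed
  show "\<not> monochromatic c e"
    using m[OF e] g e unfolding proper_def by blast
qed

text \<open>Here the bound 2 for the elements of \<open>S\<close> enters: without edges a constant
  map would be proper.\<close>

lemma B_nonempty: "B \<noteq> {}"
proof
  assume B: "B = {}"
  have "card ((\<lambda>_. 0::nat) ` X) \<in> S" by (rule card_in) (simp add: proper_def B)
  moreover have "card ((\<lambda>_. 0::nat) ` X) \<le> 1" using card_mono[of "{0::nat}" "(\<lambda>_. 0) ` X"] by auto
  ultimately show False using S2 by fastforce
qed

lemma not_inj: "proper B c \<Longrightarrow> \<not> inj_on c X"
  using B_nonempty edges(1) unfolding proper_def by (meson equals0I inj_on_subset)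

text \<open>With at most \<open>r - 2\<close> colours, a vertex that shares its colour can get a
  fresh one and the colouring stays proper. Uniqueness leaves only one pair of equally coloured
  vertices, so \<open>X\<close> has at most \<open>k + 1 < r\<close> vertices and no room for an
  edge.\<close>

lemma S_ge:
  assumes k: "k \<in> S"
  shows "r - 1 \<le> k"
proof (rule ccontr)
  assume "\<not> r - 1 \<le> k"
  then have kr: "k + 1 < r" by simp
  obtain c where c: "proper B c" "card (c ` X) = k" using ex_colouring[OF k] by blast
  obtain w where w: "w \<notin> c ` X" using finX by (metis ex_new_if_finite finite_imageI infinite_UNIV_nat)
  have up: "proper B (c(x := w)) \<and> card (c(x := w) ` X) = k + 1"
    if x: "x \<in> X" "y \<in> X" "x \<noteq> y" "c x = c y" for x y
  proof -
    have "c(x := w) ` X = insert w (c ` X)"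
      using x by (auto simp: image_iff)
    then have card: "card (c(x := w) ` X) = k + 1" using w c finX by simp
    have "monochromatic c e" if "e \<in> B" "monochromatic (c(x := w)) e" for e
      unfolding monochromatic_def
    proof (intro ballI)
      fix a b assume ab: "a \<in> e" "b \<in> e"
      then have "(c(x := w)) a = (c(x := w)) b" "c a \<noteq> w" "c b \<noteq> w"
        using that(2) edges(1)[OF that(1)] w unfolding monochromatic_def by blast+
      then show "c a = c b" by (simp split: if_splits)
    qed
    then have "proper B (c(x := w))"
      using card kr by (intro proper_few[OF c(1)]) auto
    then show ?thesis using card by simp
  qed
  obtain x y where xy: "x \<in> X" "y \<in> X" "x \<noteq> y" "c x = c y"
    using not_inj[OF c(1)] unfolding inj_on_def by blast
  have inj: "inj_on c (X - {x})"
  proof (rule inj_onI, rule ccontr)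
    fix a b assume ab: "a \<in> X - {x}" "b \<in> X - {x}" "c a = c b" "a \<noteq> b"
    \<comment> \<open>Recolouring \<open>z\<close> keeps \<open>x\<close> and \<open>y\<close>
      together, whereas recolouring \<open>x\<close> separates them.\<close>
    obtain z where z: "z \<in> {a, b}" "z \<noteq> y" using ab by blast
    define z' where "z' = (if z = a then b else a)"
    have z': "z \<in> X" "z' \<in> X" "z \<noteq> z'" "c z = c z'" "z \<noteq> x" using z ab z'_def by auto
    have "same_kernel X (c(x := w)) (c(z := w))"
      using up[OF xy] up[OF z'(1-4)] unique by simp
    from same_kernelD[OF this xy(1,2)] show False
      using xy z z' w by auto
  qed
  have "card (X - {x}) = card (c ` (X - {x}))" by (rule card_image[OF inj, symmetric])
  also have "\<dots> \<le> card (c ` X)" using finX by (intro card_mono) auto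
  also have "\<dots> = k" by (rule c(2))
  finally have "card X \<le> k + 1" using xy finX by (simp add: card_Diff_singleton)
  moreover obtain e where "e \<in> B" using B_nonempty by blast
  ultimately show False using edges[of e] kr card_mono[OF finX, of e] by auto
qed

text \<open>No feasible number lies below \<open>r - 1\<close>, so both colourings have exactly
  \<open>r - 1\<close> colours.\<close>

lemma few_colours_unique:
  assumes "proper B c" "proper B c'" "card (c ` X) \<le> r - 1" "card (c' ` X) \<le> r - 1"
  shows "same_kernel X c c'"
proof (rule unique)
  show "card (c ` X) = card (c' ` X)"
    using assms(3,4) S_ge[OF card_in[OF assms(1)]] S_ge[OF card_in[OF assms(2)]] by simp
qed (use assms in auto)

text \<open>An edge that becomes monochromatic lies in the union of the two classes, which is too
  small to contain it; rainbow edges cannot arise by merging.\<close>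

lemma merge_proper:
  assumes c: "proper B c" and uv: "u \<in> c ` X" "v \<in> c ` X" "u \<noteq> v"
    and small: "card (cls X c u) + card (cls X c v) < r"
  shows "proper B (\<lambda>x. if c x = v then u else c x)" (is "proper B ?m")
    and "card ((\<lambda>x. if c x = v then u else c x) ` X) = card (c ` X) - 1"
proof -
  have "?m ` X = c ` X - {v}"
  proof (intro equalityI subsetI)
    fix w assume "w \<in> c ` X - {v}"
    then obtain x where "x \<in> X" "w = c x" "c x \<noteq> v" by blast
    then show "w \<in> ?m ` X" by (intro image_eqI[of _ _ x]) simp_all
  next
    fix w assume "w \<in> ?m ` X"
    then obtain x where "x \<in> X" "w = ?m x" by blast
    then show "w \<in> c ` X - {v}" using uv by (cases "c x = v") simp_all
  qed
  then show "card (?m ` X) = card (c ` X) - 1" using uv finX by (simp add: card_Diff_singleton)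
  show "proper B ?m"
    unfolding proper_def
  proof (intro ballI conjI)
    fix e assume e: "e \<in> B"
    have nc: "\<not> inj_on c e" "\<not> monochromatic c e" using c e unfolding proper_def by auto
    show "\<not> inj_on ?m e"
    proof
      assume inj: "inj_on ?m e"
      have "inj_on c e" by (rule inj_onI, rule inj_onD[OF inj]) simp_all
      then show False using nc(1) by blast
    qed
    show "\<not> monochromatic ?m e"
    proof
      assume m: "monochromatic ?m e"
      obtain a b where ab: "a \<in> e" "b \<in> e" "c a \<noteq> c b"
        using nc unfolding monochromatic_def by blast
      have "?m a = ?m b" by (rule monochromaticD[OF m ab(1,2)])
      then have mu: "?m a = u" using ab(3) by (simp split: if_splits)
      have "e \<subseteq> cls X c u \<union> cls X c v"
      proof
        fix z assume z: "z \<in> e"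
        have "?m z = u" by (rule trans[OF monochromaticD[OF m z ab(1)] mu])
        then show "z \<in> cls X c u \<union> cls X c v"
          using edges(1)[OF e] z by (auto split: if_split_asm)
      qed
      then have "card e \<le> card (cls X c u \<union> cls X c v)" using finX by (intro card_mono) auto
      also have "\<dots> \<le> card (cls X c u) + card (cls X c v)" by (rule card_Un_le)
      finally show False using small edges(2)[OF e] by simp
    qed
  qed
qed

text \<open>Both merges have one colour less than \<open>c\<close>, hence the same kernel, and the
  kernel reveals which classes were merged.\<close>

lemma merge_unique:
  assumes c: "proper B c" and uv: "u \<in> c ` X" "v \<in> c ` X" "u \<noteq> v"
    and small: "card (cls X c u) + card (cls X c v) < r"
    and uv': "u' \<in> c ` X" "v' \<in> c ` X" "u' \<noteq> v'"
    and small': "card (cls X c u') + card (cls X c v') < r"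
  shows "{u, v} = {u', v'}"
proof -
  have sk: "same_kernel X (\<lambda>x. if c x = v then u else c x) (\<lambda>x. if c x = v' then u' else c x)"
    using merge_proper[OF c uv small] merge_proper[OF c uv' small'] by (intro unique) auto
  obtain x y where xy: "x \<in> X" "y \<in> X" "u = c x" "v = c y" using uv by blast
  then show ?thesis using same_kernelD[OF sk xy(1,2)] uv(3) by (simp split: if_splits) blast+
qed

end

subsection \<open>Lower bounds\<close>

context realized
begin

text \<open>Enumerate every colour class. For \<open>t < p\<close> the vertices with index \<open>t\<close> form a rainbow row; if the
  remaining vertices fitted into \<open>r - 1 - p\<close> rows of size \<open>r - 1\<close>, the rows would be a proper
  colouring, and exchanging two vertices of the same class would yield a second one.\<close>

lemma cover_bound:
  assumes c: "proper B c" and n2: "2 \<le> card (c ` X)" and p: "1 \<le> p" "p < r"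
  shows "(\<Sum>v\<in>c ` X. min (card (cls X c v)) p) + (r - 1) * (r - 1 - p) < card X"
proof (rule ccontr)
  assume "\<not> ?thesis"
  then have small: "card X \<le> (\<Sum>v\<in>c ` X. min (card (cls X c v)) p) + (r - 1) * (r - 1 - p)" by simp
  have "\<exists>i. bij_betw i (cls X c v) {..<card (cls X c v)}" for v
    using finite_same_card_bij[of "cls X c v" "{..<card (cls X c v)}"] finX by auto
  then obtain i where i: "\<And>v. bij_betw (i v) (cls X c v) {..<card (cls X c v)}" by metis
  define idx where "idx = (\<lambda>x. i (c x) x)"
  have idx_inj: "x = y" if "x \<in> X" "y \<in> X" "c x = c y" "idx x = idx y" for x y
    using that bij_betw_imp_inj_on[OF i[of "c x"]] unfolding idx_def inj_on_def by auto
  have idx_ex: "\<exists>x\<in>X. c x = v \<and> idx x = k" if k: "k < card (cls X c v)" for v k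
  proof -
    have "k \<in> i v ` cls X c v" using k i[of v] unfolding bij_betw_def by auto
    then show ?thesis unfolding idx_def by auto
  qed
  define T where "T = {x \<in> X. idx x < p}"
  have "card {x \<in> X. c x = v \<and> idx x < p} = min (card (cls X c v)) p" for v
  proof -
    have "i v ` {x \<in> X. c x = v \<and> idx x < p} = {..<min (card (cls X c v)) p}"
    proof (intro equalityI subsetI)
      fix k assume "k \<in> i v ` {x \<in> X. c x = v \<and> idx x < p}"
      then obtain x where "x \<in> X" "c x = v" "k = i v x" "k < p" unfolding idx_def by blast
      then show "k \<in> {..<min (card (cls X c v)) p}"
        using bij_betwE[OF i[of v]] by auto
    next
      fix k assume "k \<in> {..<min (card (cls X c v)) p}"
      then show "k \<in> i v ` {x \<in> X. c x = v \<and> idx x < p}"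
        using idx_ex[of k v] unfolding idx_def by auto
    qed
    moreover have "inj_on (i v) {x \<in> X. c x = v \<and> idx x < p}"
      by (rule inj_on_subset[OF bij_betw_imp_inj_on[OF i[of v]]]) auto
    ultimately show ?thesis using card_image[of "i v" "{x \<in> X. c x = v \<and> idx x < p}"] by simp
  qed
  moreover have "cls T c v = {x \<in> X. c x = v \<and> idx x < p}" for v unfolding T_def by auto
  ultimately have "card T = (\<Sum>v\<in>c ` X. min (card (cls X c v)) p)"
    using sum_card_cls[of T "c ` X" c] finX unfolding T_def by fastforce
  then have cZ: "card (X - T) \<le> (r - 1) * (r - 1 - p)"
    using small finX unfolding T_def by (subst card_Diff_subset) auto
  obtain e where e: "bij_betw e (X - T) {..<card (X - T)}"
    using finite_same_card_bij[of "X - T" "{..<card (X - T)}"] finX by auto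
  define row where "row = (\<lambda>x. if idx x < p then idx x else p + e x div (r - 1))"
  have row_lt: "row x < r - 1" if x: "x \<in> X" for x
  proof (cases "idx x < p")
    case True then show ?thesis using p r4 unfolding row_def by auto
  next
    case False
    then have "e x < (r - 1) * (r - 1 - p)"
      using x bij_betw_apply[OF e, of x] cZ unfolding T_def by simp
    then have "e x div (r - 1) < r - 1 - p" by (simp add: less_mult_imp_div_less mult.commute)
    then show ?thesis using False unfolding row_def by auto
  qed
  have rows: "inj_on c E" if E: "E \<subseteq> X" "card E = r" "monochromatic row E" for E
  proof (rule inj_onI)
    fix x y assume xy: "x \<in> E" "y \<in> E" "c x = c y"
    have "idx x < p"
    proof (rule ccontr)
      assume np: "\<not> idx x < p"
      have big: "p \<le> idx z \<and> e z div (r - 1) = e x div (r - 1)" if "z \<in> E" for z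
        using monochromaticD[OF E(3) that xy(1)] np unfolding row_def by (auto split: if_splits)
      then have sub: "E \<subseteq> X - T" using E(1) unfolding T_def by fastforce
      have "e ` E \<subseteq> {(r - 1) * (e x div (r - 1))..<(r - 1) * (e x div (r - 1)) + (r - 1)}"
      proof
        fix w assume "w \<in> e ` E"
        then obtain z where z: "z \<in> E" "w = e z" by auto
        have "w = (r - 1) * (e x div (r - 1)) + w mod (r - 1)"
          using big[OF z(1)] z(2) by (metis mult_div_mod_eq)
        moreover have "w mod (r - 1) < r - 1" using r4 by simp
        ultimately show "w \<in> {(r - 1) * (e x div (r - 1))..<(r - 1) * (e x div (r - 1)) + (r - 1)}"
          by (metis atLeastLessThan_iff le_add1 nat_add_left_cancel_less)
      qed
      then have "card (e ` E) \<le> r - 1" by (metis card_atLeastLessThan add_diff_cancel_left' card_mono finite_atLeastLessThan)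
      moreover have "card (e ` E) = r"
        using inj_on_subset[OF bij_betw_imp_inj_on[OF e] sub] E(2) by (simp add: card_image)
      ultimately show False using r4 by simp
    qed
    then have "idx x = idx y"
      using monochromaticD[OF E(3) xy(1,2)] unfolding row_def by (auto split: if_splits)
    then show "x = y" using idx_inj xy E(1) by blast
  qed
  have few: "card (f ` X) \<le> r - 1" if "\<And>x. x \<in> X \<Longrightarrow> f x < r - 1" for f :: "'a \<Rightarrow> nat"
    using that card_mono[of "{..<r - 1}" "f ` X"] by auto
  have P1: "proper B row"
    using few[of row] row_lt r4 rows edges by (intro proper_few[OF c]) auto
  obtain x' y' where xy': "x' \<in> X" "y' \<in> X" "x' \<noteq> y'" "c x' = c y'"
    using not_inj[OF c] unfolding inj_on_def by blast
  \<comment> \<open>The vertices of index 0 and 1 of a class lie in different rows, even for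
    \<open>p = 1\<close>, where index 1 goes to one of the later rows. The vertex \<open>z\<close>
    of another class stays in row 0 and will witness that the exchange changes the kernel.\<close>
  have "2 \<le> card (cls X c (c x'))"
    using card_mono[of "cls X c (c x')" "{x', y'}"] xy' finX by auto
  then obtain x y where xy: "x \<in> X" "c x = c x'" "idx x = 0" "y \<in> X" "c y = c x'" "idx y = 1"
    using idx_ex[of 0 "c x'"] idx_ex[of 1 "c x'"] by auto
  have "\<exists>v\<in>c ` X. v \<noteq> c x'"
  proof (rule ccontr)
    assume "\<not> ?thesis"
    then have "c ` X \<subseteq> {c x'}" by auto
    then show False using n2 card_mono[of "{c x'}" "c ` X"] by auto
  qed
  then obtain v where v: "v \<in> c ` X" "v \<noteq> c x'" by blast
  then have "card (cls X c v) \<noteq> 0" using finX by auto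
  then obtain z where z: "z \<in> X" "c z = v" "idx z = 0" using idx_ex[of 0 v] by auto
  \<comment> \<open>Exchanging two vertices of one class does not affect \<open>c\<close>, so the
    preimages of rainbow rows are rainbow.\<close>
  define \<pi> where "\<pi> = (\<lambda>w. if w = x then y else if w = y then x else w)"
  have \<pi>c: "c (\<pi> w) = c w" and \<pi>X: "w \<in> X \<Longrightarrow> \<pi> w \<in> X" for w
    using xy unfolding \<pi>_def by auto
  have \<pi>inj: "inj \<pi>" unfolding \<pi>_def inj_def by (auto split: if_splits)
  have P2: "proper B (row \<circ> \<pi>)"
  proof (rule proper_few[OF c])
    show "card ((row \<circ> \<pi>) ` X) < r" using few[of "row \<circ> \<pi>"] row_lt \<pi>X r4 by fastforce
    fix E assume E: "E \<in> B" and m: "monochromatic (row \<circ> \<pi>) E"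
    have "monochromatic row (\<pi> ` E)" using m unfolding monochromatic_def comp_def by blast
    moreover have "card (\<pi> ` E) = r" using card_image[OF inj_on_subset[OF \<pi>inj]] edges[OF E] by simp
    moreover have "\<pi> ` E \<subseteq> X" using \<pi>X edges[OF E] by auto
    ultimately have "inj_on c (\<pi> ` E)" using rows by blast
    then have "inj_on (c \<circ> \<pi>) E" by (intro comp_inj_on inj_on_subset[OF \<pi>inj]) auto
    then show "degenerate c E" using \<pi>c by (simp add: comp_def)
  qed
  have sk: "same_kernel X row (row \<circ> \<pi>)"
    using P1 P2 few[of row] few[of "row \<circ> \<pi>"] row_lt \<pi>X by (intro few_colours_unique) auto
  have "row x = 0" "row z = 0" "row y \<noteq> 0" using xy z p unfolding row_def by auto
  moreover have "\<pi> x = y" "\<pi> z = z" using xy z v unfolding \<pi>_def by auto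
  ultimately show False using same_kernelD[OF sk xy(1) z(1)] by simp
qed

text \<open>A class of \<open>t\<close> vertices, \<open>t\<close> at most \<open>r div 2\<close>,
  forces all others to have at least \<open>r - t\<close>, so \<open>p = r - t\<close> is attained
  by each of them. Since \<open>r < n\<close>, the slope in \<open>t\<close> is not positive and
  \<open>t = r div 2\<close> is the worst case. If all classes are larger,
  \<open>p = r - r div 2\<close> is attained by every class and gives at least as much.\<close>

lemma no_small_pair_bound:
  assumes c: "proper B c" and n: "card (c ` X) = n" "r < n"
    and big: "\<And>u v. u \<in> c ` X \<Longrightarrow> v \<in> c ` X \<Longrightarrow> u \<noteq> v \<Longrightarrow> r \<le> card (cls X c u) + card (cls X c v)"
  shows "(int n - 2) * int r - (int n - int r - 1) * int (r div 2) + 2 \<le> int (card X)"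
proof -
  define h where "h = r div 2"
  have h: "2 \<le> h" "2 * h \<le> r" using r4 unfolding h_def by auto
  define a where "a = (\<lambda>v. card (cls X c v))"
  have fin: "finite (c ` X)" using finX by simp
  have a1: "1 \<le> a v" if "v \<in> c ` X" for v
    using that finX unfolding a_def by (auto simp: Suc_le_eq card_gt_0_iff)
  show ?thesis
  proof (cases "\<exists>w\<in>c ` X. a w \<le> h")
    case True
    then obtain w where w: "w \<in> c ` X" "a w \<le> h" by blast
    define t where "t = a w"
    have t: "1 \<le> t" "t \<le> h" using w a1 unfolding t_def by auto
    have "(\<Sum>v\<in>c ` X - {w}. min (a v) (r - t)) = (\<Sum>v\<in>c ` X - {w}. r - t)"
    proof (rule sum.cong[OF refl])
      fix v assume "v \<in> c ` X - {w}"
      then have "r \<le> a v + t" using big[of v w] w unfolding a_def t_def by auto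
      then show "min (a v) (r - t) = r - t" by simp
    qed
    then have "(\<Sum>v\<in>c ` X. min (a v) (r - t)) = t + (n - 1) * (r - t)"
      using w fin n t h unfolding t_def by (subst sum.remove[OF fin w(1)]) (simp add: card_Diff_singleton)
    then have "t + (n - 1) * (r - t) + (r - 1) * (t - 1) < card X"
      using cover_bound[OF c, of "r - t"] n r4 t h unfolding a_def by auto
    then have "int (t + (n - 1) * (r - t) + (r - 1) * (t - 1)) + 1 \<le> int (card X)" by linarith
    moreover have "int (t + (n - 1) * (r - t) + (r - 1) * (t - 1)) =
        int t + (int n - 1) * (int r - int t) + (int r - 1) * (int t - 1)"
      using n r4 t h by (simp add: of_nat_diff)
    moreover have "(int n - int r - 1) * int t \<le> (int n - int r - 1) * int h"
      using t n by (intro mult_left_mono) auto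
    ultimately show ?thesis unfolding h_def[symmetric] by (simp add: algebra_simps)
  next
    case False
    have "(\<Sum>v\<in>c ` X. min (a v) (r - h)) = (\<Sum>v\<in>c ` X. r - h)"
      using False h_def by (intro sum.cong refl) fastforce
    then have "(\<Sum>v\<in>c ` X. min (a v) (r - h)) = n * (r - h)" using n by simp
    then have "n * (r - h) + (r - 1) * (h - 1) < card X"
      using cover_bound[OF c, of "r - h"] n r4 h unfolding a_def by auto
    then have "int (n * (r - h) + (r - 1) * (h - 1)) + 1 \<le> int (card X)" by linarith
    moreover have "int (n * (r - h) + (r - 1) * (h - 1)) =
        int n * (int r - int h) + (int r - 1) * (int h - 1)"
      using n r4 h by (simp add: of_nat_diff)
    ultimately show ?thesis using h unfolding h_def[symmetric] by (simp add: algebra_simps)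
  qed
qed

text \<open>By \<open>merge_unique\<close> no other class forms a small pair with \<open>u\<close>,
  so all others have at least \<open>r - t\<close> vertices, where \<open>t\<close> is the size of
  class \<open>u\<close>. The bound is left open in \<open>t\<close> because the sign of
  \<open>n - r - 3\<close> decides which \<open>t\<close> is worst.\<close>

lemma small_pair_bound:
  assumes c: "proper B c" and n: "card (c ` X) = n" "r < n"
    and uv: "u \<in> c ` X" "v \<in> c ` X" "u \<noteq> v"
    and pair: "card (cls X c u) + card (cls X c v) < r" and le: "card (cls X c u) \<le> card (cls X c v)"
  shows "1 \<le> card (cls X c u)" and "2 * card (cls X c u) < r"
    and "(int n - 3) * int r + 2 - int (card (cls X c u)) * (int n - int r - 3) \<le> int (card X)"
proof -
  define a where "a = (\<lambda>v. card (cls X c v))"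
  have fin: "finite (c ` X)" using finX by simp
  show a1: "1 \<le> card (cls X c u)"
    using uv finX by (auto simp: Suc_le_eq card_gt_0_iff)
  show "2 * card (cls X c u) < r" using pair le by simp
  define t where "t = a u"
  have t: "1 \<le> t" "t \<le> a v" "t + a v < r" using a1 le pair unfolding t_def a_def by auto
  have other: "r - t \<le> a w" if w: "w \<in> c ` X" "w \<noteq> u" "w \<noteq> v" for w
  proof (rule ccontr)
    assume "\<not> r - t \<le> a w"
    then have "{u, v} = {u, w}"
      using w uv pair by (intro merge_unique[OF c]) (auto simp: a_def t_def)
    then show False using w by auto
  qed
  have "(\<Sum>w\<in>c ` X - {u} - {v}. min (a w) (r - t)) = (\<Sum>w\<in>c ` X - {u} - {v}. r - t)"
    using other by (intro sum.cong refl) (auto simp: min_absorb2)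
  also have "\<dots> = (n - 2) * (r - t)"
    using uv fin n by (simp add: card_Diff_singleton numeral_2_eq_2)
  finally have "(\<Sum>w\<in>c ` X. min (a w) (r - t)) = t + a v + (n - 2) * (r - t)"
    using uv fin t by (simp add: sum.remove[of _ u] sum.remove[of _ v] t_def)
  then have "t + a v + (n - 2) * (r - t) + (r - 1) * (t - 1) < card X"
    using cover_bound[OF c, of "r - t"] n r4 t unfolding a_def by auto
  then have "t + t + (n - 2) * (r - t) + (r - 1) * (t - 1) < card X" using t by linarith
  then have "int (t + t + (n - 2) * (r - t) + (r - 1) * (t - 1)) + 1 \<le> int (card X)" by linarith
  moreover have "int (t + t + (n - 2) * (r - t) + (r - 1) * (t - 1)) =
      int t + int t + (int n - 2) * (int r - int t) + (int r - 1) * (int t - 1)"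
    using n r4 t by (simp add: of_nat_diff)
  ultimately show "(int n - 3) * int r + 2 - int (card (cls X c u)) * (int n - int r - 3) \<le> int (card X)"
    unfolding t_def a_def by (simp add: algebra_simps)
qed

text \<open>A recolouring with the same \<open>r - 1\<close> colours is proper if each class shrinks
  or stays below \<open>r\<close> vertices. Two classes below \<open>r\<close> could be merged or
  could exchange vertices; a class below \<open>r - 1\<close> could absorb another vertex. This
  leaves \<open>r - 2\<close> classes of size at least \<open>r\<close> and one of size at least
  \<open>r - 1\<close>.\<close>

lemma min_colours_bound:
  assumes "r - 1 \<in> S"
  shows "int r * (int r - 1) - 1 \<le> int (card X)"
proof -
  obtain c where c: "proper B c" "card (c ` X) = r - 1" using ex_colouring[OF assms] by blast
  define a where "a = (\<lambda>v. card (cls X c v))"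
  have fin: "finite (c ` X)" using finX by simp
  have recolour: "same_kernel X c c'"
    if im: "c' ` X \<subseteq> c ` X" and cl: "\<And>w. w \<in> c ` X \<Longrightarrow> cls X c' w \<subseteq> cls X c w \<or> card (cls X c' w) < r" for c'
  proof (rule few_colours_unique[OF c(1)])
    show "card (c' ` X) \<le> r - 1" using card_mono[OF fin im] c by simp
    show "proper B c'"
    proof (rule proper_few[OF c(1)])
      show "card (c' ` X) < r" using card_mono[OF fin im] c r4 by simp
      fix e assume e: "e \<in> B" and m: "monochromatic c' e"
      then obtain x where x: "x \<in> e" using edges(2)[OF e] r4 by fastforce
      have sub: "e \<subseteq> cls X c' (c' x)" using monochromaticD[OF m _ x] edges(1)[OF e] by blast
      then have "r \<le> card (cls X c' (c' x))" using card_mono[OF _ sub] edges(2)[OF e] finX by simp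
      moreover have "c' x \<in> c ` X" using im x edges(1)[OF e] by blast
      ultimately have "cls X c' (c' x) \<subseteq> cls X c (c' x)" using cl[of "c' x"] by linarith
      then have "c y = c' x" if "y \<in> e" for y using sub that by blast
      then show "degenerate c e" using monochromaticI[of e c "c' x"] by blast
    qed
  qed (use c in simp)
  have one_small: "u = v" if uv: "u \<in> c ` X" "v \<in> c ` X" "a u < r" "a v < r" for u v
  proof (rule ccontr)
    assume ne: "u \<noteq> v"
    obtain x y where xy: "x \<in> X" "c x = u" "y \<in> X" "c y = v" using uv by blast
    show False
    proof (cases "a u + a v < r")
      case True
      have "card (c ` X) - 1 \<in> S"
        using card_in[OF merge_proper(1)[OF c(1) uv(1,2) ne]] merge_proper(2)[OF c(1) uv(1,2) ne]
          True unfolding a_def by simp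
      then show False using S_ge c r4 by fastforce
    next
      case False
      define c' where "c' = c(x := v, y := u)"
      have "same_kernel X c c'"
      proof (rule recolour)
        show "c' ` X \<subseteq> c ` X" using uv unfolding c'_def by (auto split: if_splits)
        fix w assume "w \<in> c ` X"
        consider "w \<noteq> u" "w \<noteq> v" | "w = u" | "w = v" by blast
        then show "cls X c' w \<subseteq> cls X c w \<or> card (cls X c' w) < r"
        proof cases
          case 1 then show ?thesis using xy unfolding c'_def by auto
        next
          case 2
          have "cls X c' u = insert y (cls X c u - {x})" using xy ne unfolding c'_def by auto
          then have "card (cls X c' u) = a u" unfolding a_def
            using xy ne finX card_exchange[of "cls X c u" x y] by simp
          then show ?thesis using 2 uv by simp
        next
          case 3
          have "cls X c' v = insert x (cls X c v - {y})" using xy ne unfolding c'_def by auto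
          then have "card (cls X c' v) = a v" unfolding a_def
            using xy ne finX card_exchange[of "cls X c v" y x] by simp
          then show ?thesis using 3 uv by simp
        qed
      qed
      note sk = same_kernelD[OF this]
      \<comment> \<open>For two singletons the exchange would only rename colours, but here the
        sizes add up to at least \<open>r\<close>.\<close>
      have "\<exists>z\<in>X. z \<noteq> x \<and> z \<noteq> y \<and> (c z = u \<or> c z = v)"
      proof (rule ccontr)
        assume "\<not> ?thesis"
        then have "cls X c u \<subseteq> {x}" "cls X c v \<subseteq> {y}" using xy ne by auto
        then have "a u \<le> 1" "a v \<le> 1" unfolding a_def by (auto dest: card_mono[rotated])
        then show False using False r4 by simp
      qed
      then obtain z where z: "z \<in> X" "z \<noteq> x" "z \<noteq> y" "c z = u \<or> c z = v" by blast
      have "c' x = v" "c' z = c z" using z xy ne unfolding c'_def by auto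
      then show False using sk[OF xy(1) z(1)] z(4) xy(2) ne by presburger
    qed
  qed
  have ge: "r - 1 \<le> a v" if v: "v \<in> c ` X" for v
  proof (rule ccontr)
    assume lt: "\<not> r - 1 \<le> a v"
    have "\<exists>u\<in>c ` X. u \<noteq> v"
    proof (rule ccontr)
      assume "\<not> ?thesis"
      then have "card (c ` X) \<le> 1" using card_mono[of "{v}" "c ` X"] by auto
      then show False using c r4 by simp
    qed
    then obtain u where u: "u \<in> c ` X" "u \<noteq> v" by blast
    then have au: "r \<le> a u" using one_small[of u v] v lt by fastforce
    have "\<not> card (cls X c u) \<le> Suc 0" using au r4 unfolding a_def by simp
    then obtain x y where xy: "x \<in> cls X c u" "y \<in> cls X c u" "x \<noteq> y"
      using finX card_le_Suc0_iff_eq[of "cls X c u"] by auto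
    define c' where "c' = c(x := v)"
    have "same_kernel X c c'"
    proof (rule recolour)
      show "c' ` X \<subseteq> c ` X" using v unfolding c'_def by (auto split: if_splits)
      fix w assume "w \<in> c ` X"
      show "cls X c' w \<subseteq> cls X c w \<or> card (cls X c' w) < r"
      proof (cases "w = v")
        case True
        have "cls X c' v = insert x (cls X c v)" using xy u unfolding c'_def by auto
        then have "card (cls X c' v) \<le> a v + 1" unfolding a_def by (simp add: card_insert_if finX)
        then have "card (cls X c' v) < r" using lt by linarith
        then show ?thesis using True by simp
      next
        case False then show ?thesis unfolding c'_def by auto
      qed
    qed
    from same_kernelD[OF this, of x y] xy u show False unfolding c'_def by auto
  qed
  have "\<exists>w\<in>c ` X. \<forall>v\<in>c ` X - {w}. r \<le> a v"
  proof (cases "\<exists>w\<in>c ` X. a w < r")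
    case True
    then obtain w where "w \<in> c ` X" "a w < r" by blast
    then have "\<forall>v\<in>c ` X - {w}. r \<le> a v" using one_small[of w] by force
    then show ?thesis using \<open>w \<in> c ` X\<close> by blast
  next
    case False
    moreover have "c ` X \<noteq> {}" using c r4 by auto
    ultimately show ?thesis by force
  qed
  then obtain w where w: "w \<in> c ` X" "\<And>v. v \<in> c ` X - {w} \<Longrightarrow> r \<le> a v" by blast
  have "card X = a w + (\<Sum>v\<in>c ` X - {w}. a v)"
    using sum_card_cls[OF finX fin, of c] sum.remove[OF fin w(1), of a] unfolding a_def by simp
  moreover have "(\<Sum>v\<in>c ` X - {w}. r) \<le> (\<Sum>v\<in>c ` X - {w}. a v)" using w by (intro sum_mono) auto
  moreover have "(\<Sum>v\<in>c ` X - {w}. r) = (r - 2) * r" using w fin c by (simp add: card_Diff_singleton numeral_2_eq_2)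
  ultimately have "(r - 1) + (r - 2) * r \<le> card X" using ge[OF w(1)] by linarith
  then have "int ((r - 1) + (r - 2) * r) \<le> int (card X)" by linarith
  moreover have "int ((r - 1) + (r - 2) * r) = (int r - 1) + (int r - 2) * int r"
    using r4 by (simp add: of_nat_diff)
  ultimately show ?thesis by (simp add: algebra_simps)
qed

end

subsection \<open>Transversals and rows\<close>

text \<open>The source of information about colourings with at least \<open>r\<close> colours: every
  small rainbow pattern occurs in a degenerate \<open>r\<close>-set.\<close>

lemma extend_transversal:
  fixes c :: "'a \<Rightarrow> nat"
  assumes "finite X" "E \<subseteq> X" "inj_on c E" "card E \<le> r" "r \<le> card (c ` X)"
  shows "\<exists>e. E \<subseteq> e \<and> e \<subseteq> X \<and> inj_on c e \<and> card e = r"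
proof -
  have finE: "finite E" using assms finite_subset by blast
  have "card (c ` X - c ` E) = card (c ` X) - card E"
    using assms finE by (subst card_Diff_subset) (auto simp: card_image)
  then have "r - card E \<le> card (c ` X - c ` E)" using assms(5) by simp
  then obtain V where V: "V \<subseteq> c ` X - c ` E" "card V = r - card E"
    by (rule obtain_subset_with_card_n)
  define T where "T = inv_into X c ` V"
  have cT: "c (inv_into X c v) = v" if "v \<in> V" for v using V that f_inv_into_f[of v c X] by blast
  have injT: "inj_on (inv_into X c) V" by (rule inj_on_inverseI[of _ c]) (rule cT)
  have "c ` T = V" unfolding T_def using cT by force
  have TX: "T \<subseteq> X" unfolding T_def using V by (auto intro: inv_into_into)
  have "inj_on c T" unfolding T_def by (rule inj_onI) (use cT in auto)
  then have "inj_on c (E \<union> T)"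
    using assms(3) V \<open>c ` T = V\<close> unfolding inj_on_Un by blast
  moreover have "E \<inter> T = {}" using V \<open>c ` T = V\<close> by blast
  moreover have "finite V" using V assms(1) finite_subset by blast
  ultimately have "inj_on c (E \<union> T) \<and> card (E \<union> T) = r"
    using V finE card_image[OF injT] assms(4) unfolding T_def by (simp add: card_Un_disjoint)
  then show ?thesis using TX assms(2) by blast
qed

lemma not_inj_few_values:
  fixes f :: "'a \<Rightarrow> nat"
  assumes "\<And>x. x \<in> e \<Longrightarrow> f x < r - 1" "card e = r" "0 < r"
  shows "\<not> inj_on f e"
proof
  assume "inj_on f e"
  then have "card (f ` e) = r" using assms(2) by (simp add: card_image)
  moreover have "card (f ` e) \<le> r - 1" using card_mono[of "{..<r - 1}" "f ` e"] assms(1) by auto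
  ultimately show False using assms(3) by simp
qed

lemma two_elements:
  assumes "2 \<le> card W"
  shows "\<exists>x\<in>W. \<exists>y\<in>W. x \<noteq> y"
proof (rule ccontr)
  assume "\<not> ?thesis"
  then have "card W \<le> 1" by (cases "finite W") (auto simp: card_le_Suc0_iff_eq)
  then show False using assms by simp
qed

lemma third_colour:
  fixes c :: "'a \<Rightarrow> nat"
  assumes "3 \<le> card (c ` X)"
  shows "\<exists>w\<in>X. c w \<noteq> p \<and> c w \<noteq> q"
proof (rule ccontr)
  assume "\<not> ?thesis"
  then have "card (c ` X) \<le> card {p, q}" by (intro card_mono) auto
  also have "\<dots> \<le> 2" by (simp add: card_insert_if)
  finally show False using assms by simp
qed

lemma transversal_union:
  fixes c :: "'a \<Rightarrow> nat" and a :: "nat \<Rightarrow> 'a"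
  assumes "finite E" "finite D" "inj_on c E"
    and D: "\<And>k l. k \<in> D \<Longrightarrow> l \<in> D \<Longrightarrow> c (a k) = c (a l) \<Longrightarrow> k = l"
    and ED: "\<And>x l. x \<in> E \<Longrightarrow> l \<in> D \<Longrightarrow> c x \<noteq> c (a l)"
  shows "inj_on c (E \<union> a ` D)" "card (E \<union> a ` D) = card E + card D"
proof -
  have "inj_on a D" using D by (intro inj_onI) auto
  moreover have "E \<inter> a ` D = {}" using ED by blast
  ultimately show "card (E \<union> a ` D) = card E + card D"
    using assms(1,2) by (simp add: card_Un_disjoint card_image)
  have "inj_on c (a ` D)"
  proof (rule inj_onI)
    fix x y assume "x \<in> a ` D" "y \<in> a ` D" "c x = c y"
    then obtain k l where kl: "k \<in> D" "x = a k" "l \<in> D" "y = a l" "c (a k) = c (a l)" by blast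
    then show "x = y" using D by blast
  qed
  then show "inj_on c (E \<union> a ` D)" using assms(3) ED unfolding inj_on_Un by blast
qed

lemma core_total:
  fixes g :: "'a \<Rightarrow> nat"
  assumes "finite X" "0 < r" "\<And>k. k < r - 1 \<Longrightarrow> card (cls X g k) = r - 1 \<or> card (cls X g k) = r"
  shows "card {x \<in> X. g x < r - 1} = (r - 1) * (r - 1) + card {k. k < r - 1 \<and> card (cls X g k) = r}"
proof -
  have "card {x \<in> X. g x < r - 1} = (\<Sum>k<r - 1. card (cls {x \<in> X. g x < r - 1} g k))"
    by (subst sum_card_cls) (use assms(1) in auto)
  also have "\<dots> = (\<Sum>k<r - 1. (r - 1) + (if card (cls X g k) = r then 1 else 0))"
  proof (rule sum.cong[OF refl])
    fix k assume k: "k \<in> {..<r - 1}"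
    then have "cls {x \<in> X. g x < r - 1} g k = cls X g k" by auto
    then show "card (cls {x \<in> X. g x < r - 1} g k) = (r - 1) + (if card (cls X g k) = r then 1 else 0)"
      using assms(2) assms(3)[of k] k by auto
  qed
  also have "\<dots> = (r - 1) * (r - 1) + card {k \<in> {..<r - 1}. card (cls X g k) = r}"
    by (simp only: sum.distrib) (simp add: sum.If_cases Int_def)
  finally show ?thesis by simp
qed

text \<open>A core of \<open>n * n + b\<close> vertices is distributed to at most \<open>n\<close> rows of at most \<open>n + 1\<close>
  vertices each; if at most \<open>b + 1\<close> rows are overfull, there are almost no deficient rows.\<close>

lemma row_deficit:
  assumes V: "finite V" "card V \<le> n" and n: "2 \<le> n"
    and le: "\<And>v. v \<in> V \<Longrightarrow> f v \<le> n + 1" and sum: "sum f V = n * n + b"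
    and over: "card {v \<in> V. n < f v} \<le> b + 1"
  shows "card V = n" and "(\<Sum>v\<in>V. n - f v) + b = card {v \<in> V. n < f v}"
proof -
  \<comment> \<open>Subtraction truncates, so \<open>n - f v\<close> is the deficit of a row and
    vanishes for an overfull one.\<close>
  have "(\<Sum>v\<in>V. (n - f v) + f v) = (\<Sum>v\<in>V. n + (if n < f v then 1 else 0))"
    using le by (intro sum.cong refl) (fastforce simp: le_Suc_eq)
  moreover have "(\<Sum>v\<in>V. if n < f v then 1 else 0) = card {v \<in> V. n < f v}"
    using V by (simp add: sum.If_cases Int_def)
  ultimately have eq: "(\<Sum>v\<in>V. n - f v) + (n * n + b) = n * card V + card {v \<in> V. n < f v}"
    using sum by (simp add: sum.distrib)
  \<comment> \<open>A missing row costs \<open>n\<close> places, while the overfull rows gain at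
    most one place beyond \<open>b\<close>.\<close>
  show cV: "card V = n"
  proof (rule ccontr)
    assume "card V \<noteq> n"
    then have "card V \<le> n - 1" using V by simp
    then have "n * card V \<le> n * (n - 1)" by simp
    moreover have "n * (n - 1) + n = n * n" using n by (simp add: algebra_simps)
    ultimately show False using eq over n by linarith
  qed
  show "(\<Sum>v\<in>V. n - f v) + b = card {v \<in> V. n < f v}" using eq cV by simp
qed

text \<open>What the two constructions below have in common: the colours below \<open>r - 1\<close> of \<open>g\<close> are the core
  classes, which the colourings in \<open>F\<close> respect up to the exceptional vertices in \<open>E\<close>, and \<open>G k\<close> contains
  all vertices which may get the core colour \<open>k\<close>.\<close>

locale core_frame =
  fixes X :: "'a set" and g :: "'a \<Rightarrow> nat" and r :: nat and E :: "'a set"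
    and F :: "('a \<Rightarrow> nat) set" and G :: "nat \<Rightarrow> 'a set"
  assumes finite_X: "finite X" and r_ge: "4 \<le> r"
    and core_card: "k < r - 1 \<Longrightarrow> r - 1 \<le> card (cls X g k)"
    and core_elem: "k < r - 1 \<Longrightarrow> \<exists>x\<in>X. g x = k \<and> x \<notin> E"
    and F_core: "f \<in> F \<Longrightarrow> g x < r - 1 \<Longrightarrow> x \<notin> E \<Longrightarrow> f x = g x"
    and F_G: "f \<in> F \<Longrightarrow> x \<in> X \<Longrightarrow> f x < r - 1 \<Longrightarrow> x \<in> G (f x)"
    and G_core: "x \<in> X \<Longrightarrow> x \<in> G (g x)"
    and separate: "j < r - 1 \<Longrightarrow> \<exists>k<r - 1. G j \<inter> G k = {} \<and> cls X g k \<inter> E = {}"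
begin

lemma core_subset: "k < r - 1 \<Longrightarrow> \<exists>W\<subseteq>cls X g k. card W = r - 1"
  using core_card[of k] by (metis (no_types) obtain_subset_with_card_n)

text \<open>An unexceptional representative of core class \<open>k\<close>, so that every member of
  \<open>F\<close> gives it the colour \<open>k\<close>.\<close>

definition a :: "nat \<Rightarrow> 'a" where "a k = (SOME x. x \<in> X \<and> g x = k \<and> x \<notin> E)"

lemma a: "k < r - 1 \<Longrightarrow> a k \<in> X" "k < r - 1 \<Longrightarrow> g (a k) = k" "k < r - 1 \<Longrightarrow> a k \<notin> E"
  unfolding a_def using someI_ex[of "\<lambda>x. x \<in> X \<and> g x = k \<and> x \<notin> E"] core_elem[of k] by auto

end

locale core_colouring = core_frame +
  fixes c :: "'a \<Rightarrow> nat"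
  assumes H: "e \<subseteq> X \<Longrightarrow> card e = r \<Longrightarrow> degenerate c e \<Longrightarrow> \<exists>f\<in>F. degenerate f e"
begin

text \<open>The core part of a colour class of \<open>c\<close>. Such classes are called rows below,
  as opposed to the core classes of \<open>g\<close>.\<close>

definition K :: "nat \<Rightarrow> 'a set" where "K v = {x \<in> X. g x < r - 1 \<and> c x = v}"

lemma finK: "finite (K v)" and K_X: "K v \<subseteq> X" unfolding K_def using finite_X by auto

lemma K_mono: "W \<subseteq> K (c z) \<Longrightarrow> monochromatic c (insert z W)"
  by (intro monochromaticI[of _ _ "c z"]) (auto simp: K_def)

text \<open>Some \<open>f\<close> in \<open>F\<close> is degenerate on \<open>insert z W\<close>. It
  is constant on \<open>W\<close>, so it cannot be rainbow and gives the colour \<open>k\<close> to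
  \<open>z\<close> as well.\<close>

lemma mono_core:
  assumes W: "W \<subseteq> cls X g k" "card W = r - 1" and k: "k < r - 1"
    and z: "z \<in> X" "z \<notin> W" and m: "monochromatic c (insert z W)" and E: "W \<inter> E = {}"
  shows "z \<in> G k"
proof -
  have "finite W" using W finite_X finite_subset by fastforce
  then have "card (insert z W) = r" using W z r_ge by simp
  then obtain f where f: "f \<in> F" "degenerate f (insert z W)"
    using H[of "insert z W"] m z W by blast
  have "2 \<le> card W" using W r_ge by simp
  from two_elements[OF this] obtain x y where xy: "x \<in> W" "y \<in> W" "x \<noteq> y" by blast
  have "x \<notin> E" "y \<notin> E" using xy E by auto
  then have fk: "f x = k" "f y = k" using xy W F_core[OF f(1)] k by auto
  then have "\<not> inj_on f (insert z W)" using xy unfolding inj_on_def by blast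
  then have "monochromatic f (insert z W)" using f(2) by blast
  from monochromaticD[OF this, of z x] have "f z = k" using xy(1) fk(1) by blast
  then show ?thesis using F_G[OF f(1) z(1)] k by auto
qed

text \<open>A rainbow \<open>r\<close>-set through \<open>u\<close>, \<open>v\<close>,
  \<open>w\<close> is degenerate for some \<open>f\<close>; as \<open>f\<close> does not separate
  \<open>u\<close> and \<open>v\<close>, it is constant there.\<close>

lemma other_in_G:
  assumes many: "r \<le> card (c ` X)"
    and uv: "u \<in> X" "v \<in> X" "g u = g v" "g u < r - 1" "u \<notin> E" "v \<notin> E" "c u \<noteq> c v"
    and w: "w \<in> X" "c w \<noteq> c u" "c w \<noteq> c v"
  shows "w \<in> G (g u)"
proof -
  have "inj_on c {u, v, w}" using uv w by auto
  moreover have "card {u, v, w} \<le> r" using r_ge by (simp add: card_insert_if)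
  ultimately obtain e where e: "{u, v, w} \<subseteq> e" "e \<subseteq> X" "inj_on c e" "card e = r"
    using extend_transversal[of X "{u, v, w}" c r] finite_X many uv w by blast
  obtain f where f: "f \<in> F" "degenerate f e" using H e by blast
  have fu: "f u = g u" "f v = g u" using F_core[OF f(1)] uv by auto
  then have "\<not> inj_on f e" using inj_onD[of f e u v] e(1) uv(7) by auto
  then have "f w = f u" using f(2) e(1) monochromaticD[of f e w u] by blast
  then show ?thesis using F_G[OF f(1) w(1)] fu uv by auto
qed

text \<open>If \<open>u\<close> and \<open>v\<close> were separated, all vertices of a third colour
  would lie in \<open>G (g u)\<close>. For a class \<open>k\<close> with \<open>G k\<close> disjoint
  from it this leaves only the colours of \<open>u\<close> and \<open>v\<close>, and if it were
  split too, third colours would lie in \<open>G k\<close> as well. So class \<open>k\<close> has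
  the colour of \<open>u\<close> or of \<open>v\<close>, which drags that vertex into
  \<open>G k\<close>.\<close>

lemma unsplit:
  assumes many: "r \<le> card (c ` X)"
    and uv: "u \<in> X" "v \<in> X" "g u = g v" "g u < r - 1" "u \<notin> E" "v \<notin> E"
  shows "c u = c v"
proof (rule ccontr)
  assume ne: "c u \<noteq> c v"
  obtain k where k: "k < r - 1" "G (g u) \<inter> G k = {}" "cls X g k \<inter> E = {}"
    using separate[OF uv(4)] by blast
  have sub: "c x = c u \<or> c x = c v" if x: "x \<in> X" "g x = k" for x
  proof (rule ccontr)
    assume "\<not> ?thesis"
    then have "x \<in> G (g u)" using other_in_G[OF many uv ne x(1)] by blast
    then show False using k(2) x G_core[OF x(1)] by blast
  qed
  have same: "c x = c y" if xy: "x \<in> X" "g x = k" "y \<in> X" "g y = k" for x y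
  proof (rule ccontr)
    assume nxy: "c x \<noteq> c y"
    have "3 \<le> card (c ` X)" using many r_ge by simp
    then obtain w where w: "w \<in> X" "c w \<noteq> c u" "c w \<noteq> c v" using third_colour by blast
    have "c w \<noteq> c x" "c w \<noteq> c y" using w sub[OF xy(1,2)] sub[OF xy(3,4)] by auto
    moreover have "x \<notin> E" "y \<notin> E" using xy k(3) by auto
    ultimately have "w \<in> G (g u)" "w \<in> G k"
      using other_in_G[OF many uv ne w] other_in_G[OF many, of x y w] xy nxy k(1) w by auto
    then show False using k(2) by blast
  qed
  obtain W where W: "W \<subseteq> cls X g k" "card W = r - 1" using core_subset[OF k(1)] by blast
  have "W \<noteq> {}" using W(2) r_ge by auto
  then obtain x where x: "x \<in> W" by blast
  then obtain t where t: "t \<in> {u, v}" "c x = c t" using sub[of x] W by blast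
  have tG: "t \<in> X" "t \<in> G (g u)" using t uv G_core[of u] G_core[of v] by auto
  have "monochromatic c (insert t W)"
    using same[of _ x] x W t(2) by (intro monochromaticI[of _ _ "c t"]) auto
  moreover have "t \<notin> W" using W tG k(2) G_core[of t] by auto
  moreover have "W \<inter> E = {}" using W k(3) by blast
  ultimately have "t \<in> G k" using mono_core[OF W k(1) tG(1)] by blast
  then show False using tG k(2) by blast
qed

end

subsection \<open>Block constructions\<close>

text \<open>The top colouring \<open>g\<close> has the core classes \<open>0, \<dots>, r - 2\<close> and the blocks \<open>r - 1, \<dots>, N - 1\<close>; a moved
  vertex \<open>x\<close> gets the core colour \<open>d x\<close>. If \<open>mg\<close> holds, merging the last two blocks yields one more
  colouring.\<close>

locale block_frame =
  fixes X :: "'a set" and g d :: "'a \<Rightarrow> nat" and r N :: nat and S :: "nat set" and mg :: bool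
  assumes finX: "finite X"
    and r4: "4 \<le> r" and rN: "r \<le> N"
    and gN: "x \<in> X \<Longrightarrow> g x < N"
    and core: "k < r - 1 \<Longrightarrow> card (cls X g k) = r - 1 \<or> card (cls X g k) = r"
    and big: "\<exists>k<r - 1. card (cls X g k) = r"
    and block: "r - 1 \<le> k \<Longrightarrow> k < N \<Longrightarrow> 1 \<le> card (cls X g k) \<and> card (cls X g k) < r"
    and S: "S \<subseteq> {r - 1..N}" "N \<in> S"
    and d: "x \<in> X \<Longrightarrow> r - 1 \<le> g x \<Longrightarrow> d x < r - 1"
    and moved: "n \<in> S \<Longrightarrow> n \<le> k \<Longrightarrow> k < N \<Longrightarrow> r < N \<Longrightarrow>
      2 \<le> card (cls X g k) \<and> card (cls X g k) < r - 1 \<and> inj_on d (cls X g k)"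
    and pair: "r - 1 \<le> k \<Longrightarrow> k < k' \<Longrightarrow> k' < N \<Longrightarrow> \<not> (mg \<and> k = N - 2 \<and> k' = N - 1) \<Longrightarrow>
      r \<le> card (cls X g k) + card (cls X g k')"
    and hit: "r - 1 \<in> S \<Longrightarrow> k < r - 1 \<Longrightarrow> k' < r - 1 \<Longrightarrow> k \<noteq> k' \<Longrightarrow>
      card (cls X g k) = r - 1 \<Longrightarrow> card (cls X g k') = r - 1 \<Longrightarrow>
      \<exists>z\<in>X. r - 1 \<le> g z \<and> (d z = k \<or> d z = k')"
    and mg: "mg \<Longrightarrow> r < N \<and> N - 1 \<notin> S"
begin

definition col :: "nat \<Rightarrow> 'a \<Rightarrow> nat" where
  "col n x = (if g x < n then g x else d x)"

definition mrg :: "'a \<Rightarrow> nat" where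
  "mrg x = (if g x = N - 1 then N - 2 else g x)"

definition F :: "('a \<Rightarrow> nat) set" where
  "F = col ` S \<union> (if mg then {mrg} else {})"

text \<open>A block vertex counts only if some \<open>col n\<close> really distributes its block. In
  this way a coincidence of colours yields an element of \<open>S\<close>.\<close>

definition G :: "nat \<Rightarrow> 'a set" where
  "G k = {x \<in> X. g x = k \<or> r - 1 \<le> g x \<and> d x = k \<and> (\<exists>n\<in>S. n \<le> g x)}"

lemma F_cases: "f \<in> F \<Longrightarrow> (\<And>n. n \<in> S \<Longrightarrow> f = col n \<Longrightarrow> P) \<Longrightarrow> (mg \<Longrightarrow> f = mrg \<Longrightarrow> P) \<Longrightarrow> P"
  unfolding F_def by (auto split: if_splits)

lemma S_le: "n \<in> S \<Longrightarrow> r - 1 \<le> n \<and> n \<le> N" using S by auto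

lemma F_core_eq: "f \<in> F \<Longrightarrow> g x < r - 1 \<Longrightarrow> f x = g x"
  by (erule F_cases) (use S_le mg in \<open>auto simp: col_def mrg_def dest: order.strict_trans2\<close>)

lemma F_low:
  assumes f: "f \<in> F" and x: "x \<in> X" "r - 1 \<le> g x" "f x < r - 1"
  shows "f x = d x \<and> (\<exists>n\<in>S. n \<le> g x)"
proof (rule F_cases[OF f])
  fix n assume n: "n \<in> S" "f = col n"
  then have "n \<le> g x" using S_le[OF n(1)] x by (simp add: col_def split: if_splits)
  then show ?thesis using n by (auto simp: col_def)
next
  assume "mg" "f = mrg"
  then show ?thesis using mg x by (simp add: mrg_def split: if_splits)
qed

text \<open>Kept and merged blocks are monochromatic, so only a distributed block can be
  split.\<close>

lemma F_split:
  assumes f: "f \<in> F" and xy: "g x = g y" "f x \<noteq> f y"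
  shows "f x = d x \<and> f y = d y \<and> (\<exists>n\<in>S. f = col n \<and> n \<le> g x)"
proof (rule F_cases[OF f])
  fix n assume n: "n \<in> S" "f = col n"
  then have "n \<le> g x" using xy by (simp add: col_def split: if_splits)
  then show ?thesis using n xy by (auto simp: col_def)
qed (use xy in \<open>auto simp: mrg_def split: if_splits\<close>)

lemma F_value: "f \<in> F \<Longrightarrow> x \<in> X \<Longrightarrow> f x < r - 1 \<Longrightarrow> x \<in> G (f x)"
  unfolding G_def using F_core_eq[of f x] F_low[of f x] by (cases "g x < r - 1") auto

sublocale core_frame X g r "{}" F G
proof
  show card: "r - 1 \<le> card (cls X g k)" if "k < r - 1" for k using core[OF that] by auto
  show "\<exists>x\<in>X. g x = k \<and> x \<notin> {}" if "k < r - 1" for k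
  proof -
    have "card (cls X g k) \<noteq> 0" using card[OF that] r4 by simp
    then show ?thesis by (auto simp: card_eq_0_iff)
  qed
  \<comment> \<open>Any other core class will do, because \<open>d\<close> assigns a vertex to only
    one of them.\<close>
  show "\<exists>k<r - 1. G j \<inter> G k = {} \<and> cls X g k \<inter> {} = {}" if "j < r - 1" for j
    using that r4 by (intro exI[of _ "if j = 0 then 1 else 0"]) (auto simp: G_def)
qed (use finX r4 F_core_eq F_value in \<open>auto simp: G_def\<close>)

end

locale block_frame_colouring = block_frame +
  fixes c :: "'a \<Rightarrow> nat"
  assumes H: "e \<subseteq> X \<Longrightarrow> card e = r \<Longrightarrow> degenerate c e \<Longrightarrow> \<exists>f\<in>F. degenerate f e"
begin

sublocale core_colouring X g r "{}" F G c
  by unfold_locales (rule H)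

section \<open>Block frames: colourings with at least \<open>r\<close> colours\<close>

context
  assumes many: "r \<le> card (c ` X)"
begin

lemmas core_unsplit = unsplit[OF many]

text \<open>Core class \<open>k\<close> is unsplit and forms an \<open>r\<close>-set with
  \<open>z\<close>, so by \<open>mono_core\<close> only vertices that some colouring in
  \<open>F\<close> moves to \<open>k\<close> can join it.\<close>

lemma row_core:
  assumes k: "k < r - 1" and z: "z \<in> X" "c z = c (a k)" "g z \<noteq> k"
  shows "r - 1 \<le> g z" "d z = k" "\<exists>n\<in>S. n \<le> g z"
proof -
  obtain W where W: "W \<subseteq> cls X g k" "card W = r - 1" using core_subset[OF k(1)] by blast
  have "c x = c (a k)" if "x \<in> W" for x
    using core_unsplit[of x "a k"] that W a[OF k] k by auto
  then have "monochromatic c (insert z W)"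
    using z by (intro monochromaticI[of _ _ "c (a k)"]) auto
  moreover have "z \<notin> W" using W z by auto
  ultimately have "z \<in> G k" using mono_core[OF W k z(1)] by blast
  then show "r - 1 \<le> g z" "d z = k" "\<exists>n\<in>S. n \<le> g z" using z unfolding G_def by auto
qed

lemma inj_ca: "k < r - 1 \<Longrightarrow> l < r - 1 \<Longrightarrow> c (a k) = c (a l) \<longleftrightarrow> k = l"
  using row_core(1)[of k "a l"] a by fastforce

text \<open>Every \<open>f\<close> gives core colours to the representatives, and there are only
  \<open>r - 1\<close> of these colours; so if \<open>f\<close> is rainbow, some vertex of
  \<open>E\<close> has a colour outside the core.\<close>

lemma mixed_transversal:
  assumes E: "E \<subseteq> X" "\<And>x. x \<in> E \<Longrightarrow> r - 1 \<le> g x" "inj_on c E"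
    and D: "D \<subseteq> {..<r - 1}" "\<And>x l. x \<in> E \<Longrightarrow> l \<in> D \<Longrightarrow> c x \<noteq> c (a l)" "card E + card D = r"
  shows "\<exists>f\<in>F. (inj_on f E \<and> (\<exists>x\<in>E. r - 1 \<le> f x)) \<or> (\<forall>x\<in>E. \<forall>l\<in>D. f x = l)"
proof -
  have fin: "finite E" "finite D" using E D finX finite_subset by blast+
  have gD: "g (a l) = l" "a l \<in> X" if "l \<in> D" for l using a[of l] D(1) that by auto
  have tr: "inj_on c (E \<union> a ` D)" "card (E \<union> a ` D) = r"
    using transversal_union[OF fin E(3), of a] inj_ca D by auto
  then obtain f where f: "f \<in> F" "degenerate f (E \<union> a ` D)"
    using H[of "E \<union> a ` D"] E(1) gD(2) by blast
  have fa: "f (a l) = l" if "l \<in> D" for l using F_core[OF f(1), of "a l"] gD[OF that] D(1) that by auto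
  from f(2) show ?thesis
  proof
    assume inj: "inj_on f (E \<union> a ` D)"
    have "\<exists>x\<in>E. r - 1 \<le> f x"
    proof (rule ccontr)
      assume "\<not> ?thesis"
      then have "f x < r - 1" if "x \<in> E \<union> a ` D" for x using that fa D(1) by fastforce
      then show False using not_inj_few_values[OF _ tr(2)] inj r4 by simp
    qed
    then show ?thesis using f(1) inj inj_on_Un by blast
  next
    assume m: "monochromatic f (E \<union> a ` D)"
    have "f x = l" if "x \<in> E" "l \<in> D" for x l
      using monochromaticD[OF m, of x "a l"] that fa by simp
    then show ?thesis using f(1) by blast
  qed
qed

text \<open>The vertices that \<open>c\<close> leaves in a block; the next two lemmas show that this
  is a union of entire blocks.\<close>

definition U :: "'a set" where
  "U = {x \<in> X. r - 1 \<le> g x \<and> c x \<notin> c ` a ` {..<r - 1}}"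

text \<open>The only core class that can share the colour of \<open>z\<close> is \<open>d z\<close>.
  With all other representatives, \<open>z\<close> and \<open>w\<close> form a rainbow
  \<open>r\<close>-set; but an \<open>f\<close> that separates two vertices of a block sends both to
  the core.\<close>

lemma U_block:
  assumes w: "w \<in> U" and z: "z \<in> X" "g z = g w"
  shows "c z = c w"
proof (rule ccontr)
  assume ne: "c z \<noteq> c w"
  define D where "D = {..<r - 1} - {d z}"
  have wX: "w \<in> X" "r - 1 \<le> g w" and cw: "\<And>l. l < r - 1 \<Longrightarrow> c w \<noteq> c (a l)" using w unfolding U_def by auto
  have dz: "d z < r - 1" using d z wX by simp
  have cD: "card D = r - 2" unfolding D_def using dz by (simp add: card_Diff_singleton numeral_2_eq_2)
  have "\<exists>f\<in>F. (inj_on f {z, w} \<and> (\<exists>x\<in>{z, w}. r - 1 \<le> f x)) \<or> (\<forall>x\<in>{z, w}. \<forall>l\<in>D. f x = l)"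
  proof (rule mixed_transversal)
    show "{z, w} \<subseteq> X" "inj_on c {z, w}" "D \<subseteq> {..<r - 1}" using z wX ne unfolding D_def by auto
    show "r - 1 \<le> g x" if "x \<in> {z, w}" for x using that z wX by auto
    show "card {z, w} + card D = r" using ne cD r4 by (auto simp: card_insert_if)
    show "c x \<noteq> c (a l)" if "x \<in> {z, w}" "l \<in> D" for x l
      using that cw[of l] row_core(2)[of l z] z wX unfolding D_def by auto
  qed
  then obtain f where f: "f \<in> F" "(inj_on f {z, w} \<and> (\<exists>x\<in>{z, w}. r - 1 \<le> f x)) \<or> (\<forall>x\<in>{z, w}. \<forall>l\<in>D. f x = l)"
    by blast
  have "2 \<le> card D" using cD r4 by simp
  from two_elements[OF this] obtain l l' where "l \<in> D" "l' \<in> D" "l \<noteq> l'" by blast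
  then have "\<not> (\<forall>x\<in>{z, w}. \<forall>l\<in>D. f x = l)" by (metis insertI1)
  then have inj: "inj_on f {z, w}" "\<exists>x\<in>{z, w}. r - 1 \<le> f x" using f(2) by blast+
  then have "f z \<noteq> f w" using ne by auto
  then have "f z = d z" "f w = d w" using F_split[OF f(1) z(2)] by auto
  then show False using inj(2) dz d[OF wX] by auto
qed

lemma U_closed: "w \<in> U \<Longrightarrow> z \<in> X \<Longrightarrow> g z = g w \<Longrightarrow> z \<in> U"
  using U_block[of w z] unfolding U_def by auto

text \<open>Two vertices \<open>x\<close>, \<open>y\<close> of the block of \<open>z\<close> go to
  different core classes, and with \<open>w\<close> and the representatives of the remaining classes
  they form a rainbow \<open>r\<close>-set. The \<open>f\<close> responsible for it distributes the
  block of \<open>z\<close> but not that of \<open>w\<close>, so it is \<open>col n\<close> for the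
  desired \<open>n\<close>.\<close>

lemma moved_above:
  assumes w: "w \<in> U" and z: "z \<in> X - U" "r - 1 \<le> g z"
  shows "\<exists>n\<in>S. g w < n \<and> n \<le> g z"
proof -
  have wX: "w \<in> X" "r - 1 \<le> g w" and cw: "\<And>l. l < r - 1 \<Longrightarrow> c w \<noteq> c (a l)" using w unfolding U_def by auto
  have gne: "g z \<noteq> g w" using U_closed[OF w] z by auto
  have rN': "r < N" using gne gN[of z] gN[of w] z wX by auto
  have inrow: "\<exists>k<r - 1. c x = c (a k) \<and> d x = k \<and> (\<exists>n\<in>S. n \<le> g x)" if x: "x \<in> X" "g x = g z" for x
  proof -
    have "x \<notin> U" using U_closed[of x z] x z by auto
    then obtain k where k: "k < r - 1" "c x = c (a k)" using x z unfolding U_def by auto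
    moreover have "g x \<noteq> k" using x z k by auto
    ultimately show ?thesis using row_core[of k x] x by auto
  qed
  obtain n0 where n0: "n0 \<in> S" "n0 \<le> g z" using inrow[of z] z by blast
  have mv: "2 \<le> card (cls X g (g z))" "inj_on d (cls X g (g z))"
    using moved[OF n0(1,2) gN rN'] z by auto
  obtain x y where xy: "x \<in> X" "g x = g z" "y \<in> X" "g y = g z" "x \<noteq> y" using two_elements[OF mv(1)] by blast
  have dxy: "d x \<noteq> d y" using mv(2) xy unfolding inj_on_def by blast
  have row: "d x < r - 1" "c x = c (a (d x))" "d y < r - 1" "c y = c (a (d y))"
    using inrow[OF xy(1,2)] inrow[OF xy(3,4)] by auto
  have cxy: "c x \<noteq> c y" using row dxy inj_ca by metis
  define D where "D = {..<r - 1} - {d x, d y}"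
  have cD: "card D = r - 3" unfolding D_def using row dxy by (simp add: card_Diff_subset)
  have wxy: "c w \<noteq> c x" "c w \<noteq> c y" using cw row by auto
  have "\<exists>f\<in>F. (inj_on f {x, y, w} \<and> (\<exists>t\<in>{x, y, w}. r - 1 \<le> f t)) \<or> (\<forall>t\<in>{x, y, w}. \<forall>l\<in>D. f t = l)"
  proof (rule mixed_transversal)
    show "{x, y, w} \<subseteq> X" "D \<subseteq> {..<r - 1}" using xy wX unfolding D_def by auto
    show "inj_on c {x, y, w}" using cxy wxy by auto
    show "r - 1 \<le> g t" if "t \<in> {x, y, w}" for t using that xy z wX by auto
    have "card {x, y, w} = 3" using cxy wxy by (auto simp: card_insert_if)
    then show "card {x, y, w} + card D = r" using cD r4 by simp
    show "c t \<noteq> c (a l)" if t: "t \<in> {x, y, w}" "l \<in> D" for t l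
    proof -
      have l: "l < r - 1" "l \<noteq> d x" "l \<noteq> d y" using t unfolding D_def by auto
      then show ?thesis using t(1) cw[of l] row inj_ca[of l "d x"] inj_ca[of l "d y"] by auto
    qed
  qed
  then obtain f where f: "f \<in> F"
    "(inj_on f {x, y, w} \<and> (\<exists>t\<in>{x, y, w}. r - 1 \<le> f t)) \<or> (\<forall>t\<in>{x, y, w}. \<forall>l\<in>D. f t = l)" by blast
  from f(2) show ?thesis
  proof
    assume inj: "inj_on f {x, y, w} \<and> (\<exists>t\<in>{x, y, w}. r - 1 \<le> f t)"
    then have "f x \<noteq> f y" using xy(5) by auto
    then have s: "f x = d x" "f y = d y" "\<exists>n\<in>S. f = col n \<and> n \<le> g x"
      using F_split[OF f(1), of x y] xy by auto
    then obtain n where n: "n \<in> S" "f = col n" "n \<le> g z" using xy by auto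
    have "r - 1 \<le> f w" using inj s row by auto
    then have "g w < n" using n d[OF wX] by (auto simp: col_def split: if_splits)
    then show ?thesis using n by auto
  next
    assume all: "\<forall>t\<in>{x, y, w}. \<forall>l\<in>D. f t = l"
    have "D \<noteq> {}" using cD r4 by auto
    then obtain l where l: "l \<in> D" by blast
    then have "f x = l" "f x < r - 1" using all unfolding D_def by auto
    then have "l = d x" using F_low[OF f(1) xy(1)] xy(2) z by simp
    then show ?thesis using l unfolding D_def by simp
  qed
qed

text \<open>Otherwise the two blocks contain a monochromatic \<open>r\<close>-set meeting both. An
  \<open>f\<close> degenerate on it must distribute the upper block. If it also distributes the
  lower one, it is constant on the set but injective on each block; if not, it is rainbow, and one
  vertex of the kept block plus fewer than \<open>r - 1\<close> of the other are too few.\<close>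

lemma blocks_distinct:
  assumes w: "w \<in> U" "w' \<in> U" "c w = c w'" "g w < g w'"
  shows "mg \<and> g w = N - 2 \<and> g w' = N - 1"
proof (rule ccontr)
  assume np: "\<not> ?thesis"
  define A where "A = cls X g (g w)"
  define B where "B = cls X g (g w')"
  have wX: "w \<in> X" "w' \<in> X" "r - 1 \<le> g w" "r - 1 \<le> g w'" using w(1,2) unfolding U_def by blast+
  have rN': "r < N" using gN[OF wX(2)] wX w(4) by linarith
  have fin: "finite A" "finite B" unfolding A_def B_def using finX by auto
  have cA: "card A < r" "card B < r" using block[of "g w"] block[of "g w'"] wX gN unfolding A_def B_def by auto
  have disj: "A \<inter> B = {}" unfolding A_def B_def using w(4) by auto
  have "r \<le> card (A \<union> B)"
    using pair[of "g w" "g w'"] wX w(4) gN np fin disj unfolding A_def B_def by (simp add: card_Un_disjoint)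
  then obtain e where e: "e \<subseteq> A \<union> B" "card e = r" by (metis obtain_subset_with_card_n)
  have "c x = c w" if "x \<in> e" for x
    using that e(1) U_block[OF w(1)] U_block[OF w(2)] w(3) unfolding A_def B_def by auto
  then have "monochromatic c e" by (rule monochromaticI)
  then obtain f where f: "f \<in> F" "degenerate f e"
    using H[of e] e unfolding A_def B_def by blast
  have "e \<inter> A \<noteq> {}"
  proof
    assume "e \<inter> A = {}"
    then have "e \<subseteq> B" using e by blast
    from card_mono[OF fin(2) this] show False using cA e by simp
  qed
  moreover have "e \<inter> B \<noteq> {}"
  proof
    assume "e \<inter> B = {}"
    then have "e \<subseteq> A" using e by blast
    from card_mono[OF fin(1) this] show False using cA e by simp
  qed
  ultimately obtain x y where xy: "x \<in> e" "x \<in> A" "y \<in> e" "y \<in> B" by blast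
  have gxy: "g x = g w" "g y = g w'" using xy unfolding A_def B_def by auto
  have ce: "r \<le> card (e \<inter> A) + card (e \<inter> B)"
    using card_Un_le[of "e \<inter> A" "e \<inter> B"] e by (simp add: Int_Un_distrib[symmetric] Int_absorb2)
  have one: "card M \<le> 1" if "inj_on h M" "\<And>t. t \<in> M \<Longrightarrow> h t = v" "M \<subseteq> e" for h :: "'a \<Rightarrow> nat" and M v
  proof -
    have "card M = card (h ` M)" using that(1) by (simp add: card_image)
    also have "\<dots> \<le> card {v}" using that(2) by (intro card_mono) auto
    finally show ?thesis by simp
  qed
  show False
  proof (cases "(\<forall>t\<in>A. f t = f x) \<and> (\<forall>t\<in>B. f t = f y) \<and> f x \<noteq> f y")
    case True
    then have "\<not> monochromatic f e" using xy monochromaticD[of f e x y] by blast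
    then have inj: "inj_on f e" using f(2) by blast
    have "card (e \<inter> A) \<le> 1" "card (e \<inter> B) \<le> 1"
      using True one[of f "e \<inter> A" "f x"] one[of f "e \<inter> B" "f y"] inj_on_subset[OF inj] by auto
    then show False using ce r4 by simp
  next
    case False
    obtain n where n: "n \<in> S" "f = col n" "n \<le> g w'"
    proof (rule F_cases[OF f(1)])
      fix n assume n: "n \<in> S" "f = col n"
      have "n \<le> g w'"
      proof (rule ccontr)
        assume "\<not> n \<le> g w'"
        then have "col n t = g t" if "t \<in> A \<union> B" for t
          using that w(4) unfolding col_def A_def B_def by auto
        then show False using False n gxy w(4) xy unfolding A_def B_def by auto
      qed
      then show ?thesis using that n by blast
    next
      assume m: "mg" "f = mrg"
      have "g w < N - 1" using w(4) gN[OF wX(2)] by simp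
      then have fx: "f x = g w" "\<forall>t\<in>A. f t = g w" using m gxy unfolding mrg_def A_def by auto
      have "\<forall>t\<in>B. f t = f y" using m gxy unfolding mrg_def B_def by auto
      moreover have "f y \<noteq> g w" using m gxy np w(4) unfolding mrg_def by (auto split: if_splits)
      ultimately show ?thesis using False fx by force
    qed
    have mB: "card B < r - 1" "inj_on d B" using moved[OF n(1,3) gN rN'] wX unfolding B_def by auto
    have fB: "f t = d t" "d t < r - 1" if "t \<in> B" for t
      using that n d wX unfolding B_def col_def by auto
    show False
    proof (cases "n \<le> g w")
      case True
      have mA: "inj_on d A" using moved[OF n(1) True gN rN'] wX unfolding A_def by auto
      have fA: "f t = d t" "d t < r - 1" if "t \<in> A" for t
        using that n True d wX unfolding A_def col_def by auto
      have "\<not> inj_on f e"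
        using e fA fB r4 by (intro not_inj_few_values) auto
      then have m: "monochromatic f e" using f(2) by blast
      have "card (e \<inter> A) \<le> 1"
      proof (rule one[of d _ "f x"])
        show "d t = f x" if "t \<in> e \<inter> A" for t
          using fA(1)[of t] monochromaticD[OF m _ xy(1), of t] that by simp
      qed (use inj_on_subset[OF mA] in auto)
      moreover have "card (e \<inter> B) \<le> 1"
      proof (rule one[of d _ "f x"])
        show "d t = f x" if "t \<in> e \<inter> B" for t
          using fB(1)[of t] monochromaticD[OF m _ xy(1), of t] that by simp
      qed (use inj_on_subset[OF mB(2)] in auto)
      ultimately show False using ce r4 by simp
    next
      case False
      have fA: "f t = g w" if "t \<in> A" for t using that n False unfolding A_def col_def by auto
      have "f y < r - 1" using fB xy by simp
      then have "f x \<noteq> f y" using fA[OF xy(2)] wX by simp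
      then have "\<not> monochromatic f e" using monochromaticD[of f e x y] xy by blast
      then have inj: "inj_on f e" using f(2) by blast
      have "card (e \<inter> A) \<le> 1"
        using one[of f "e \<inter> A" "g w"] fA inj_on_subset[OF inj] by auto
      moreover have "card (e \<inter> B) \<le> card B" using fin by (intro card_mono) auto
      ultimately show False using ce mB by simp
    qed
  qed
qed

lemma rigid_many: "\<exists>f\<in>F. same_kernel X c f"
proof -
  have coreU: "g x < r - 1 \<Longrightarrow> x \<in> X \<Longrightarrow> c x = c (a (g x))" for x
    using a[of "g x"] by (intro core_unsplit) auto
  have coreE: "\<exists>k<r - 1. c x = c (a k)" if "x \<in> X - U" for x
    using that coreU[of x] unfolding U_def by (cases "g x < r - 1") auto
  have nU: "c u \<noteq> c x" if "u \<in> U" "x \<in> X - U" for u x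
    using coreE[OF that(2)] that(1) unfolding U_def by auto
  have "U \<noteq> {}"
  proof
    assume "U = {}"
    then have "c ` X \<subseteq> (\<lambda>k. c (a k)) ` {..<r - 1}" using coreE by blast
    then have "card (c ` X) \<le> card {..<r - 1}" by (rule surj_card_le[rotated]) simp
    then show False using many r4 by simp
  qed
  define E where "E = {z \<in> X - U. r - 1 \<le> g z}"
  have finUE: "finite (g ` U)" "finite (g ` E)" unfolding U_def E_def using finX by auto
  show ?thesis
  proof (cases "E = {}")
    case True
    have geq: "c x = c y" if "x \<in> X" "y \<in> X" "g x = g y" for x y
    proof (cases "g x < r - 1")
      case True then show ?thesis using core_unsplit[OF that] by blast
    next
      case False
      then have "y \<in> U" using True that unfolding E_def by auto
      then show ?thesis using U_block[of y x] that by blast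
    qed
    have ceq: "g x = g y \<or> mg \<and> {g x, g y} = {N - 2, N - 1}"
      if xy: "x \<in> X" "y \<in> X" "c x = c y" for x y
    proof (cases "x \<in> U")
      case True
      then have "y \<in> U" using nU[of x y] xy by auto
      then show ?thesis
        using True blocks_distinct[of x y] blocks_distinct[of y x] xy by (cases "g x" "g y" rule: linorder_cases) auto
    next
      case False
      then have "y \<notin> U" using nU[of y x] xy by auto
      then have "g x < r - 1" "g y < r - 1" using False True xy unfolding E_def by auto
      then show ?thesis using coreU[of x] coreU[of y] xy inj_ca by auto
    qed
    show ?thesis
    proof (cases "\<forall>x\<in>X. \<forall>y\<in>X. c x = c y \<longrightarrow> g x = g y")
      case True
      have "c x = c y \<longleftrightarrow> col N x = col N y" if xy: "x \<in> X" "y \<in> X" for x y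
      proof -
        have "col N x = g x" "col N y = g y" using xy gN by (simp_all add: col_def)
        moreover have "c x = c y \<longleftrightarrow> g x = g y" using True geq[OF xy] xy by blast
        ultimately show ?thesis by simp
      qed
      then have "same_kernel X c (col N)" unfolding same_kernel_def by blast
      then show ?thesis using S(2) unfolding F_def by blast
    next
      case False
      then obtain p q where pq: "p \<in> X" "q \<in> X" "c p = c q" "g p \<noteq> g q" by blast
      then have m: "mg" "{g p, g q} = {N - 2, N - 1}" using ceq[OF pq(1-3)] by auto
      have N2: "N - 2 \<noteq> N - 1" using rN r4 by simp
      have "c x = c y \<longleftrightarrow> mrg x = mrg y" if xy: "x \<in> X" "y \<in> X" for x y
      proof
        assume "c x = c y"
        then show "mrg x = mrg y" using ceq[OF xy] N2 unfolding mrg_def by (auto simp: doubleton_eq_iff)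
      next
        assume "mrg x = mrg y"
        then have or: "g x = g y \<or> g x \<in> {g p, g q} \<and> g y \<in> {g p, g q}"
          unfolding m(2) mrg_def by (auto split: if_splits)
        have tp: "c t = c p" if "t \<in> X" "g t \<in> {g p, g q}" for t
          using that geq[of t p] geq[of t q] pq by auto
        show "c x = c y"
        proof (cases "g x = g y")
          case True then show ?thesis by (rule geq[OF xy])
        next
          case False
          then show ?thesis using or tp[OF xy(1)] tp[OF xy(2)] by simp
        qed
      qed
      then have "same_kernel X c mrg" unfolding same_kernel_def by blast
      then show ?thesis using m unfolding F_def by auto
    qed
  next
    case False
    \<comment> \<open>The highest kept block and the lowest distributed one: a number
      \<open>n\<close> between them separates all kept blocks from all distributed ones.\<close>
    obtain w where w: "w \<in> U" "g w = Max (g ` U)" using Max_in[OF finUE(1)] \<open>U \<noteq> {}\<close> by fastforce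
    obtain z where z: "z \<in> E" "g z = Min (g ` E)" using Min_in[OF finUE(2)] False by fastforce
    obtain n where n: "n \<in> S" "g w < n" "n \<le> g z" using moved_above[OF w(1), of z] z(1) unfolding E_def by blast
    have Ug: "g x < n" if "x \<in> U" for x using that w n Max_ge[OF finUE(1), of "g x"] by auto
    have Eg: "n \<le> g x" if "x \<in> E" for x using that z n Min_le[OF finUE(2), of "g x"] by auto
    have nN: "n < N" using n gN[of z] z(1) unfolding E_def by auto
    have nr: "r - 1 \<le> n" using S_le n by blast
    have low: "col n x < r - 1 \<and> c x = c (a (col n x))" if x: "x \<in> X - U" for x
    proof (cases "g x < r - 1")
      case True then show ?thesis using coreU[of x] x nr by (auto simp: col_def)
    next
      case False
      then have xE: "x \<in> E" using x unfolding E_def by auto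
      obtain k where k: "k < r - 1" "c x = c (a k)" using coreE[OF x] by blast
      then have "d x = k" using row_core(2)[of k x] x False by auto
      then show ?thesis using k Eg[OF xE] by (auto simp: col_def)
    qed
    have high: "col n x = g x" "r - 1 \<le> g x" if "x \<in> U" for x
      using Ug[OF that] that unfolding U_def by (auto simp: col_def)
    have "c x = c y \<longleftrightarrow> col n x = col n y" if xy: "x \<in> X" "y \<in> X" for x y
    proof -
      consider "x \<in> U" "y \<in> U" | "x \<in> U" "y \<notin> U" | "x \<notin> U" "y \<in> U" | "x \<notin> U" "y \<notin> U" by blast
      then show ?thesis
      proof cases
        case 1
        have "g x = g y" if "c x = c y"
        proof (rule ccontr)
          assume "g x \<noteq> g y"
          \<comment> \<open>Blocks can coincide only if the last one is involved, and it is not kept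
            because \<open>n < N\<close>.\<close>
          then have "g x = N - 1 \<or> g y = N - 1"
            using blocks_distinct[OF 1 that] blocks_distinct[OF 1(2,1) that[symmetric]] by linarith
          then show False using Ug 1 nN by fastforce
        qed
        then show ?thesis using 1 high U_block[of y x] xy by auto
      next
        case 2 then show ?thesis using nU[of x y] low[of y] high[of x] xy by auto
      next
        case 3 then show ?thesis using nU[of y x] low[of x] high[of y] xy by auto
      next
        case 4 then show ?thesis using low[of x] low[of y] inj_ca xy by auto
      qed
    qed
    then have "same_kernel X c (col n)" unfolding same_kernel_def by blast
    then show ?thesis using n unfolding F_def by blast
  qed
qed

end

end

section \<open>Block frames: colourings with fewer than \<open>r\<close> colours\<close>

context block_frame_colouring
begin

context
  assumes few: "card (c ` X) \<le> r - 1"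
begin

definition Sp :: "nat set" where "Sp = {k. k < r - 1 \<and> card (cls X g k) = r}"

text \<open>An \<open>r\<close>-subset of a row inside the core is degenerate for some
  \<open>f\<close>, which agrees with \<open>g\<close> there and has too few colours to be rainbow.
  So any two vertices of the row belong to the same core class.\<close>

lemma K_large:
  assumes "r \<le> card (K v)"
  shows "\<exists>k\<in>Sp. K v = cls X g k"
proof -
  have gc: "g x = g y" if xy: "x \<in> K v" "y \<in> K v" for x y
  proof (cases "x = y")
    case False
    have "r - 2 \<le> card (K v - {x, y})" using assms xy False finK by (simp add: card_Diff_subset)
    then obtain T where T: "T \<subseteq> K v - {x, y}" "card T = r - 2" by (rule obtain_subset_with_card_n)
    define e where "e = insert x (insert y T)"
    have "finite T" using T finK finite_subset by blast
    then have ce: "card e = r" unfolding e_def using T False r4 by (subst card_insert_disjoint; force)+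
    have eK: "e \<subseteq> K v" unfolding e_def using T xy by blast
    then have "monochromatic c e" unfolding K_def by (intro monochromaticI[of _ _ v]) auto
    then obtain f where f: "f \<in> F" "degenerate f e" using H ce eK K_X by blast
    have fg: "f t = g t" "g t < r - 1" if "t \<in> e" for t
      using that eK F_core[OF f(1)] unfolding K_def by auto
    have "\<not> inj_on f e" using fg ce r4 by (intro not_inj_few_values) auto
    then have "f x = f y" using f(2) monochromaticD[of f e x y] unfolding e_def by blast
    then show ?thesis using fg unfolding e_def by simp
  qed simp
  have "K v \<noteq> {}" using assms r4 by auto
  then obtain x where x: "x \<in> K v" by blast
  have k: "g x < r - 1" using x unfolding K_def by auto
  have sub: "K v \<subseteq> cls X g (g x)" using gc[OF _ x] K_X by auto
  have "card (K v) = card (cls X g (g x))" "card (cls X g (g x)) = r"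
  proof -
    have "card (K v) \<le> card (cls X g (g x))" using card_mono[OF _ sub] finX by simp
    then show "card (K v) = card (cls X g (g x))" "card (cls X g (g x)) = r"
      using assms core[OF k] r4 by linarith+
  qed
  then show ?thesis using card_subset_eq[OF _ sub] finX k unfolding Sp_def by auto
qed

text \<open>By \<open>K_large\<close> there are at most as many overfull rows as core classes of
  size \<open>r\<close>, and this number is the surplus of the core over
  \<open>(r - 1) * (r - 1)\<close>. So \<open>row_deficit\<close> leaves no deficient row.\<close>

lemma row_structure:
  shows "card (c ` X) = r - 1" and "\<And>k. k \<in> Sp \<Longrightarrow> K (c (a k)) = cls X g k"
    and "\<And>v. v \<in> c ` X \<Longrightarrow> v \<notin> (\<lambda>k. c (a k)) ` Sp \<Longrightarrow> card (K v) = r - 1"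
proof -
  define Vs where "Vs = {v \<in> c ` X. r - 1 < card (K v)}"
  have finSp: "finite Sp" unfolding Sp_def by auto
  have aX: "a k \<in> X" "g (a k) = k" if "k \<in> Sp" for k using a that unfolding Sp_def by auto
  have sub: "Vs \<subseteq> (\<lambda>k. c (a k)) ` Sp"
  proof
    fix v assume "v \<in> Vs"
    then have "r \<le> card (K v)" unfolding Vs_def by auto
    then obtain k where k: "k \<in> Sp" "K v = cls X g k" using K_large by blast
    then have "a k \<in> K v" using aX by auto
    then show "v \<in> (\<lambda>k. c (a k)) ` Sp" using k unfolding K_def by auto
  qed
  have cVs: "card Vs \<le> card Sp" by (rule surj_card_le[OF finSp sub])
  have "cls {x \<in> X. g x < r - 1} c v = K v" for v unfolding K_def by auto
  then have sum: "(\<Sum>v\<in>c ` X. card (K v)) = (r - 1) * (r - 1) + card Sp"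
    using sum_card_cls[of "{x \<in> X. g x < r - 1}" "c ` X" c] finX core_total[OF finX _ core] r4 unfolding Sp_def by auto
  have le: "card (K v) \<le> r - 1 + 1" if "v \<in> c ` X" for v
  proof (rule ccontr)
    assume gt: "\<not> card (K v) \<le> r - 1 + 1"
    then have "r \<le> card (K v)" by linarith
    then obtain k where "k \<in> Sp" "K v = cls X g k" using K_large by blast
    then show False using gt unfolding Sp_def by auto
  qed
  have over: "card {v \<in> c ` X. r - 1 < card (K v)} \<le> card Sp + 1" using cVs unfolding Vs_def by simp
  have n2: "2 \<le> r - 1" using r4 by simp
  note rd = row_deficit[OF finite_imageI[OF finX] few n2 le sum over]
  show "card (c ` X) = r - 1" by (rule rd(1))
  have eq: "(\<Sum>v\<in>c ` X. (r - 1) - card (K v)) = 0" "card Vs = card Sp"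
    using rd(2) cVs unfolding Vs_def by auto
  have "card ((\<lambda>k. c (a k)) ` Sp) \<le> card Vs" using card_image_le[OF finSp] eq(2) by metis
  then have VsEq: "Vs = (\<lambda>k. c (a k)) ` Sp" using finSp by (intro card_seteq sub) auto
  show "K (c (a k)) = cls X g k" if k: "k \<in> Sp" for k
  proof -
    have "c (a k) \<in> Vs" using VsEq k by auto
    then have "r \<le> card (K (c (a k)))" unfolding Vs_def by auto
    then obtain l where l: "l \<in> Sp" "K (c (a k)) = cls X g l" using K_large by blast
    have "a k \<in> K (c (a k))" using aX[OF k] k unfolding K_def Sp_def by auto
    then have "k = l" using l aX[OF k] by auto
    then show ?thesis using l by simp
  qed
  show "card (K v) = r - 1" if v: "v \<in> c ` X" "v \<notin> (\<lambda>k. c (a k)) ` Sp" for v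
  proof -
    have "\<forall>v\<in>c ` X. (r - 1) - card (K v) = 0"
      using eq(1) finX by (simp only: sum_eq_0_iff finite_imageI)
    then have "(r - 1) - card (K v) = 0" using v(1) by (rule bspec)
    moreover have "v \<notin> Vs" using v VsEq by auto
    ultimately show ?thesis using v unfolding Vs_def by auto
  qed
qed

lemma row_of_block:
  assumes z: "z \<in> X" "r - 1 \<le> g z"
  shows "K (c z) = cls X g (d z)" and "\<exists>n\<in>S. n \<le> g z"
proof -
  obtain k0 where k0: "k0 \<in> Sp" using big unfolding Sp_def by auto
  have *: "K (c z) = cls X g (d z) \<and> (\<exists>n\<in>S. n \<le> g z)"
  proof (cases "c z \<in> (\<lambda>k. c (a k)) ` Sp")
    case True
    then obtain k where k: "k \<in> Sp" "c z = c (a k)" by blast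
    have k1: "k < r - 1" using k unfolding Sp_def by auto
    obtain W where W: "W \<subseteq> cls X g k" "card W = r - 1" using core_subset[OF k1] by blast
    have "c x = c z" if "x \<in> W" for x
      using that W row_structure(2)[OF k(1)] k(2) unfolding K_def by auto
    then have "monochromatic c (insert z W)" by (intro monochromaticI[of _ _ "c z"]) auto
    moreover have "z \<notin> W" using W z k1 by auto
    ultimately have "z \<in> G k" using mono_core[OF W k1 z(1)] by blast
    then show ?thesis using row_structure(2)[OF k(1)] k z k1 unfolding G_def by auto
  next
    case False
    have cK: "card (K (c z)) = r - 1" using row_structure(3)[OF _ False] z by blast
    have zK: "z \<notin> K (c z)" using z unfolding K_def by auto
    have "monochromatic c (insert z (K (c z)))"
      by (intro monochromaticI[of _ _ "c z"]) (auto simp: K_def)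
    moreover have "card (insert z (K (c z))) = r" using cK zK finK r4 by simp
    ultimately obtain f where f: "f \<in> F"
      "degenerate f (insert z (K (c z)))"
      using H[of "insert z (K (c z))"] z K_X by blast
    have fg: "f t = g t" "g t < r - 1" if "t \<in> K (c z)" for t
      using that F_core[OF f(1)] unfolding K_def by auto
    have sep: "c (a k) \<noteq> c t" if "k \<in> Sp" "t \<in> K (c z)" for k t
    proof
      assume "c (a k) = c t"
      then have "c z = c (a k)" using that(2) unfolding K_def by simp
      then show False using False that(1) by blast
    qed
    \<comment> \<open>An injective \<open>f\<close> would use all \<open>r - 1\<close> core colours
      on this row, including that of a class of size \<open>r\<close>, but such a class is a
      different row. Here \<open>big\<close> enters.\<close>
    have "\<not> inj_on f (insert z (K (c z)))"
    proof
      assume "inj_on f (insert z (K (c z)))"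
      then have "inj_on f (K (c z))" by (rule inj_on_subset) auto
      then have "card (f ` K (c z)) = r - 1" using cK by (simp add: card_image)
      moreover have "f ` K (c z) \<subseteq> {..<r - 1}" using fg by auto
      ultimately have "f ` K (c z) = {..<r - 1}" by (intro card_subset_eq) auto
      moreover have "k0 < r - 1" using k0 unfolding Sp_def by auto
      ultimately have "k0 \<in> f ` K (c z)" by simp
      then obtain w where w: "w \<in> K (c z)" "k0 = f w" by blast
      then have "g w = k0" using fg(1) by simp
      then have "w \<in> K (c (a k0))" using row_structure(2)[OF k0] w(1) K_X by auto
      then show False using sep[OF k0 w(1)] unfolding K_def by auto
    qed
    then have m: "monochromatic f (insert z (K (c z)))" using f(2) by blast
    have "K (c z) \<noteq> {}" using cK r4 by auto
    then obtain x where x: "x \<in> K (c z)" by blast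
    define k where "k = g x"
    have k: "k < r - 1" unfolding k_def using fg[OF x] by simp
    have "f z = k" using monochromaticD[OF m, of z x] x fg[OF x] unfolding k_def by simp
    then have "z \<in> G k" using F_G[OF f(1) z(1)] k by auto
    then have dz: "d z = k" "\<exists>n\<in>S. n \<le> g z" using z k unfolding G_def by auto
    have sub: "K (c z) \<subseteq> cls X g k"
    proof
      fix t assume t: "t \<in> K (c z)"
      have "f t = f x" using monochromaticD[OF m, of t x] t x by blast
      then show "t \<in> cls X g k" using t x fg[OF t] fg[OF x] K_X unfolding k_def by auto
    qed
    have "k \<notin> Sp"
    proof
      assume kS: "k \<in> Sp"
      then have "x \<in> K (c (a k))" using row_structure(2)[OF kS] sub x by auto
      then show False using sep[OF kS x] unfolding K_def by auto
    qed
    then have "card (cls X g k) = r - 1" using core[OF k] k unfolding Sp_def by auto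
    then have "K (c z) = cls X g k" using cK sub finX by (intro card_subset_eq) auto
    then show ?thesis using dz by auto
  qed
  show "K (c z) = cls X g (d z)" "\<exists>n\<in>S. n \<le> g z" using * by auto
qed

lemma rigid_few: "\<exists>f\<in>F. same_kernel X c f"
proof -
  \<comment> \<open>Every block is distributed, even block \<open>r - 1\<close>, and this forces
    \<open>r - 1\<close> into \<open>S\<close>.\<close>
  have "r - 1 < N" using rN r4 by simp
  then have "card (cls X g (r - 1)) \<noteq> 0" using block[of "r - 1"] by auto
  then obtain z0 where z0: "z0 \<in> X" "g z0 = r - 1" by (auto simp: card_eq_0_iff)
  obtain n where "n \<in> S" "n \<le> g z0" using row_of_block(2)[of z0] z0 by auto
  then have rS: "r - 1 \<in> S" using S_le[of n] z0 by auto
  have row: "K (c x) = cls X g (col (r - 1) x)" if x: "x \<in> X" for x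
  proof (cases "g x < r - 1")
    case False
    then show ?thesis using row_of_block(1)[OF x] by (simp add: col_def)
  next
    case True
    have xK: "x \<in> K (c x)" using x True unfolding K_def by auto
    show ?thesis
    proof (cases "\<exists>v. K v = cls X g (g x)")
      case True
      then obtain v where v: "K v = cls X g (g x)" by blast
      then have "x \<in> K v" using x by auto
      then have "c x = v" unfolding K_def by auto
      then show ?thesis using v \<open>g x < r - 1\<close> by (simp add: col_def)
    next
      case nK: False
      have gS: "g x \<notin> Sp" using nK row_structure(2) by blast
      have cx: "card (cls X g (g x)) = r - 1" using core[OF True] gS True unfolding Sp_def by auto
      have notSp: "c x \<notin> (\<lambda>k. c (a k)) ` Sp"
      proof
        assume "c x \<in> (\<lambda>k. c (a k)) ` Sp"
        then obtain k where k: "k \<in> Sp" "c x = c (a k)" by blast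
        then have "x \<in> cls X g k" using row_structure(2)[OF k(1)] xK by simp
        then show False using k(1) gS by auto
      qed
      have cK: "card (K (c x)) = r - 1" using row_structure(3)[OF _ notSp] x by blast
      have sub: "K (c x) \<subseteq> cls X g (g x)"
      proof
        fix y assume y: "y \<in> K (c x)"
        have yX: "y \<in> X" "g y < r - 1" "c y = c x" using y unfolding K_def by auto
        show "y \<in> cls X g (g x)"
        proof (rule ccontr)
          assume "y \<notin> cls X g (g x)"
          then have ne: "g x \<noteq> g y" using yX by auto
          have nKy: "K v \<noteq> cls X g (g y)" for v
          proof
            assume v: "K v = cls X g (g y)"
            then have "y \<in> K v" using yX by auto
            then have "v = c x" using yX unfolding K_def by auto
            then have "x \<in> cls X g (g y)" using v xK by simp
            then show False using ne by simp
          qed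
          then have "g y \<notin> Sp" using row_structure(2) by blast
          then have "card (cls X g (g y)) = r - 1" using core[OF yX(2)] yX(2) unfolding Sp_def by auto
          \<comment> \<open>Two core classes of size \<open>r - 1\<close> could exchange vertices; a
            block vertex that goes to one of them pins this class down as a row.\<close>
          then obtain z where z: "z \<in> X" "r - 1 \<le> g z" "d z = g x \<or> d z = g y"
            using hit[OF rS True yX(2) ne cx] by blast
          then show False using row_of_block(1)[OF z(1,2)] nK nKy by auto
        qed
      qed
      then have "K (c x) = cls X g (g x)" using cK cx finX by (intro card_subset_eq) auto
      then show ?thesis using nK by blast
    qed
  qed
  have low: "col (r - 1) x < r - 1" if "x \<in> X" for x
    using d[OF that] by (auto simp: col_def)
  have "c x = c y \<longleftrightarrow> col (r - 1) x = col (r - 1) y" if xy: "x \<in> X" "y \<in> X" for x y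
  proof
    assume "c x = c y"
    then have eq: "cls X g (col (r - 1) x) = cls X g (col (r - 1) y)" using row[OF xy(1)] row[OF xy(2)] by simp
    obtain t where "t \<in> X" "g t = col (r - 1) x" using core_elem[OF low[OF xy(1)]] by blast
    then show "col (r - 1) x = col (r - 1) y" using eq by auto
  next
    assume eq: "col (r - 1) x = col (r - 1) y"
    obtain t where "t \<in> X" "g t = col (r - 1) x" using core_elem[OF low[OF xy(1)]] by blast
    then have "t \<in> K (c x)" "t \<in> K (c y)" using row[OF xy(1)] row[OF xy(2)] eq by auto
    then show "c x = c y" unfolding K_def by auto
  qed
  then have "same_kernel X c (col (r - 1))" unfolding same_kernel_def by blast
  then show ?thesis using rS unfolding F_def by blast
qed

end

lemma rigid: "\<exists>f\<in>F. same_kernel X c f"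
proof (cases "card (c ` X) \<le> r - 1")
  case True then show ?thesis by (rule rigid_few)
next
  case False
  then have "r \<le> card (c ` X)" by simp
  then show ?thesis by (rule rigid_many)
qed

end

section \<open>Block frames: the realized set\<close>

context block_frame
begin

lemma col_image: "n \<in> S \<Longrightarrow> col n ` X = {..<n}"
proof (intro equalityI subsetI)
  fix v assume n: "n \<in> S" and "v \<in> {..<n}"
  then have v: "v < n" "v < N" using S_le[OF n] by auto
  have "card (cls X g v) \<noteq> 0" using core_card[of v] block[of v] r4 v by (cases "v < r - 1") auto
  then obtain x where x: "x \<in> X" "g x = v" by (auto simp: card_eq_0_iff)
  then have "v = col n x" using v by (simp add: col_def)
  then show "v \<in> col n ` X" using x by blast
next
  fix v assume n: "n \<in> S" and "v \<in> col n ` X"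
  then obtain x where x: "x \<in> X" "v = col n x" by blast
  then show "v \<in> {..<n}" using S_le[OF n] d[OF x(1)] by (auto simp: col_def)
qed

lemma mrg_image: "mg \<Longrightarrow> mrg ` X = {..<N - 1}"
proof (intro equalityI subsetI)
  fix v assume m: mg and "v \<in> {..<N - 1}"
  then have v: "v < N" "v \<noteq> N - 1" by auto
  have "card (cls X g v) \<noteq> 0" using core_card[of v] block[of v] r4 v by (cases "v < r - 1") auto
  then obtain x where x: "x \<in> X" "g x = v" by (auto simp: card_eq_0_iff)
  then have "v = mrg x" using v by (simp add: mrg_def)
  then show "v \<in> mrg ` X" using x by blast
next
  fix v assume m: mg and "v \<in> mrg ` X"
  then obtain x where x: "x \<in> X" "v = mrg x" by blast
  then show "v \<in> {..<N - 1}" using gN[OF x(1)] rN r4 by (auto simp: mrg_def)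
qed

theorem block_frame_realization:
  "\<exists>B. realizes r X B (S \<union> (if mg then {N - 1} else {}))"
proof -
  have "\<exists>B. realizes r X B ((\<lambda>f. card (f ` X)) ` F)"
  proof (rule one_realizationI_rigid[OF finX])
    fix c :: "'a \<Rightarrow> nat"
    assume H: "\<And>e. e \<subseteq> X \<Longrightarrow> card e = r \<Longrightarrow> degenerate c e \<Longrightarrow> \<exists>f\<in>F. degenerate f e"
    interpret block_frame_colouring X g d r N S mg c
      by unfold_locales (rule H)
    show "\<exists>f\<in>F. same_kernel X c f" by (rule rigid)
  next
    fix f f' assume f: "f \<in> F" and f': "f' \<in> F" and eq: "card (f ` X) = card (f' ` X)"
    have im: "(\<exists>n\<in>S. h = col n \<and> card (h ` X) = n) \<or> mg \<and> h = mrg \<and> card (h ` X) = N - 1" if "h \<in> F" for h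
      using that by (rule F_cases) (auto simp: col_image mrg_image)
    show "f = f'" using im[OF f] im[OF f'] eq mg by auto
  qed
  moreover have "(\<lambda>f. card (f ` X)) ` F = S \<union> (if mg then {N - 1} else {})"
    unfolding F_def by (auto simp: col_image mrg_image image_iff)
  ultimately show ?thesis by simp
qed

end

subsection \<open>Twisted constructions\<close>

text \<open>For \<open>n\<^sub>1 \<le> r + 2\<close> the two smallest classes of a minimum realization are singletons, and moving one of
  them alone to a core class would be a proper colouring. This is prevented by moving both of them to
  the core class of \<open>x0\<close> and at the same time \<open>x0\<close> to another core class. The colours of \<open>g\<close> are the
  core classes \<open>0, \<dots>, r - 2\<close>, an optional block \<open>r - 1\<close>, and \<open>r\<close> and \<open>r + 1\<close> for the singletons; colour
  \<open>r - 1\<close> is unused if there is no block. The flags \<open>p\<close> and \<open>p'\<close> tell whether the twisted colouring is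
  present with the block kept and with the block distributed.\<close>

locale twist_frame =
  fixes X :: "'a set" and g d :: "'a \<Rightarrow> nat" and r :: nat and x0 y1 y2 :: 'a and p p' :: bool
  assumes finX: "finite X"
    and r4: "4 \<le> r"
    and range: "x \<in> X \<Longrightarrow> g x \<le> r + 1"
    and x0: "x0 \<in> X" "g x0 = 0"
    and y12: "cls X g r = {y1}" "cls X g (r + 1) = {y2}"
    and core: "k < r - 1 \<Longrightarrow> card (cls X g k) = r - 1 \<or> card (cls X g k) = r"
    and core01: "card (cls X g 0) = r - 1" "card (cls X g 1) = r - 1"
    and big: "\<exists>k<r - 1. card (cls X g k) = r"
    and Y: "cls X g (r - 1) = {} \<or> card (cls X g (r - 1)) = r - 1"
    and d: "inj_on d (cls X g (r - 1))" "x \<in> X \<Longrightarrow> g x = r - 1 \<Longrightarrow> d x < r - 1"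
    and pp: "p \<or> p'" "cls X g (r - 1) = {} \<Longrightarrow> p' \<and> \<not> p"
    and hit: "2 \<le> k \<Longrightarrow> k < r - 1 \<Longrightarrow> 2 \<le> k' \<Longrightarrow> k' < r - 1 \<Longrightarrow> k \<noteq> k' \<Longrightarrow>
      card (cls X g k) = r - 1 \<Longrightarrow> card (cls X g k') = r - 1 \<Longrightarrow>
      \<exists>z\<in>X. g z = r - 1 \<and> (d z = k \<or> d z = k')"
begin

definition mrg :: "'a \<Rightarrow> nat" where "mrg x = (if g x = r + 1 then r else g x)"
text \<open>Both affected classes end up with \<open>r\<close> vertices: class 0 loses
  \<open>x0\<close> and gains \<open>y1\<close> and \<open>y2\<close>, class 1 gains
  \<open>x0\<close>.\<close>

definition tw :: "'a \<Rightarrow> nat" where "tw x = (if x = x0 then 1 else if r \<le> g x then 0 else g x)"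
definition twd :: "'a \<Rightarrow> nat" where "twd x = (if g x = r - 1 then d x else tw x)"

definition F :: "('a \<Rightarrow> nat) set" where
  "F = {g, mrg} \<union> (if p then {tw} else {}) \<union> (if p' then {twd} else {})"

definition G :: "nat \<Rightarrow> 'a set" where
  "G k = {x \<in> X. g x = k \<or> x = x0 \<and> k = 1 \<or> g x = r - 1 \<and> d x = k \<or> k = 0 \<and> r \<le> g x}"

text \<open>The core parts of the twisted classes, which replace the core classes as candidates for
  rows when there are few colours.\<close>

definition C :: "nat \<Rightarrow> 'a set" where "C k = {x \<in> X. g x < r - 1 \<and> tw x = k}"

lemma F_cases:
  assumes "f \<in> F"
  obtains "f = g" | "f = mrg" | "p" "f = tw" | "p'" "f = twd"
  using assms unfolding F_def by (auto split: if_splits)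

lemma y_in: "y1 \<in> X" "g y1 = r" "y2 \<in> X" "g y2 = r + 1" "y1 \<noteq> y2"
proof -
  have "y1 \<in> cls X g r" "y2 \<in> cls X g (r + 1)" unfolding y12 by simp_all
  then show "y1 \<in> X" "g y1 = r" "y2 \<in> X" "g y2 = r + 1" "y1 \<noteq> y2" by auto
qed

lemma F_core_eq: "f \<in> F \<Longrightarrow> g x < r - 1 \<Longrightarrow> x \<noteq> x0 \<Longrightarrow> f x = g x"
  by (erule F_cases) (auto simp: mrg_def tw_def twd_def)

lemma F_core_less: "f \<in> F \<Longrightarrow> g x < r - 1 \<Longrightarrow> f x < r - 1"
  using r4 by (erule_tac F_cases) (auto simp: mrg_def tw_def twd_def)

text \<open>The colour of \<open>x0\<close> decides whether a singleton is moved. This coupling is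
  the purpose of the twist.\<close>

lemma F_twist:
  assumes "f \<in> F" "r \<le> g y"
  shows "f x0 = 0 \<and> r \<le> f y \<and> (f = g \<or> f = mrg) \<or>
    f x0 = 1 \<and> f y = 0 \<and> (p \<and> f = tw \<or> p' \<and> f = twd)"
  using assms(1) by (rule F_cases) (use assms x0 r4 in \<open>auto simp: mrg_def tw_def twd_def\<close>)

lemma F_Y:
  assumes "f \<in> F" "g z = r - 1"
  shows "f z = r - 1 \<or> p' \<and> f = twd \<and> f z = d z"
  using assms(1) by (rule F_cases) (use assms x0 r4 in \<open>auto simp: mrg_def tw_def twd_def\<close>)

lemma F_Y_low:
  assumes "f \<in> F" "z \<in> X" "g z = r - 1" "f z < r - 1"
  shows "p' \<and> f = twd \<and> f z = d z"
  using F_Y[OF assms(1,3)] assms(4) by auto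

lemma F_mid: "f \<in> F \<Longrightarrow> f \<noteq> twd \<Longrightarrow> x \<in> X \<Longrightarrow> f x = r - 1 \<Longrightarrow> g x = r - 1"
  by (erule F_cases) (use x0 r4 in \<open>auto simp: mrg_def tw_def split: if_splits\<close>)

lemma twd_less: "x \<in> X \<Longrightarrow> twd x < r - 1"
  using d(2)[of x] r4 range[of x] unfolding twd_def tw_def by auto

lemma F_value: "f \<in> F \<Longrightarrow> x \<in> X \<Longrightarrow> f x < r - 1 \<Longrightarrow> x \<in> G (f x)"
  by (erule F_cases) (use r4 in \<open>auto simp: G_def mrg_def tw_def twd_def split: if_splits\<close>)

sublocale core_frame X g r "{x0}" F G
proof
  show card: "r - 1 \<le> card (cls X g k)" if "k < r - 1" for k using core[OF that] by auto
  show "\<exists>x\<in>X. g x = k \<and> x \<notin> {x0}" if "k < r - 1" for k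
  proof -
    have "2 \<le> card (cls X g k)" using card[OF that] r4 by simp
    from two_elements[OF this] show ?thesis by blast
  qed
  \<comment> \<open>Classes 0 and 1 may both contain \<open>x0\<close> and do not separate each
    other, so class 2 serves for them and class 1 for the others; class 0 is never chosen because it
    contains the exceptional vertex.\<close>
  show "\<exists>k<r - 1. G j \<inter> G k = {} \<and> cls X g k \<inter> {x0} = {}" if "j < r - 1" for j
    using that r4 x0 by (intro exI[of _ "if j \<le> 1 then 2 else 1"]) (auto simp: G_def)
qed (use finX r4 F_core_eq F_value in \<open>auto simp: G_def\<close>)

lemma F_a: "f \<in> F \<Longrightarrow> k < r - 1 \<Longrightarrow> f (a k) = k"
  using F_core[of f "a k"] a[of k] by simp

lemma C_eq: "C 0 = cls X g 0 - {x0}" "C 1 = insert x0 (cls X g 1)"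
  "2 \<le> k \<Longrightarrow> k < r - 1 \<Longrightarrow> C k = cls X g k"
  using x0 r4 unfolding C_def tw_def by auto

lemma C_card: "card (C 0) = r - 2" "card (C 1) = r" "2 \<le> k \<Longrightarrow> k < r - 1 \<Longrightarrow> card (C k) = card (cls X g k)"
  using x0 r4 core01 finX C_eq by (auto simp: card_Diff_singleton numeral_2_eq_2)

lemma C_card_le: "k < r - 1 \<Longrightarrow> card (C k) \<le> r"
  using C_card core[of k] by (cases "k = 0"; cases "k = 1") (auto simp: Suc_le_eq)

lemma finC: "finite (C k)" unfolding C_def using finX by auto

lemma a_C: "k < r - 1 \<Longrightarrow> a k \<in> C k"
  using a[of k] unfolding C_def tw_def by auto

lemma F_C_const: "f \<in> F \<Longrightarrow> x \<in> C k \<Longrightarrow> x \<noteq> x0 \<Longrightarrow> f x = k"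
  using F_core[of f x] unfolding C_def tw_def by auto

lemma F_C_not_inj:
  assumes f: "f \<in> F" and W: "W \<subseteq> C k" "3 \<le> card W" "W \<subseteq> e"
  shows "\<not> inj_on f e"
proof -
  have "card W - 1 \<le> card (W - {x0})" by (simp add: card_Diff_singleton_if)
  then have "2 \<le> card (W - {x0})" using W(2) by simp
  from two_elements[OF this] obtain x y where "x \<in> W - {x0}" "y \<in> W - {x0}" "x \<noteq> y" by blast
  moreover from this have "f x = k" "f y = k" "x \<in> e" "y \<in> e" using F_C_const[OF f] W by blast+
  ultimately show ?thesis using inj_onD[of f e x y] by auto
qed

end

locale twist_frame_colouring = twist_frame +
  fixes c :: "'a \<Rightarrow> nat"
  assumes H: "e \<subseteq> X \<Longrightarrow> card e = r \<Longrightarrow> degenerate c e \<Longrightarrow> \<exists>f\<in>F. degenerate f e"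
begin

sublocale core_colouring X g r "{x0}" F G c
  by unfold_locales (rule H)

section \<open>Twisted frames: colourings with at least \<open>r\<close> colours\<close>

context
  assumes many: "r \<le> card (c ` X)"
begin

lemmas core_unsplit = unsplit[OF many]

text \<open>On a rainbow \<open>r\<close>-set through two block vertices, \<open>twd\<close> is not
  rainbow for lack of colours and not constant since \<open>d\<close> is injective. Any other
  \<open>f\<close> gives the whole block a colour of its own, and the block is smaller than
  \<open>r\<close>.\<close>

lemma Y_unsplit:
  assumes uv: "u \<in> X" "v \<in> X" "g u = r - 1" "g v = r - 1"
  shows "c u = c v"
proof (rule ccontr)
  assume ne: "c u \<noteq> c v"
  then have "inj_on c {u, v}" "card {u, v} \<le> r" using r4 by (auto simp: card_insert_if)
  then obtain e where e: "{u, v} \<subseteq> e" "e \<subseteq> X" "inj_on c e" "card e = r"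
    using extend_transversal[of X "{u, v}" c r] finX many uv by blast
  obtain f where f: "f \<in> F" "degenerate f e" using H e by blast
  have duv: "d u \<noteq> d v" using inj_onD[OF d(1), of u v] uv ne by auto
  show False
  proof (cases "f = twd")
    case True
    have "\<not> inj_on f e" using True twd_less e r4 by (intro not_inj_few_values) auto
    then have "f u = f v" using f(2) e(1) monochromaticD[of f e u v] by blast
    then show False using True duv uv by (simp add: twd_def)
  next
    case False
    then have fr: "f u = r - 1" "f v = r - 1" using F_Y[OF f(1)] uv by auto
    then have "\<not> inj_on f e" using inj_onD[of f e u v] e(1) ne by auto
    then have m: "monochromatic f e" using f(2) by blast
    have "e \<subseteq> cls X g (r - 1)"
    proof
      fix t assume t: "t \<in> e"
      have "f t = r - 1" using monochromaticD[OF m t, of u] e(1) fr by simp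
      then show "t \<in> cls X g (r - 1)" using F_mid[OF f(1) False, of t] t e(2) by auto
    qed
    then have "r \<le> card (cls X g (r - 1))" using card_mono[of "cls X g (r - 1)" e] finX e(4) by simp
    moreover have "card (cls X g (r - 1)) \<le> r - 1" using Y by (elim disjE) (simp_all only: card.empty le0 order_refl)
    ultimately show False using r4 by linarith
  qed
qed

text \<open>The block and one more vertex form an \<open>r\<close>-set, on which \<open>twd\<close>
  is neither rainbow nor constant, and neither is any colouring that keeps the block as a
  class.\<close>

lemma Y_alone:
  assumes z: "z \<in> X" "g z = r - 1" and z': "z' \<in> X" "g z' \<noteq> r - 1"
  shows "c z \<noteq> c z'"
proof
  assume eq: "c z = c z'"
  define W where "W = cls X g (r - 1)"
  have cW: "card W = r - 1" using Y z unfolding W_def by auto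
  have finW: "finite W" unfolding W_def using finX by auto
  have "z' \<notin> W" using z' unfolding W_def by auto
  then have ce: "card (insert z' W) = r" using cW finW r4 by simp
  have "c t = c z'" if "t \<in> W" for t using Y_unsplit[of t z] that z eq unfolding W_def by simp
  then have "monochromatic c (insert z' W)" by (intro monochromaticI[of _ _ "c z'"]) auto
  then obtain f where f: "f \<in> F" "degenerate f (insert z' W)"
    using H[of "insert z' W"] ce z' unfolding W_def by blast
  have "2 \<le> card W" using cW r4 by simp
  from two_elements[OF this] obtain u v where uv: "u \<in> W" "v \<in> W" "u \<noteq> v" by blast
  have guv: "u \<in> X" "v \<in> X" "g u = r - 1" "g v = r - 1" using uv unfolding W_def by auto
  have duv: "d u \<noteq> d v" using inj_onD[OF d(1), of u v] guv uv(3) by auto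
  show False
  proof (cases "f = twd")
    case True
    have "\<not> inj_on f (insert z' W)"
      using True twd_less z' ce r4 unfolding W_def by (intro not_inj_few_values) auto
    then have "f u = f v" using f(2) uv monochromaticD[of f "insert z' W" u v] by blast
    then show False using True duv guv by (simp add: twd_def)
  next
    case False
    then have fr: "f u = r - 1" "f v = r - 1" using F_Y[OF f(1)] guv by auto
    then have "\<not> inj_on f (insert z' W)" using inj_onD[of f "insert z' W" u v] uv by auto
    then have "f z' = r - 1" using f(2) uv fr monochromaticD[of f "insert z' W" z' u] by auto
    then show False using F_mid[OF f(1) False z'(1)] z'(2) by auto
  qed
qed

lemma row_core:
  assumes k: "0 < k" "k < r - 1" and z: "z \<in> X" "c z = c (a k)" "g z \<noteq> k"
  shows "z = x0 \<and> k = 1"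
proof -
  obtain W where W: "W \<subseteq> cls X g k" "card W = r - 1" using core_subset[OF k(2)] by blast
  \<comment> \<open>For class 0 this fails: without \<open>x0\<close> it has only
    \<open>r - 2\<close> vertices, too few to form an \<open>r\<close>-set with
    \<open>z\<close>.\<close>
  have W': "W \<inter> {x0} = {}" using W x0 k by auto
  have "c x = c (a k)" if "x \<in> W" for x
    using core_unsplit[of x "a k"] that W W' a[OF k(2)] k by auto
  then have "monochromatic c (insert z W)"
    using z by (intro monochromaticI[of _ _ "c (a k)"]) auto
  moreover have "z \<notin> W" using W z by auto
  ultimately have "z \<in> G k" using mono_core[OF W k(2) z(1)] W' by blast
  moreover have "g z \<noteq> r - 1" using Y_alone[OF z(1) _ a(1)[OF k(2)]] a[OF k(2)] k z by auto
  ultimately show ?thesis using z k unfolding G_def by auto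
qed

lemma inj_ca: "k < r - 1 \<Longrightarrow> l < r - 1 \<Longrightarrow> c (a k) = c (a l) \<Longrightarrow> k = l"
  using row_core[of k "a l"] row_core[of l "a k"] a[of k] a[of l]
  by (cases "k = 0"; cases "l = 0") auto

lemma mixed:
  assumes E: "E \<subseteq> X" "inj_on c E" and D: "D \<subseteq> {..<r - 1}"
    "\<And>x l. x \<in> E \<Longrightarrow> l \<in> D \<Longrightarrow> c x \<noteq> c (a l)" "card E + card D = r"
  shows "card (E \<union> a ` D) = r" "\<exists>f\<in>F. degenerate f (E \<union> a ` D)"
proof -
  have fin: "finite E" "finite D" using E D finX finite_subset by blast+
  have tr: "inj_on c (E \<union> a ` D)" "card (E \<union> a ` D) = r"
    using transversal_union[OF fin E(2), of a] inj_ca D by auto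
  then show "card (E \<union> a ` D) = r" by blast
  have "E \<union> a ` D \<subseteq> X" using E(1) D(1) a by auto
  then show "\<exists>f\<in>F. degenerate f (E \<union> a ` D)" using H tr by blast
qed

lemma core_row: "x \<in> X \<Longrightarrow> g x < r - 1 \<Longrightarrow> x \<noteq> x0 \<Longrightarrow> c x = c (a (g x))"
  using a[of "g x"] by (intro core_unsplit) auto

lemma y_row: "y \<in> {y1, y2} \<Longrightarrow> 0 < l \<Longrightarrow> l < r - 1 \<Longrightarrow> c y \<noteq> c (a l)"
  using row_core[of l y] y_in x0 r4 by auto

text \<open>Here \<open>x0\<close> can replace the representative of class 1. An \<open>f\<close>
  that is rainbow on \<open>x0\<close>, \<open>a 0\<close> and the classes from 2 on is twisted and
  gives both singletons the colour 0 of \<open>a 0\<close>; so no singleton can complete this set to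
  a rainbow one.\<close>

lemma rigid_twisted:
  assumes eq: "c x0 = c (a 1)"
  shows "\<exists>f\<in>F. same_kernel X c f"
proof -
  have lt: "0 < r - 1" "1 < r - 1" "2 < r - 1" using r4 by auto
  define D where "D = {2..<r - 1}"
  have D: "D \<subseteq> {..<r - 1}" "card D = r - 3" "2 \<in> D" unfolding D_def using r4 by auto
  have x0D: "c x0 \<noteq> c (a l)" if "l \<in> D" for l
    using inj_ca[of 1 l] that eq r4 unfolding D_def by auto
  have aD: "c (a 0) \<noteq> c (a l)" if "l \<in> D" for l
    using inj_ca[of 0 l] that r4 unfolding D_def by auto
  have x0a: "c x0 \<noteq> c (a 0)" using inj_ca[OF lt(2,1)] eq by auto
  have trans: "card ({x0, a 0, y} \<union> a ` D) = r \<and> (\<exists>f\<in>F. inj_on f ({x0, a 0, y} \<union> a ` D))"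
    if y: "y \<in> X" "c y \<noteq> c x0" "c y \<noteq> c (a 0)" "\<And>l. l \<in> D \<Longrightarrow> c y \<noteq> c (a l)" for y
  proof -
    have E: "{x0, a 0, y} \<subseteq> X" "inj_on c {x0, a 0, y}"
      using x0 a(1)[OF lt(1)] y x0a by auto
    have ED: "c x \<noteq> c (a l)" if "x \<in> {x0, a 0, y}" "l \<in> D" for x l
      using that x0D aD y(4) by auto
    have "card {x0, a 0, y} = 3" using x0a y by (auto simp: card_insert_if)
    then have cr: "card {x0, a 0, y} + card D = r" using D r4 by simp
    note m = mixed[OF E D(1) ED cr]
    from m(2) obtain f where f: "f \<in> F" "degenerate f ({x0, a 0, y} \<union> a ` D)"
      by blast
    have "f (a 0) = 0" "f (a 2) = 2" using F_a[OF f(1)] lt by auto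
    then have "\<not> monochromatic f ({x0, a 0, y} \<union> a ` D)"
      using monochromaticD[of f "{x0, a 0, y} \<union> a ` D" "a 0" "a 2"] D by auto
    then show ?thesis using f m(1) by blast
  qed
  have twist: "f x0 = 1" if f: "f \<in> F" "inj_on f ({x0, a 0, y} \<union> a ` D)" for f y
  proof (rule ccontr)
    assume "f x0 \<noteq> 1"
    then have "f x0 = 0" using F_twist[OF f(1), of y1] y_in by auto
    then have "f x0 = f (a 0)" using F_a[OF f(1)] lt by simp
    then show False using inj_onD[OF f(2), of x0 "a 0"] a(3)[OF lt(1)] by auto
  qed
  have cy: "c y = c (a 0)" if y: "y \<in> {y1, y2}" for y
  proof (rule ccontr)
    assume ne: "c y \<noteq> c (a 0)"
    have yX: "y \<in> X" "r \<le> g y" using y y_in by auto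
    have "c y \<noteq> c x0" using y_row[OF y, of 1] eq lt by simp
    moreover have "c y \<noteq> c (a l)" if "l \<in> D" for l using y_row[OF y, of l] that unfolding D_def by auto
    ultimately obtain f where f: "f \<in> F" "inj_on f ({x0, a 0, y} \<union> a ` D)" using trans[OF yX(1) _ ne] by blast
    have "f y = 0" using twist[OF f] F_twist[OF f(1) yX(2)] by auto
    then have "f y = f (a 0)" using F_a[OF f(1)] lt by simp
    then show False using inj_onD[OF f(2), of y "a 0"] yX a(2)[OF lt(1)] r4 by auto
  qed
  have low: "c x = c (a (tw x))" "tw x < r - 1" if x: "x \<in> X" "g x \<noteq> r - 1" for x
  proof -
    consider "x = x0" | "x \<noteq> x0" "g x < r - 1" | "x \<in> {y1, y2}" "x \<noteq> x0" "r \<le> g x"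
      using range[OF x(1)] x y12 by (cases "g x = r"; cases "g x = r + 1") fastforce+
    then show "c x = c (a (tw x))" "tw x < r - 1"
    proof (atomize (full), cases)
      case 1 then show "c x = c (a (tw x)) \<and> tw x < r - 1" using eq lt unfolding tw_def by simp
    next
      case 2
      have "tw x = g x" using 2 unfolding tw_def by auto
      then show "c x = c (a (tw x)) \<and> tw x < r - 1" using core_row[OF x(1) 2(2,1)] 2 by simp
    next
      case 3
      have "tw x = 0" using 3 unfolding tw_def by simp
      then show "c x = c (a (tw x)) \<and> tw x < r - 1" using cy[OF 3(1)] lt by simp
    qed
  qed
  have high: "tw x = r - 1" if "x \<in> X" "g x = r - 1" for x
    using that x0 r4 unfolding tw_def by auto
  have "c x = c y \<longleftrightarrow> tw x = tw y" if xy: "x \<in> X" "y \<in> X" for x y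
  proof -
    consider "g x = r - 1" "g y = r - 1" | "g x = r - 1" "g y \<noteq> r - 1" | "g x \<noteq> r - 1" "g y = r - 1"
      | "g x \<noteq> r - 1" "g y \<noteq> r - 1" by blast
    then show ?thesis
    proof cases
      case 1 then show ?thesis using Y_unsplit[OF xy 1] high xy by simp
    next
      case 2 then show ?thesis using Y_alone[OF xy(1) 2(1) xy(2) 2(2)] high[of x] low(2)[of y] xy by auto
    next
      case 3 then show ?thesis using Y_alone[OF xy(2) 3(2) xy(1) 3(1)] high[of y] low(2)[of x] xy by auto
    next
      case 4 then show ?thesis using low[OF xy(1)] low[OF xy(2)] inj_ca[of "tw x" "tw y"] by auto
    qed
  qed
  then have sk: "same_kernel X c tw" unfolding same_kernel_def by blast
  show ?thesis
  proof (cases p)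
    case True then show ?thesis using sk unfolding F_def by auto
  next
    case False
    \<comment> \<open>If \<open>tw\<close> is not in \<open>F\<close>, a block vertex would complete
      the rainbow \<open>r\<close>-set, leaving only \<open>twd\<close>, which has too few
      colours.\<close>
    have "cls X g (r - 1) = {}"
    proof (rule ccontr)
      assume "cls X g (r - 1) \<noteq> {}"
      then obtain z where z: "z \<in> X" "g z = r - 1" by blast
      have ne: "c z \<noteq> c x" if "x \<in> X" "g x \<noteq> r - 1" for x using Y_alone[OF z that] .
      have "c z \<noteq> c (a l)" if "l < r - 1" for l using ne[of "a l"] a[OF that] that by auto
      moreover have "c z \<noteq> c x0" using ne[of x0] x0 r4 by auto
      ultimately obtain f where f: "f \<in> F" "inj_on f ({x0, a 0, z} \<union> a ` D)"
        "card ({x0, a 0, z} \<union> a ` D) = r"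
        using trans[OF z(1)] D(1) lt by blast
      have "f = twd" using twist[OF f(1,2)] F_twist[OF f(1), of y1] y_in False by auto
      then have "f x < r - 1" if "x \<in> {x0, a 0, z} \<union> a ` D" for x
        using twd_less that x0 z a(1) D(1) lt by auto
      then show False using not_inj_few_values[OF _ f(3)] f(2) r4 by auto
    qed
    then have "twd x = tw x" if "x \<in> X" for x using that unfolding twd_def by auto
    then have "same_kernel X c twd" using sk unfolding same_kernel_def by simp
    then show ?thesis using False pp(1) unfolding F_def by auto
  qed
qed

text \<open>All members of \<open>F\<close> give \<open>x0\<close> the colour 0 or 1, so here
  \<open>x0\<close> must stay in class 0. A singleton cannot join class 0, since some
  \<open>f\<close> would then be constant on that class, including \<open>x0\<close>, and the
  singleton, contrary to \<open>F_twist\<close>.\<close>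

lemma rigid_untwisted:
  assumes ne: "c x0 \<noteq> c (a 1)"
  shows "\<exists>f\<in>F. same_kernel X c f"
proof -
  have lt: "0 < r - 1" "1 < r - 1" "2 < r - 1" using r4 by auto
  have x0l: "c x0 \<noteq> c (a l)" if "0 < l" "l < r - 1" for l
    using row_core[OF that x0(1)] x0 ne that by auto
  have x00: "c x0 = c (a 0)"
  proof (rule ccontr)
    assume n0: "c x0 \<noteq> c (a 0)"
    define D where "D = {1..<r - 1}"
    have "\<exists>f\<in>F. degenerate f ({x0, a 0} \<union> a ` D)"
    proof (rule mixed(2))
      show "{x0, a 0} \<subseteq> X" "D \<subseteq> {..<r - 1}" using x0 a(1)[OF lt(1)] unfolding D_def by auto
      show "inj_on c {x0, a 0}" using n0 by auto
      show "c x \<noteq> c (a l)" if "x \<in> {x0, a 0}" "l \<in> D" for x l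
        using that x0l[of l] inj_ca[of 0 l] lt unfolding D_def by auto
      have "card {x0, a 0} = 2" using n0 by (auto simp: card_insert_if)
      then show "card {x0, a 0} + card D = r" using r4 unfolding D_def by simp
    qed
    then obtain f where f: "f \<in> F" "degenerate f ({x0, a 0} \<union> a ` D)"
      by blast
    have fa: "f (a 0) = 0" "f (a 1) = 1" using F_a[OF f(1)] lt by auto
    have D1: "1 \<in> D" unfolding D_def using r4 by simp
    have "\<not> monochromatic f ({x0, a 0} \<union> a ` D)"
      using monochromaticD[of f "{x0, a 0} \<union> a ` D" "a 0" "a 1"] D1 fa by auto
    then have inj: "inj_on f ({x0, a 0} \<union> a ` D)" using f by blast
    have "f x0 = f (a 0) \<or> f x0 = f (a 1)" using F_twist[OF f(1), of y1] y_in fa by auto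
    then show False
      using inj_onD[OF inj, of x0 "a 0"] inj_onD[OF inj, of x0 "a 1"] D1 a(3)[OF lt(1)] a(3)[OF lt(2)] by auto
  qed
  have low: "c x = c (a (g x))" if "x \<in> X" "g x < r - 1" for x
    using core_row[OF that] x00 x0 by (cases "x = x0") auto
  have ya: "c y \<noteq> c (a l)" if y: "y \<in> {y1, y2}" and l: "l < r - 1" for y l
  proof (cases "l = 0")
    case False then show ?thesis using y_row[OF y _ l] by simp
  next
    case True
    show ?thesis
    proof
      assume eq: "c y = c (a l)"
      have yX: "y \<in> X" "r \<le> g y" using y y_in by auto
      define W where "W = cls X g 0"
      have finW: "finite W" unfolding W_def using finX by auto
      have yW: "y \<notin> W" using yX r4 unfolding W_def by auto
      have ce: "card (insert y W) = r" using finW yW core01(1) r4 unfolding W_def by simp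
      have "c t = c y" if "t \<in> W" for t using low[of t] that eq True lt unfolding W_def by simp
      then have "monochromatic c (insert y W)" by (intro monochromaticI[of _ _ "c y"]) auto
      then obtain f where f: "f \<in> F" "degenerate f (insert y W)"
        using H[of "insert y W"] ce yX unfolding W_def by blast
      have "2 \<le> card (W - {x0})" using core01(1) finW x0 r4 unfolding W_def by (simp add: card_Diff_singleton)
      from two_elements[OF this] obtain u v where uv: "u \<in> W - {x0}" "v \<in> W - {x0}" "u \<noteq> v" by blast
      have fuv: "f u = 0" "f v = 0" using uv F_core[OF f(1)] lt unfolding W_def by auto
      have "\<not> inj_on f (insert y W)" using inj_onD[of f "insert y W" u v] uv fuv by auto
      then have m: "monochromatic f (insert y W)" using f(2) by blast
      have "f y = 0" using monochromaticD[OF m, of y u] uv fuv by simp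
      moreover have "f x0 = 0" using monochromaticD[OF m, of x0 u] uv fuv x0 unfolding W_def by simp
      ultimately show False using F_twist[OF f(1) yX(2)] r4 by auto
    qed
  qed
  have gy: "x \<in> {y1, y2}" if "x \<in> X" "r \<le> g x" for x
    using range[OF that(1)] that y12 by (cases "g x = r"; cases "g x = r + 1") fastforce+
  have Yne: "c z \<noteq> c x" if "z \<in> X" "g z = r - 1" "x \<in> X" "g x \<noteq> r - 1" for z x
    using Y_alone[OF that] .
  have main: "c x = c y \<longleftrightarrow> g x = g y \<or> {x, y} = {y1, y2} \<and> c y1 = c y2" if xy: "x \<in> X" "y \<in> X" "g x \<le> g y" for x y
  proof -
    have triv: "y1 \<noteq> y2" "g y1 = r" "g y2 = r + 1" using y_in by auto
    consider "g y < r - 1" | "g x < r - 1" "g y = r - 1" | "g x < r - 1" "r \<le> g y" | "g x = r - 1" "g y = r - 1"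
      | "g x = r - 1" "r \<le> g y" | "r \<le> g x" "r \<le> g y" using xy(3) by linarith
    then show ?thesis
    proof cases
      case 1 then show ?thesis
        using low[OF xy(1)] low[OF xy(2)] xy(3) inj_ca[of "g x" "g y"] triv by (auto simp: doubleton_eq_iff)
    next
      case 2 then show ?thesis using Yne[of y x] xy triv by (auto simp: doubleton_eq_iff)
    next
      case 3 then show ?thesis
        using low[OF xy(1)] ya[OF gy[OF xy(2) 3(2)] 3(1)] triv by (auto simp: doubleton_eq_iff)
    next
      case 4 then show ?thesis using Y_unsplit[OF xy(1,2)] by simp
    next
      case 5
      then have "g y \<noteq> r - 1" using r4 by linarith
      then show ?thesis using Yne[of x y] xy 5 triv by (auto simp: doubleton_eq_iff)
    next
      case 6
      then have "x = y1 \<or> x = y2" "y = y1 \<or> y = y2" using gy xy by blast+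
      moreover have "x = y \<Longrightarrow> ?thesis" by simp
      moreover have "x = y1 \<Longrightarrow> y = y2 \<Longrightarrow> ?thesis" using triv by simp
      moreover have "x = y2 \<Longrightarrow> y = y1 \<Longrightarrow> ?thesis" using xy(3) triv by simp
      ultimately show ?thesis by blast
    qed
  qed
  have main': "c x = c y \<longleftrightarrow> g x = g y \<or> {x, y} = {y1, y2} \<and> c y1 = c y2" if xy: "x \<in> X" "y \<in> X" for x y
  proof (cases "g x \<le> g y")
    case True then show ?thesis using main[OF xy] by blast
  next
    case False
    then have "c y = c x \<longleftrightarrow> g y = g x \<or> {y, x} = {y1, y2} \<and> c y1 = c y2" using main[OF xy(2,1)] by simp
    then show ?thesis by (simp add: insert_commute eq_commute[of "c x"] eq_commute[of "g x"])
  qed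
  show ?thesis
  proof (cases "c y1 = c y2")
    case False
    then have "same_kernel X c g" using main' unfolding same_kernel_def by blast
    then show ?thesis unfolding F_def by blast
  next
    case True
    have mrg_eq: "mrg x = mrg y \<longleftrightarrow> g x = g y \<or> {x, y} = {y1, y2}" if xy: "x \<in> X" "y \<in> X" for x y
    proof -
      have "g t = r \<longleftrightarrow> t = y1" "g t = r + 1 \<longleftrightarrow> t = y2" if "t \<in> X" for t using that y12 by auto
      note t = this[OF xy(1)] this[OF xy(2)]
      show ?thesis using t y_in(5) unfolding mrg_def by (auto simp: doubleton_eq_iff)
    qed
    have "c x = c y \<longleftrightarrow> mrg x = mrg y" if "x \<in> X" "y \<in> X" for x y
      by (simp only: main'[OF that] mrg_eq[OF that] True simp_thms)
    then have "same_kernel X c mrg" unfolding same_kernel_def by blast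
    then show ?thesis unfolding F_def by blast
  qed
qed

end

end

section \<open>Twisted frames: colourings with fewer than \<open>r\<close> colours\<close>

context twist_frame
begin

definition Sp :: "nat set" where "Sp = {k. k < r - 1 \<and> card (C k) = r}"

lemma Sp_pos: "k \<in> Sp \<Longrightarrow> 0 < k"
  using C_card(1) r4 unfolding Sp_def by (cases "k = 0") auto

lemma Sp_eq: "Sp = insert 1 {k. k < r - 1 \<and> card (cls X g k) = r}"
proof (rule set_eqI)
  fix k :: nat
  consider "k = 0" | "k = 1" | "2 \<le> k" by linarith
  then show "k \<in> Sp \<longleftrightarrow> k \<in> insert 1 {k. k < r - 1 \<and> card (cls X g k) = r}"
    using C_card core01 r4 unfolding Sp_def by cases auto
qed

lemma Sp_card: "card Sp = card {k. k < r - 1 \<and> card (cls X g k) = r} + 1"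
proof -
  have "1 \<notin> {k. k < r - 1 \<and> card (cls X g k) = r}" using core01 r4 by auto
  then show ?thesis unfolding Sp_eq by simp
qed

lemma F_C: "f \<in> F \<Longrightarrow> x \<in> X \<Longrightarrow> g x < r - 1 \<Longrightarrow> 0 < f x \<Longrightarrow> x \<in> C (f x)"
  by (erule F_cases) (auto simp: C_def tw_def twd_def mrg_def x0)

lemma F_tw_like:
  assumes "f \<in> F" "y \<in> X" "r \<le> g y" "f y < r - 1" "x \<in> X" "g x < r - 1"
  shows "f y = 0 \<and> f x = tw x \<and> (f = tw \<or> p' \<and> f = twd)"
  using F_twist[OF assms(1,3)] assms(4,6) by (auto simp: twd_def)

end

context twist_frame_colouring
begin

context
  assumes few: "card (c ` X) \<le> r - 1"
begin

lemma K_subset_large: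
  assumes e: "e \<subseteq> K v" "card e = r"
  shows "\<exists>k\<in>Sp. e = C k"
proof -
  have "monochromatic c e" using e(1) unfolding K_def by (intro monochromaticI[of _ _ v]) auto
  then obtain f where f: "f \<in> F" "degenerate f e" using H e K_X by blast
  have low: "f x < r - 1" if "x \<in> e" for x
    using that e(1) F_core_less[OF f(1)] unfolding K_def by auto
  then have "\<not> inj_on f e" using e(2) r4 by (intro not_inj_few_values) auto
  then have m: "monochromatic f e" using f(2) by blast
  have "2 \<le> card (e - {x0})" using e(2) r4 by (auto simp: card_Diff_singleton_if)
  from two_elements[OF this] obtain x where x: "x \<in> e" "x \<noteq> x0" by blast
  define k where "k = f x"
  have k: "k < r - 1" unfolding k_def using low x by blast
  have fk: "f t = k" if "t \<in> e" for t unfolding k_def using monochromaticD[OF m that x(1)] .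
  have "e \<subseteq> C k"
  proof (cases "k = 0")
    case False
    then show ?thesis using F_C[OF f(1)] fk e(1) unfolding K_def by fastforce
  next
    case True
    \<comment> \<open>Twisted or not, core vertices of colour 0 come from class 0 of
      \<open>g\<close>, which is too small for \<open>e\<close>.\<close>
    have "e \<subseteq> cls X g 0"
    proof
      fix t assume t: "t \<in> e"
      have "g t = 0" using F_core[OF f(1), of t] fk[OF t] True x0 t e(1) unfolding K_def by (cases "t = x0") auto
      then show "t \<in> cls X g 0" using t e(1) K_X by auto
    qed
    then have "r \<le> r - 1" using card_mono[of "cls X g 0" e] finX core01(1) e(2) by simp
    then show ?thesis using r4 by simp
  qed
  then have "e = C k" "card (C k) = r"
    using card_seteq[OF finC, of e k] card_mono[OF finC, of e k] C_card_le[OF k] e(2) by auto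
  then show ?thesis using k unfolding Sp_def by blast
qed

text \<open>An \<open>r\<close>-subset of the row fills some \<open>C k\<close>. Exchanging one of
  its vertices for a further vertex of the row would fill a different set \<open>C l\<close> that
  still meets \<open>C k\<close>.\<close>

lemma K_large:
  assumes "r \<le> card (K v)"
  shows "\<exists>k\<in>Sp. K v = C k"
proof -
  obtain e where e: "e \<subseteq> K v" "card e = r" using assms by (rule obtain_subset_with_card_n)
  obtain k where k: "k \<in> Sp" "e = C k" using K_subset_large[OF e] by blast
  have "K v \<subseteq> e"
  proof (rule ccontr)
    assume "\<not> K v \<subseteq> e"
    then obtain t where t: "t \<in> K v" "t \<notin> e" by blast
    have "2 \<le> card e" using e r4 by simp
    from two_elements[OF this] obtain s s' where s: "s \<in> e" "s' \<in> e" "s \<noteq> s'" by blast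
    have "finite e" using e finK finite_subset by blast
    then have "card (insert t (e - {s})) = r" using card_exchange[of e s t] s t e by simp
    then obtain l where l: "l \<in> Sp" "insert t (e - {s}) = C l"
      using K_subset_large[of "insert t (e - {s})" v] e(1) t by blast
    have "s' \<in> C k" "s' \<in> C l" using k l s by auto
    then have "k = l" unfolding C_def by auto
    then show False using k l t by auto
  qed
  then show ?thesis using k e by blast
qed

lemma row_count:
  shows "(\<Sum>v\<in>c ` X. (r - 1) - card (K v)) + card {k. k < r - 1 \<and> card (cls X g k) = r}
      = card {v \<in> c ` X. r - 1 < card (K v)}"
    and "{v \<in> c ` X. r - 1 < card (K v)} \<subseteq> (\<lambda>k. c (a k)) ` Sp"
proof -
  define Vs where "Vs = {v \<in> c ` X. r - 1 < card (K v)}"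
  have finSp: "finite Sp" unfolding Sp_def by auto
  have sub: "Vs \<subseteq> (\<lambda>k. c (a k)) ` Sp"
  proof
    fix v assume "v \<in> Vs"
    then have "r \<le> card (K v)" unfolding Vs_def by auto
    then obtain k where k: "k \<in> Sp" "K v = C k" using K_large by blast
    then have "a k \<in> K v" using a_C unfolding Sp_def by auto
    then show "v \<in> (\<lambda>k. c (a k)) ` Sp" using k unfolding K_def by auto
  qed
  then show "{v \<in> c ` X. r - 1 < card (K v)} \<subseteq> (\<lambda>k. c (a k)) ` Sp" unfolding Vs_def .
  have cVs: "card Vs \<le> card Sp" by (rule surj_card_le[OF finSp sub])
  have "cls {x \<in> X. g x < r - 1} c v = K v" for v unfolding K_def by auto
  then have sum: "(\<Sum>v\<in>c ` X. card (K v)) = (r - 1) * (r - 1) + card {k. k < r - 1 \<and> card (cls X g k) = r}"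
    using sum_card_cls[of "{x \<in> X. g x < r - 1}" "c ` X" c] finX core_total[OF finX _ core] r4 by auto
  have le: "card (K v) \<le> r - 1 + 1" if "v \<in> c ` X" for v
  proof (rule ccontr)
    assume gt: "\<not> card (K v) \<le> r - 1 + 1"
    then have "r \<le> card (K v)" by linarith
    then obtain k where "k \<in> Sp" "K v = C k" using K_large by blast
    then show False using gt unfolding Sp_def by auto
  qed
  have over: "card {v \<in> c ` X. r - 1 < card (K v)} \<le> card {k. k < r - 1 \<and> card (cls X g k) = r} + 1"
    using cVs Sp_card unfolding Vs_def by simp
  have n2: "2 \<le> r - 1" using r4 by simp
  show "(\<Sum>v\<in>c ` X. (r - 1) - card (K v)) + card {k. k < r - 1 \<and> card (cls X g k) = r}
      = card {v \<in> c ` X. r - 1 < card (K v)}"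
    by (rule row_deficit(2)[OF finite_imageI[OF finX] few n2 le sum over])
qed

text \<open>Using all \<open>r - 1\<close> core colours includes using \<open>k\<close>, but
  vertices of colour \<open>k\<close> lie in \<open>C k\<close>, which is another row. It matters
  that \<open>k\<close> is positive: \<open>x0\<close> can have the colour 0 without being in
  \<open>C 0\<close>.\<close>

lemma full_row_not_inj:
  assumes v: "K v' = C k" "k \<in> Sp" "v' \<noteq> v" and f: "f \<in> F" and W: "W \<subseteq> K v" "card W = r - 1"
  shows "\<not> inj_on f W"
proof
  assume inj: "inj_on f W"
  have "f ` W \<subseteq> {..<r - 1}" using W F_core_less[OF f] unfolding K_def by auto
  moreover have "card (f ` W) = card {..<r - 1}" using inj W by (simp add: card_image)
  ultimately have "f ` W = {..<r - 1}" by (intro card_subset_eq) auto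
  moreover have "k < r - 1" using v unfolding Sp_def by auto
  ultimately have "k \<in> f ` W" by simp
  then obtain w where w: "w \<in> W" "k = f w" by blast
  then have "w \<in> C k" using F_C[OF f, of w] Sp_pos[OF v(2)] W(1) unfolding K_def by auto
  then have "w \<in> K v'" using v by simp
  then show False using v(3) w(1) W(1) unfolding K_def by auto
qed

text \<open>A row with \<open>r - 1\<close> core vertices would be constant, together with
  \<open>y\<close>, for a twisted \<open>f\<close>; then these vertices would lie in
  \<open>C 0\<close>, which has only \<open>r - 2\<close>.\<close>

lemma y_row_small:
  assumes y: "y \<in> X" "r \<le> g y"
  shows "card (K (c y)) < r - 1"
proof (rule ccontr)
  assume "\<not> card (K (c y)) < r - 1"
  then have "r - 1 \<le> card (K (c y))" by simp
  then obtain W where W: "W \<subseteq> K (c y)" "card W = r - 1" by (rule obtain_subset_with_card_n)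
  have "{k. k < r - 1 \<and> card (cls X g k) = r} \<noteq> {}" "finite {k. k < r - 1 \<and> card (cls X g k) = r}" using big by auto
  then have "card {k. k < r - 1 \<and> card (cls X g k) = r} \<noteq> 0" by (simp only: card_0_eq) simp
  then have "card {v \<in> c ` X. r - 1 < card (K v)} \<noteq> 0" using row_count(1) by linarith
  then have "{v \<in> c ` X. r - 1 < card (K v)} \<noteq> {}" by (metis card.empty)
  then obtain v0 where "v0 \<in> c ` X" "r - 1 < card (K v0)" by blast
  then have "r \<le> card (K v0)" by linarith
  then obtain k0 where k0: "k0 \<in> Sp" "K v0 = C k0" using K_large by blast
  have yW: "y \<notin> W" using W y unfolding K_def by auto
  have fin: "finite W" using W finK finite_subset by blast
  have "card (insert y W) = r" using yW fin W r4 by simp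
  then obtain f where f: "f \<in> F" "degenerate f (insert y W)"
    using H[of "insert y W"] K_mono[OF W(1)] W(1) K_X y by blast
  have "\<not> inj_on f W"
  proof (cases "v0 = c y")
    case True
    then show ?thesis using F_C_not_inj[OF f(1), of W k0 W] k0 W r4 by simp
  next
    case False
    then show ?thesis using full_row_not_inj[OF k0(2,1) False f(1) W] by simp
  qed
  then have m: "monochromatic f (insert y W)" using f(2) inj_on_subset[of f "insert y W" W] by blast
  have tw: "tw w = 0" if w: "w \<in> W" for w
  proof -
    have wX: "w \<in> X" "g w < r - 1" using w W unfolding K_def by auto
    have "f y = f w" using monochromaticD[OF m, of y w] w by blast
    then show ?thesis using F_tw_like[OF f(1) y _ wX] F_core_less[OF f(1) wX(2)] by simp
  qed
  then have "W \<subseteq> C 0" using W(1) unfolding C_def K_def by auto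
  then have "card W \<le> card (C 0)" by (rule card_mono[OF finC])
  then show False using W C_card(1) r4 by simp
qed

text \<open>The count leaves a total deficit of at most one. Both singletons lie in deficient rows,
  so they share a row of deficit one and everything else is tight.\<close>

lemma rows:
  shows "k \<in> Sp \<Longrightarrow> K (c (a k)) = C k"
    and "v \<in> c ` X \<Longrightarrow> v \<notin> (\<lambda>k. c (a k)) ` Sp \<Longrightarrow> v \<noteq> c y1 \<Longrightarrow> card (K v) = r - 1"
    and "card (K (c y1)) = r - 2" and "c y2 = c y1"
proof -
  define Vs where "Vs = {v \<in> c ` X. r - 1 < card (K v)}"
  define def where "def = (\<lambda>v. (r - 1) - card (K v))"
  have finSp: "finite Sp" unfolding Sp_def by auto
  have finV: "finite (c ` X)" using finX by simp
  have sub: "Vs \<subseteq> (\<lambda>k. c (a k)) ` Sp" using row_count(2) unfolding Vs_def .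
  have cVs: "card Vs \<le> card Sp" by (rule surj_card_le[OF finSp sub])
  have eq: "(\<Sum>v\<in>c ` X. def v) + card Sp = card Vs + 1"
    using row_count(1) Sp_card unfolding Vs_def def_def by simp
  have pos: "1 \<le> def (c y1)" "1 \<le> def (c y2)"
    using y_row_small[of y1] y_row_small[of y2] y_in unfolding def_def by auto
  have split: "(\<Sum>v\<in>c ` X. def v) = def (c y1) + (\<Sum>v\<in>c ` X - {c y1}. def v)"
    using finV y_in by (intro sum.remove) auto
  have d1: "def (c y1) = 1" "(\<Sum>v\<in>c ` X - {c y1}. def v) = 0" "card Vs = card Sp"
    using eq split pos cVs by linarith+
  have zero: "def v = 0" if "v \<in> c ` X" "v \<noteq> c y1" for v
  proof -
    have "\<forall>v\<in>c ` X - {c y1}. def v = 0" using d1(2) finV by (simp only: sum_eq_0_iff finite_Diff)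
    then show ?thesis using that by simp
  qed
  show "card (K (c y1)) = r - 2" using d1(1) r4 unfolding def_def by simp
  show "c y2 = c y1" using zero[of "c y2"] pos(2) y_in by force
  have "card ((\<lambda>k. c (a k)) ` Sp) \<le> card Vs" using card_image_le[OF finSp] d1(3) by metis
  then have VsEq: "Vs = (\<lambda>k. c (a k)) ` Sp" using finSp by (intro card_seteq sub) auto
  show "K (c (a k)) = C k" if k: "k \<in> Sp" for k
  proof -
    have "c (a k) \<in> Vs" using VsEq k by auto
    then have "r \<le> card (K (c (a k)))" unfolding Vs_def by auto
    then obtain l where l: "l \<in> Sp" "K (c (a k)) = C l" using K_large by blast
    have "k < r - 1" using k unfolding Sp_def by auto
    then have "a k \<in> K (c (a k))" "a k \<in> C k" using a[of k] a_C[of k] unfolding K_def by auto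
    then have "a k \<in> C l" "a k \<in> C k" using l by auto
    then have "k = l" unfolding C_def by auto
    then show ?thesis using l by simp
  qed
  show "card (K v) = r - 1" if v: "v \<in> c ` X" "v \<notin> (\<lambda>k. c (a k)) ` Sp" "v \<noteq> c y1" for v
  proof -
    have "(r - 1) - card (K v) = 0" using zero[OF v(1,3)] unfolding def_def .
    moreover have "v \<notin> Vs" using v VsEq by auto
    ultimately show ?thesis using v unfolding Vs_def by auto
  qed
qed

lemma y1_not_Sp: "k \<in> Sp \<Longrightarrow> c (a k) \<noteq> c y1"
  using rows(1)[of k] rows(3) r4 unfolding Sp_def by auto

lemma row_y1: "K (c y1) = C 0"
proof -
  define e where "e = insert y1 (insert y2 (K (c y1)))"
  have yK: "y1 \<notin> insert y2 (K (c y1))" "y2 \<notin> K (c y1)" using y_in unfolding K_def by auto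
  have ce: "card e = r" unfolding e_def using yK finK rows(3) r4 by simp
  have "monochromatic c e"
    unfolding e_def using rows(4) by (intro monochromaticI[of _ _ "c y1"]) (auto simp: K_def)
  moreover have "e \<subseteq> X" unfolding e_def using y_in K_X by auto
  ultimately obtain f where f: "f \<in> F" "degenerate f e" using H ce by blast
  obtain k0 where k0: "k0 < r - 1" "card (cls X g k0) = r" using big by blast
  have Sp2: "1 \<in> Sp" "k0 \<in> Sp" "k0 \<noteq> 1" "k0 < r - 1" using k0 core01 r4 unfolding Sp_eq by auto
  have avoid: "f w \<noteq> k" if "w \<in> K (c y1)" "k \<in> Sp" for w k
  proof
    assume fw: "f w = k"
    have "w \<in> C k" using F_C[OF f(1), of w] fw Sp_pos[OF that(2)] that(1) unfolding K_def by auto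
    then have "w \<in> K (c (a k))" using rows(1)[OF that(2)] by simp
    then show False using y1_not_Sp[OF that(2)] that(1) unfolding K_def by auto
  qed
  \<comment> \<open>The row avoids the colours 1 and \<open>k0\<close>, whose classes are rows of
    their own. This leaves \<open>r - 3\<close> colours for \<open>r - 2\<close> vertices.\<close>
  have "\<not> inj_on f e"
  proof
    assume "inj_on f e"
    then have "inj_on f (K (c y1))" by (rule inj_on_subset) (auto simp: e_def)
    then have "card (f ` K (c y1)) = r - 2" using rows(3) by (simp add: card_image)
    moreover have "f ` K (c y1) \<subseteq> {..<r - 1} - {1, k0}"
      using avoid Sp2 F_core_less[OF f(1)] unfolding K_def by auto
    then have "card (f ` K (c y1)) \<le> card ({..<r - 1} - {1, k0})" by (intro card_mono) auto
    moreover have "card ({..<r - 1} - {1, k0}) = r - 3" using Sp2 r4 by (subst card_Diff_subset) auto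
    ultimately show False using r4 by simp
  qed
  then have m: "monochromatic f e" using f(2) by blast
  have "K (c y1) \<subseteq> C 0"
  proof
    fix w assume w: "w \<in> K (c y1)"
    have wX: "w \<in> X" "g w < r - 1" using w unfolding K_def by auto
    have "f y1 = f w" using monochromaticD[OF m, of y1 w] w unfolding e_def by blast
    then have "tw w = 0"
      using F_tw_like[OF f(1), of y1 w] y_in wX F_core_less[OF f(1) wX(2)] by simp
    then show "w \<in> C 0" using wX unfolding C_def by simp
  qed
  then show ?thesis using rows(3) C_card(1) finC by (intro card_subset_eq) auto
qed

text \<open>The vertex \<open>z\<close> and \<open>r - 1\<close> vertices of its row, or
  \<open>z\<close>, \<open>y1\<close> and the core part of the row of the singletons, form an
  \<open>r\<close>-set. An \<open>f\<close> degenerate on it is constant, so it gives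
  \<open>z\<close> a core colour and can only be \<open>twd\<close>.\<close>

lemma row_Y:
  assumes z: "z \<in> X" "g z = r - 1"
  shows "K (c z) = C (d z) \<and> p'"
proof -
  have zK: "z \<notin> K v" for v using z unfolding K_def by auto
  have finish: "p' \<and> d z = k" if "f \<in> F" "f z = k" "k < r - 1" for f k
    using F_Y_low[OF that(1) z] that by auto
  consider "c z = c y1" | "c z \<noteq> c y1" "c z \<in> (\<lambda>k. c (a k)) ` Sp"
    | "c z \<noteq> c y1" "c z \<notin> (\<lambda>k. c (a k)) ` Sp" by blast
  then show ?thesis
  proof cases
    case 1
    define e where "e = insert z (insert y1 (K (c y1)))"
    have "y1 \<notin> K (c y1)" "z \<noteq> y1" using y_in z r4 unfolding K_def by auto
    then have ce: "card e = r" unfolding e_def using zK[of "c y1"] finK rows(3) r4 by simp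
    have "monochromatic c e"
      unfolding e_def using 1 by (intro monochromaticI[of _ _ "c y1"]) (auto simp: K_def)
    moreover have "e \<subseteq> X" unfolding e_def using y_in K_X z by auto
    ultimately obtain f where f: "f \<in> F" "degenerate f e" using H ce by blast
    have "2 \<le> card (C 0)" using C_card(1) r4 by simp
    from two_elements[OF this] obtain s t where st: "s \<in> C 0" "t \<in> C 0" "s \<noteq> t" by blast
    have fst: "f s = 0" "f t = 0" using F_C_const[OF f(1)] st C_eq(1) by auto
    have ste: "s \<in> e" "t \<in> e" using st row_y1 unfolding e_def by auto
    then have "\<not> inj_on f e" using inj_onD[of f e s t] st fst by auto
    then have m: "monochromatic f e" using f(2) by blast
    have "f z = 0" using monochromaticD[OF m, of z s] ste fst unfolding e_def by simp
    then have "p' \<and> d z = 0" using finish[OF f(1)] r4 by simp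
    then show ?thesis using row_y1 1 by simp
  next
    case 2
    then obtain k where k: "k \<in> Sp" "c z = c (a k)" by blast
    have k1: "k < r - 1" "card (C k) = r" using k unfolding Sp_def by auto
    then obtain W where W: "W \<subseteq> C k" "card W = r - 1"
      using obtain_subset_with_card_n[of "r - 1" "C k"] by (metis diff_le_self)
    have WK: "W \<subseteq> K (c z)" using W rows(1)[OF k(1)] k(2) by simp
    have fin: "finite W" using W finC finite_subset by blast
    have "z \<notin> W" using zK[of "c z"] WK by blast
    then have "card (insert z W) = r" using fin W r4 by simp
    then obtain f where f: "f \<in> F" "degenerate f (insert z W)"
      using H[of "insert z W"] K_mono[OF WK] WK K_X z by blast
    have "\<not> inj_on f (insert z W)" using F_C_not_inj[OF f(1) W(1)] W r4 by auto
    then have m: "monochromatic f (insert z W)" using f(2) by blast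
    have "2 \<le> card (W - {x0})" using W(2) r4 by (auto simp: card_Diff_singleton_if)
    from two_elements[OF this] obtain w where w: "w \<in> W" "w \<noteq> x0" by blast
    have "f w = k" using F_C_const[OF f(1), of w k] w W by auto
    then have "f z = k" using monochromaticD[OF m, of z w] w by simp
    then show ?thesis using finish[OF f(1) _ k1(1)] rows(1)[OF k(1)] k(2) by simp
  next
    case 3
    have cK: "card (K (c z)) = r - 1" using rows(2)[OF _ 3(2,1)] z by blast
    have "card (insert z (K (c z))) = r" using zK finK cK r4 by simp
    then obtain f where f: "f \<in> F" "degenerate f (insert z (K (c z)))"
      using H[of "insert z (K (c z))"] K_mono[of "K (c z)" z] K_X z by blast
    have one: "1 \<in> Sp" unfolding Sp_eq by simp
    have ne1: "c (a k) \<noteq> c z" if "k \<in> Sp" for k using 3(2) that by (metis image_eqI)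
    have "\<not> inj_on f (K (c z))"
      by (rule full_row_not_inj[OF rows(1)[OF one] one ne1[OF one] f(1) order_refl cK])
    then have m: "monochromatic f (insert z (K (c z)))"
      using f(2) inj_on_subset[of f "insert z (K (c z))" "K (c z)"] by blast
    have "K (c z) \<noteq> {}" using cK r4 by auto
    then obtain w where w: "w \<in> K (c z)" by blast
    define k where "k = f w"
    have k: "k < r - 1" unfolding k_def using w F_core_less[OF f(1)] unfolding K_def by auto
    have fz: "f z = k" unfolding k_def using monochromaticD[OF m, of z w] w by blast
    have dz: "p' \<and> d z = k" by (rule finish[OF f(1) fz k])
    have twd: "f = twd" using F_Y_low[OF f(1) z] fz k by simp
    have sub: "K (c z) \<subseteq> C k"
    proof
      fix t assume t: "t \<in> K (c z)"
      have "f t = k" unfolding k_def using monochromaticD[OF m, of t w] t w by blast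
      then show "t \<in> C k" using t twd unfolding K_def C_def twd_def by auto
    qed
    have "k \<notin> Sp"
    proof
      assume kS: "k \<in> Sp"
      then have "w \<in> K (c (a k))" using rows(1)[OF kS] sub w by auto
      then show False using ne1[OF kS] w unfolding K_def by auto
    qed
    moreover have "r - 1 \<le> card (C k)" using card_mono[OF finC sub] cK by simp
    ultimately have "card (C k) = r - 1" using C_card_le[OF k] k unfolding Sp_def by auto
    then have "K (c z) = C k" using cK sub finC by (intro card_subset_eq) auto
    then show ?thesis using dz by simp
  qed
qed

lemma rigid_few: "\<exists>f\<in>F. same_kernel X c f"
proof -
  have pp': "p'"
  proof (cases "cls X g (r - 1) = {}")
    case True then show ?thesis using pp(2) by blast
  next
    case False
    then obtain z where "z \<in> X" "g z = r - 1" by blast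
    then show ?thesis using row_Y by blast
  qed
  have row: "K (c x) = C (twd x)" if x: "x \<in> X" for x
  proof -
    consider "g x = r - 1" | "r \<le> g x" | "g x < r - 1" by linarith
    then show ?thesis
    proof cases
      case 1 then show ?thesis using row_Y[OF x] by (simp add: twd_def)
    next
      case 2
      have "x \<in> {y1, y2}" using range[OF x] 2 x y12 by (cases "g x = r"; cases "g x = r + 1") fastforce+
      then have "c x = c y1" using rows(4) by auto
      moreover have "twd x = 0" using 2 r4 x0 unfolding twd_def tw_def by auto
      ultimately show ?thesis using row_y1 by simp
    next
      case 3
      have xC: "x \<in> C (tw x)" using x 3 unfolding C_def by simp
      have lt: "tw t < r - 1" if "g t < r - 1" for t using that r4 unfolding tw_def by auto
      \<comment> \<open>Only classes of size \<open>r - 1\<close> other than 0 and 1 can fail to be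
        rows, which is why \<open>hit\<close> speaks about colours from 2 on.\<close>
      have unrow: "2 \<le> k \<and> k \<notin> Sp \<and> card (cls X g k) = r - 1" if k: "k < r - 1" "\<And>v. K v \<noteq> C k" for k
      proof -
        have "k \<noteq> 0" using k(2)[of "c y1"] row_y1 by auto
        moreover have "k \<notin> Sp" using k(2) rows(1) by blast
        moreover have "1 \<in> Sp" unfolding Sp_eq by simp
        ultimately have "2 \<le> k" by (cases "k = 1") auto
        then show ?thesis using \<open>k \<notin> Sp\<close> core[OF k(1)] C_card(3)[OF _ k(1)] k(1) unfolding Sp_def by auto
      qed
      have "K (c x) = C (tw x)"
      proof (cases "\<exists>v. K v = C (tw x)")
        case True
        then obtain v where v: "K v = C (tw x)" by blast
        then have "x \<in> K v" using xC by simp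
        then show ?thesis using v unfolding K_def by auto
      next
        case nK: False
        note un = unrow[OF lt[OF 3]]
        have u: "2 \<le> tw x" "tw x \<notin> Sp" "card (cls X g (tw x)) = r - 1" using un nK by blast+
        have xK: "x \<in> K (c x)" using x 3 unfolding K_def by simp
        have other: "K (c x) \<noteq> C k" if "k \<noteq> tw x" for k
          using xK that unfolding C_def by auto
        have ny: "c x \<noteq> c y1"
        proof
          assume "c x = c y1"
          then have "K (c x) = C 0" using row_y1 by simp
          then show False using other[of 0] u(1) by simp
        qed
        have notSp: "c x \<notin> (\<lambda>k. c (a k)) ` Sp"
        proof
          assume "c x \<in> (\<lambda>k. c (a k)) ` Sp"
          then obtain k where k: "k \<in> Sp" "c x = c (a k)" by blast
          have "K (c x) = C k" unfolding k(2) by (rule rows(1)[OF k(1)])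
          moreover have "k \<noteq> tw x" using k(1) u(2) by blast
          ultimately show False using other by blast
        qed
        have cK: "card (K (c x)) = r - 1" using rows(2)[OF _ notSp ny] x by blast
        have sub: "K (c x) \<subseteq> C (tw x)"
        proof
          fix y assume y: "y \<in> K (c x)"
          have yX: "y \<in> X" "g y < r - 1" "c y = c x" using y unfolding K_def by auto
          show "y \<in> C (tw x)"
          proof (rule ccontr)
            assume "y \<notin> C (tw x)"
            then have ne: "tw x \<noteq> tw y" using yX unfolding C_def by auto
            have nKy: "K v \<noteq> C (tw y)" for v
            proof
              assume v: "K v = C (tw y)"
              then have "y \<in> K v" using yX unfolding C_def by auto
              then have "v = c x" using yX unfolding K_def by auto
              then show False using v other[of "tw y"] ne by simp
            qed
            note uy = unrow[OF lt[OF yX(2)] nKy]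
            obtain z where z: "z \<in> X" "g z = r - 1" "d z = tw x \<or> d z = tw y"
              using hit[OF u(1) lt[OF 3] _ lt[OF yX(2)] ne u(3)] uy by blast
            then show False using row_Y[OF z(1,2)] nK nKy by auto
          qed
        qed
        have "card (C (tw x)) = r - 1" using C_card(3)[OF u(1) lt[OF 3]] u(3) by simp
        then have "K (c x) = C (tw x)" using cK sub finC by (intro card_subset_eq) auto
        then show ?thesis using nK by blast
      qed
      then show ?thesis using 3 by (simp add: twd_def)
    qed
  qed
  have "c x = c y \<longleftrightarrow> twd x = twd y" if xy: "x \<in> X" "y \<in> X" for x y
  proof
    assume "c x = c y"
    then have "C (twd x) = C (twd y)" using row[OF xy(1)] row[OF xy(2)] by simp
    moreover have "a (twd x) \<in> C (twd x)" by (rule a_C[OF twd_less[OF xy(1)]])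
    ultimately show "twd x = twd y" unfolding C_def by auto
  next
    assume eq: "twd x = twd y"
    have "a (twd x) \<in> C (twd x)" by (rule a_C[OF twd_less[OF xy(1)]])
    then have "a (twd x) \<in> K (c x)" "a (twd x) \<in> K (c y)" using row[OF xy(1)] row[OF xy(2)] eq by simp_all
    then show "c x = c y" unfolding K_def by auto
  qed
  then have "same_kernel X c twd" unfolding same_kernel_def by blast
  then show ?thesis using pp' unfolding F_def by auto
qed

end

lemma rigid: "\<exists>f\<in>F. same_kernel X c f"
proof (cases "card (c ` X) \<le> r - 1")
  case True then show ?thesis by (rule rigid_few)
next
  case False
  then have "r \<le> card (c ` X)" by simp
  then show ?thesis using rigid_twisted rigid_untwisted by (cases "c x0 = c (a 1)") blast+
qed

end

section \<open>Twisted frames: the realized set\<close>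

context twist_frame
begin

definition M :: "nat set" where "M = {..<r - 1} \<union> (if cls X g (r - 1) = {} then {} else {r - 1})"

lemma M_card: "card M = (if cls X g (r - 1) = {} then r - 1 else r)" "finite M" "r \<notin> M" "Suc r \<notin> M"
  using r4 unfolding M_def by (auto simp: card_insert_if)

lemma tw_image: "tw ` X = M"
proof (intro equalityI subsetI)
  fix v assume "v \<in> tw ` X"
  then obtain x where "x \<in> X" "v = tw x" by blast
  then show "v \<in> M" using range[of x] r4 unfolding M_def tw_def by (auto split: if_splits)
next
  fix v assume v: "v \<in> M"
  show "v \<in> tw ` X"
  proof (cases "v < r - 1")
    case True
    then have "a v \<in> X" "v = tw (a v)" using a_C[OF True] unfolding C_def by auto
    then show ?thesis by (rule image_eqI[rotated])
  next
    case False
    then obtain z where "z \<in> X" "g z = v" "v = r - 1" using v unfolding M_def by (auto split: if_splits)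
    then have "v = tw z" using x0 r4 unfolding tw_def by auto
    then show ?thesis using \<open>z \<in> X\<close> by (rule image_eqI)
  qed
qed

lemma twd_image: "twd ` X = {..<r - 1}"
proof (intro equalityI subsetI)
  fix v assume "v \<in> twd ` X"
  then show "v \<in> {..<r - 1}" using twd_less by auto
next
  fix v assume "v \<in> {..<r - 1}"
  then have v: "v < r - 1" by simp
  have "a v \<in> X" "v = twd (a v)" using a_C[OF v] unfolding C_def twd_def by auto
  then show "v \<in> twd ` X" by (rule image_eqI[rotated])
qed

lemma g_image: "g ` X = insert r (insert (r + 1) M)"
proof (intro equalityI subsetI)
  fix v assume "v \<in> g ` X"
  then obtain x where "x \<in> X" "v = g x" by blast
  then show "v \<in> insert r (insert (r + 1) M)" using range[of x] unfolding M_def by (auto split: if_splits)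
next
  fix v assume v: "v \<in> insert r (insert (r + 1) M)"
  then consider "v < r - 1" | "v \<in> M" "v = r - 1" | "v = r" | "v = r + 1"
    unfolding M_def by (auto split: if_splits)
  then show "v \<in> g ` X"
  proof cases
    case 1 then show ?thesis using a[OF 1] image_eqI[of v g "a v" X] by simp
  next
    case 2
    then obtain z where "z \<in> X" "g z = v" unfolding M_def by (auto split: if_splits)
    then show ?thesis using image_eqI[of v g z X] by simp
  next
    case 3 then show ?thesis using y_in image_eqI[of v g y1 X] by simp
  next
    case 4 then show ?thesis using y_in image_eqI[of v g y2 X] by simp
  qed
qed

lemma mrg_image: "mrg ` X = insert r M"
proof -
  have "mrg ` X = (\<lambda>v. if v = r + 1 then r else v) ` (g ` X)"
    unfolding image_image by (rule image_cong) (simp_all add: mrg_def)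
  then show ?thesis unfolding g_image using M_card(4) by auto
qed

theorem twist_frame_realization:
  defines "m \<equiv> (if cls X g (r - 1) = {} then r - 1 else r)"
  shows "\<exists>B. realizes r X B ({m + 2, m + 1} \<union> (if p then {m} else {}) \<union> (if p' then {r - 1} else {}))"
proof -
  have cards: "card (g ` X) = m + 2" "card (mrg ` X) = m + 1" "card (tw ` X) = m" "card (twd ` X) = r - 1"
    unfolding g_image mrg_image tw_image twd_image m_def using M_card by auto
  have "\<exists>B. realizes r X B ((\<lambda>f. card (f ` X)) ` F)"
  proof (rule one_realizationI_rigid[OF finX])
    fix c :: "'a \<Rightarrow> nat"
    assume H: "\<And>e. e \<subseteq> X \<Longrightarrow> card e = r \<Longrightarrow> degenerate c e \<Longrightarrow> \<exists>f\<in>F. degenerate f e"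
    interpret twist_frame_colouring X g d r x0 y1 y2 p p' c
      by unfold_locales (rule H)
    show "\<exists>f\<in>F. same_kernel X c f" by (rule rigid)
  next
    fix f f' assume f: "f \<in> F" and f': "f' \<in> F" and eq: "card (f ` X) = card (f' ` X)"
    have mr: "r - 1 \<le> m" "p \<Longrightarrow> m = r" using pp(2) unfolding m_def by auto
    show "f = f'"
      using f f' eq cards mr r4 unfolding F_def by (auto split: if_splits)
  qed
  moreover have "(\<lambda>f. card (f ` X)) ` F = {m + 2, m + 1} \<union> (if p then {m} else {}) \<union> (if p' then {r - 1} else {})"
    unfolding F_def using cards by auto
  ultimately show ?thesis by simp
qed

end

subsection \<open>Realizations of minimum size\<close>

text \<open>Pairs of class and index are coded as natural numbers because \<open>delta\<close>
  ranges over such vertex sets; the index \<open>i\<close> later determines where a moved vertex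
  goes.\<close>

lemma blocks_exist:
  fixes b :: "nat \<Rightarrow> nat"
  shows "\<exists>(X :: nat set) g i. finite X \<and> (\<forall>x\<in>X. g x < N) \<and>
    (\<forall>k<N. bij_betw i (cls X g k) {..<b k}) \<and> card X = (\<Sum>k<N. b k)"
proof -
  define X where "X = prod_encode ` (SIGMA k:{..<N}. {..<b k})"
  define g where "g = fst \<circ> prod_decode"
  define i where "i = snd \<circ> prod_decode"
  have "bij_betw i (cls X g k) {..<b k}" if "k < N" for k
    by (rule bij_betw_byWitness[where f' = "\<lambda>j. prod_encode (k, j)"])
      (use that in \<open>auto simp: X_def g_def i_def\<close>)
  moreover have "card X = (\<Sum>k<N. b k)"
    unfolding X_def by (subst card_image) (auto simp: inj_on_def)
  moreover have "finite X" "\<forall>x\<in>X. g x < N" unfolding X_def g_def by auto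
  ultimately show ?thesis by blast
qed

lemma sized_block_frame:
  fixes b :: "nat \<Rightarrow> nat" and \<delta> :: "nat \<Rightarrow> nat \<Rightarrow> nat"
  assumes r: "4 \<le> r" "r \<le> N"
    and core: "\<And>k. k < r - 1 \<Longrightarrow> b k = r - 1 \<or> b k = r" and big: "\<exists>k<r - 1. b k = r"
    and block: "\<And>k. r - 1 \<le> k \<Longrightarrow> k < N \<Longrightarrow> 1 \<le> b k \<and> b k < r"
    and S: "S \<subseteq> {r - 1..N}" "N \<in> S"
    and \<delta>: "\<And>k j. r - 1 \<le> k \<Longrightarrow> k < N \<Longrightarrow> j < b k \<Longrightarrow> \<delta> k j < r - 1"
    and moved: "\<And>n k. n \<in> S \<Longrightarrow> n \<le> k \<Longrightarrow> k < N \<Longrightarrow> r < N \<Longrightarrow>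
      2 \<le> b k \<and> b k < r - 1 \<and> inj_on (\<delta> k) {..<b k}"
    and pair: "\<And>k k'. r - 1 \<le> k \<Longrightarrow> k < k' \<Longrightarrow> k' < N \<Longrightarrow> \<not> (mg \<and> k = N - 2 \<and> k' = N - 1) \<Longrightarrow> r \<le> b k + b k'"
    and hit: "\<And>k k'. r - 1 \<in> S \<Longrightarrow> k < r - 1 \<Longrightarrow> k' < r - 1 \<Longrightarrow> k \<noteq> k' \<Longrightarrow> b k = r - 1 \<Longrightarrow> b k' = r - 1 \<Longrightarrow>
      \<exists>l j. r - 1 \<le> l \<and> l < N \<and> j < b l \<and> (\<delta> l j = k \<or> \<delta> l j = k')"
    and mg: "mg \<Longrightarrow> r < N \<and> N - 1 \<notin> S"
  shows "\<exists>(X :: nat set) B. realizes r X B (S \<union> (if mg then {N - 1} else {})) \<and> card X = (\<Sum>k<N. b k)"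
proof -
  obtain X :: "nat set" and g i where X: "finite X" "\<forall>x\<in>X. g x < N"
    and i: "\<And>k. k < N \<Longrightarrow> bij_betw i (cls X g k) {..<b k}" and cX: "card X = (\<Sum>k<N. b k)"
    using blocks_exist[of N b] by blast
  have c: "card (cls X g k) = b k" if "k < N" for k using bij_betw_same_card[OF i[OF that]] by simp
  define d where "d = (\<lambda>x. \<delta> (g x) (i x))"
  have inj: "inj_on d (cls X g k)" if "k < N" "inj_on (\<delta> k) {..<b k}" for k
  proof -
    have "inj_on (\<delta> k \<circ> i) (cls X g k)"
      using i[OF that(1)] that(2) unfolding bij_betw_def by (intro comp_inj_on) auto
    then show ?thesis by (rule inj_on_cong[THEN iffD1, rotated]) (auto simp: d_def)
  qed
  have "block_frame X g d r N S mg"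
  proof
    show "finite X" "4 \<le> r" "r \<le> N" "S \<subseteq> {r - 1..N}" "N \<in> S" by fact+
    show "g x < N" if "x \<in> X" for x using X that by blast
    show "card (cls X g k) = r - 1 \<or> card (cls X g k) = r" if "k < r - 1" for k
      using core[OF that] c[of k] that r by auto
    obtain k where "k < r - 1" "b k = r" using big by blast
    then show "\<exists>k<r - 1. card (cls X g k) = r" using c[of k] r by auto
    show "1 \<le> card (cls X g k) \<and> card (cls X g k) < r" if "r - 1 \<le> k" "k < N" for k
      using block[OF that] c that by simp
    show "d x < r - 1" if x: "x \<in> X" "r - 1 \<le> g x" for x
    proof -
      have "g x < N" using X x by blast
      moreover have "i x \<in> {..<b (g x)}" using bij_betw_apply[OF i[OF \<open>g x < N\<close>], of x] x by simp
      ultimately show ?thesis using \<delta>[OF x(2)] unfolding d_def by simp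
    qed
    show "2 \<le> card (cls X g k) \<and> card (cls X g k) < r - 1 \<and> inj_on d (cls X g k)"
      if "n \<in> S" "n \<le> k" "k < N" "r < N" for n k
      using moved[OF that] inj[OF that(3)] c[OF that(3)] by simp
    show "r \<le> card (cls X g k) + card (cls X g k')"
      if "r - 1 \<le> k" "k < k'" "k' < N" "\<not> (mg \<and> k = N - 2 \<and> k' = N - 1)" for k k'
      using pair[OF that] c[of k] c[of k'] that by simp
    show "\<exists>z\<in>X. r - 1 \<le> g z \<and> (d z = k \<or> d z = k')"
      if h: "r - 1 \<in> S" "k < r - 1" "k' < r - 1" "k \<noteq> k'"
        "card (cls X g k) = r - 1" "card (cls X g k') = r - 1" for k k'
    proof -
      have "k < N" "k' < N" using h r by auto
      then obtain l j where l: "r - 1 \<le> l" "l < N" "j < b l" "\<delta> l j = k \<or> \<delta> l j = k'"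
        using hit[OF h(1-4)] h(5,6) c by auto
      then have "j \<in> i ` cls X g l" using i[OF l(2)] unfolding bij_betw_def by auto
      then obtain z where "z \<in> X" "g z = l" "i z = j" by blast
      then show ?thesis using l unfolding d_def by auto
    qed
    show "r < N \<and> N - 1 \<notin> S" if mg using mg[OF that] .
  qed
  then show ?thesis using block_frame.block_frame_realization cX by blast
qed

lemma core_sum:
  fixes b :: "nat \<Rightarrow> nat"
  assumes "1 \<le> r" "0 < q" "\<And>k. k < q \<Longrightarrow> b k = (if k = 0 then r else r - 1)"
  shows "(\<Sum>k<q. b k) = q * (r - 1) + 1"
proof -
  have "(\<Sum>k<q. b k) = (\<Sum>k<q. (r - 1) + (if k = 0 then 1 else 0))"
    using assms by (intro sum.cong refl) auto
  then show ?thesis using assms(2) by (simp only: sum.distrib) simp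
qed

lemma sum_lessThan_split:
  fixes b :: "nat \<Rightarrow> nat"
  assumes "p \<le> q" "\<And>k. p \<le> k \<Longrightarrow> k < q \<Longrightarrow> b k = v"
  shows "(\<Sum>k<q. b k) = (\<Sum>k<p. b k) + (q - p) * v"
proof -
  have "(\<Sum>k<q. b k) = (\<Sum>k<p. b k) + (\<Sum>k=p..<q. b k)"
    using assms(1) by (simp add: lessThan_atLeast0 sum.atLeastLessThan_concat)
  also have "(\<Sum>k=p..<q. b k) = (\<Sum>k=p..<q. v)" using assms(2) by (intro sum.cong refl) auto
  finally show ?thesis by simp
qed

text \<open>Block \<open>r - 1\<close> is assigned to the core classes from below, all others from
  above. The blocks \<open>r - 1\<close> and \<open>r\<close>, of sizes at least
  \<open>r - h\<close> and \<open>h\<close>, then reach every core class.\<close>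

lemma spread:
  fixes h r :: nat
  assumes h: "2 \<le> h" "2 * h \<le> r" "r \<le> 2 * h + 1"
    and \<delta>_def: "\<delta> = (\<lambda>k j. if k = r - 1 then j else r - 2 - j)"
  shows "b \<in> {r - h, h} \<Longrightarrow> 2 \<le> b \<and> b < r - 1 \<and> inj_on (\<delta> k) {..<b}"
    and "b \<in> {r - h, h} \<Longrightarrow> j < b \<Longrightarrow> \<delta> k j < r - 1"
    and "k < r - 1 \<Longrightarrow> \<exists>l\<in>{r - 1, r}. \<exists>j<(if l = r then h else r - h). \<delta> l j = k"
proof -
  show "2 \<le> b \<and> b < r - 1 \<and> inj_on (\<delta> k) {..<b}" if "b \<in> {r - h, h}"
  proof -
    have "2 \<le> b" "b < r - 1" using that h by auto
    moreover from this have "inj_on (\<delta> k) {..<b}" unfolding inj_on_def \<delta>_def by auto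
    ultimately show ?thesis by blast
  qed
  show "\<delta> k j < r - 1" if "b \<in> {r - h, h}" "j < b"
    using that h unfolding \<delta>_def by auto
  show "\<exists>l\<in>{r - 1, r}. \<exists>j<(if l = r then h else r - h). \<delta> l j = k" if k: "k < r - 1"
  proof (cases "k < r - h")
    case True
    then show ?thesis using h by (intro bexI[of _ "r - 1"] exI[of _ k]) (auto simp: \<delta>_def)
  next
    case False
    then show ?thesis using h k by (intro bexI[of _ r] exI[of _ "r - 2 - k"]) (auto simp: \<delta>_def)
  qed
qed

lemma realization_blocks:
  assumes r: "4 \<le> r" "r < N" and S: "S \<subseteq> {r - 1..N}" "N \<in> S" and mg: "mg \<Longrightarrow> r + 2 \<le> N \<and> N - 1 \<notin> S"
  shows "\<exists>(X :: nat set) B. realizes r X B (S \<union> (if mg then {N - 1} else {})) \<and>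
    int (card X) = (int N - 2) * int r - (int N - int r - 1) * int (r div 2) + 2
      - (if mg then int r - 2 * int (r div 2) else 0)"
proof -
  define h where "h = r div 2"
  have h: "2 \<le> h" "2 * h \<le> r" "r \<le> 2 * h + 1" using r unfolding h_def by auto
  define q where "q = (if mg then N - 2 else N - 1)"
  have q: "r \<le> q" "q < N" "mg \<Longrightarrow> N = q + 2" "\<not> mg \<Longrightarrow> N = q + 1" using r mg unfolding q_def by auto
  \<comment> \<open>Sizes \<open>r - h\<close> and \<open>h\<close> are as unequal as needed: any
    two blocks except two of size \<open>h\<close> have at least \<open>r\<close> vertices together.
    With \<open>mg\<close> the last two have size \<open>h\<close> and are the pair to be
    merged.\<close>
  define b where "b = (\<lambda>k. if k = 0 then r else if k < r - 1 then r - 1 else if k < q then r - h else h)"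
  define \<delta> where "\<delta> = (\<lambda>k j. if k = r - 1 then j else r - 2 - j)"
  note \<delta> = spread[OF h \<delta>_def]
  have bk: "b k \<in> {r - h, h}" if "r - 1 \<le> k" for k using that r unfolding b_def by auto
  have br: "b (r - 1) = r - h" "h \<le> b r" using r q h unfolding b_def by auto
  have ex: "\<exists>(X :: nat set) B. realizes r X B (S \<union> (if mg then {N - 1} else {})) \<and> card X = (\<Sum>k<N. b k)"
  proof (rule sized_block_frame)
    show "\<exists>k<r - 1. b k = r" using r by (intro exI[of _ 0]) (simp add: b_def)
    show "2 \<le> b k \<and> b k < r - 1 \<and> inj_on (\<delta> k) {..<b k}" if "n \<in> S" "n \<le> k" for n k
    proof -
      have "r - 1 \<le> k" using S(1) that by force
      then show ?thesis by (rule \<delta>(1)[OF bk])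
    qed
    show "r \<le> b k + b k'"
      if "r - 1 \<le> k" "k < k'" "k' < N" "\<not> (mg \<and> k = N - 2 \<and> k' = N - 1)" for k k'
    proof -
      have "k < q" using that(2-4) q(3,4) by (cases mg) linarith+
      then show ?thesis using that(1,2) h r unfolding b_def by auto
    qed
    show "\<delta> k j < r - 1" if "r - 1 \<le> k" "j < b k" for k j
      by (rule \<delta>(2)[OF bk[OF that(1)] that(2)])
    show "\<exists>l j. r - 1 \<le> l \<and> l < N \<and> j < b l \<and> (\<delta> l j = k \<or> \<delta> l j = k')" if k: "k < r - 1" for k k'
    proof -
      obtain l j where l: "l \<in> {r - 1, r}" "j < (if l = r then h else r - h)" "\<delta> l j = k"
        using \<delta>(3)[OF k] by blast
      have "j < b l"
      proof (cases "l = r")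
        case False
        then have "l = r - 1" using l(1) by simp
        then show ?thesis using l(2) False br(1) by simp
      qed (use l(2) br(2) in simp)
      moreover have "r - 1 \<le> l" "l < N" using l(1) r by auto
      ultimately show ?thesis using l(3) by blast
    qed
  qed (use r S h mg in \<open>auto simp: b_def\<close>)
  have total: "(\<Sum>k<N. b k) = (r - 1) * (r - 1) + 1 + (q - (r - 1)) * (r - h) + (N - q) * h"
  proof -
    have "(\<Sum>k<N. b k) = (\<Sum>k<q. b k) + (N - q) * h"
      using r q by (intro sum_lessThan_split) (auto simp: b_def)
    moreover have "(\<Sum>k<q. b k) = (\<Sum>k<r - 1. b k) + (q - (r - 1)) * (r - h)"
      using r q by (intro sum_lessThan_split) (auto simp: b_def)
    moreover have "(\<Sum>k<r - 1. b k) = (r - 1) * (r - 1) + 1"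
      using r by (intro core_sum) (auto simp: b_def)
    ultimately show ?thesis by simp
  qed
  have int: "int ((r - 1) * (r - 1) + 1 + (q - (r - 1)) * (r - h) + (N - q) * h) =
      (int r - 1) * (int r - 1) + 1 + (int q - (int r - 1)) * (int r - int h) + (int N - int q) * int h"
    using r h q by (simp add: of_nat_diff)
  obtain X :: "nat set" and B where X: "uniform_bi_hypergraph r X B"
    "one_realization X B (S \<union> (if mg then {N - 1} else {}))" "card X = (\<Sum>k<N. b k)" using ex by blast
  have "int (card X) = (int N - 2) * int r - (int N - int r - 1) * int h + 2
      - (if mg then int r - 2 * int h else 0)"
    unfolding X(3) total int using q(3,4) by (cases mg) (simp_all add: algebra_simps)
  then show ?thesis using X unfolding h_def by blast
qed

text \<open>Nothing is distributed: the frame is used with the set \<open>{N}\<close>, and the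
  colouring with \<open>N - 1\<close> colours merges two singletons.\<close>

lemma realization_pair:
  assumes r: "4 \<le> r" "r < N"
  shows "\<exists>(X :: nat set) B. realizes r X B {N, N - 1} \<and>
    int (card X) = (int N - 2) * (int r - 1) + 3"
proof -
  define b where "b = (\<lambda>k. if k = 0 then r else if k < N - 2 then r - 1 else 1)"
  have ex: "\<exists>(X :: nat set) B. realizes r X B ({N} \<union> (if True then {N - 1} else {})) \<and> card X = (\<Sum>k<N. b k)"
  proof (rule sized_block_frame[where \<delta> = "\<lambda>_ _. 0"])
    show "\<exists>k<r - 1. b k = r" using r by (intro exI[of _ 0]) (simp add: b_def)
    show "r \<le> b k + b k'"
      if "r - 1 \<le> k" "k < k'" "k' < N" "\<not> (True \<and> k = N - 2 \<and> k' = N - 1)" for k k'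
    proof -
      have "k < N - 2" using that(2-4) by presburger
      then show ?thesis using that(1,2) r unfolding b_def by auto
    qed
  qed (use r in \<open>auto simp: b_def\<close>)
  have total: "(\<Sum>k<N. b k) = (N - 2) * (r - 1) + 3"
  proof -
    have "N = Suc (Suc (N - 2))" using r by simp
    then obtain q where q: "N = Suc (Suc q)" by blast
    have "(\<Sum>k<q. b k) = q * (r - 1) + 1" using r q by (intro core_sum) (auto simp: b_def)
    moreover have "b q = 1" "b (Suc q) = 1" using r q by (auto simp: b_def)
    ultimately show ?thesis by (simp add: q)
  qed
  have int: "int ((N - 2) * (r - 1) + 3) = (int N - 2) * (int r - 1) + 3"
    using r by (simp add: of_nat_diff)
  obtain X :: "nat set" and B where X: "uniform_bi_hypergraph r X B" "one_realization X B {N, N - 1}"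
    "card X = (\<Sum>k<N. b k)" using ex by (auto simp: insert_commute)
  have "int (card X) = (int N - 2) * (int r - 1) + 3"
    unfolding X(3) total int by (simp add: algebra_simps)
  then show ?thesis using X by blast
qed

lemma realization_smallest:
  assumes r: "4 \<le> r"
  shows "\<exists>(X :: nat set) B. realizes r X B {r, r - 1} \<and>
    int (card X) = int r * (int r - 1) - 1"
proof -
  \<comment> \<open>Two core classes of size \<open>r - 1\<close> are possible because the only
    block vertex goes to class 0, which is one of them.\<close>
  define b where "b = (\<lambda>k. if k < 2 then r - 1 else if k < r - 1 then r else 1)"
  have ex: "\<exists>(X :: nat set) B. realizes r X B ({r, r - 1} \<union> (if False then {r - 1} else {})) \<and> card X = (\<Sum>k<r. b k)"
  proof (rule sized_block_frame[where \<delta> = "\<lambda>_ _. 0"])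
    show "\<exists>k<r - 1. b k = r" using r by (intro exI[of _ 2]) (simp add: b_def)
    show "\<exists>l j. r - 1 \<le> l \<and> l < r \<and> j < b l \<and> ((0::nat) = k \<or> 0 = k')"
      if "k \<noteq> k'" "k < r - 1" "k' < r - 1" "b k = r - 1" "b k' = r - 1" for k k'
      using that r by (intro exI[of _ "r - 1"] exI[of _ 0]) (auto simp: b_def split: if_splits)
  qed (use r in \<open>auto simp: b_def\<close>)
  have total: "(\<Sum>k<r. b k) = 2 * (r - 1) + (r - 3) * r + 1"
  proof -
    have "{..<r} = insert 0 (insert 1 (insert (r - 1) {2..<r - 1}))" using r by auto
    then have "(\<Sum>k<r. b k) = b 0 + b 1 + b (r - 1) + (\<Sum>k=2..<r - 1. b k)" using r by simp
    moreover have "b 0 = r - 1" "b 1 = r - 1" "b (r - 1) = 1" using r unfolding b_def by auto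
    ultimately have "(\<Sum>k<r. b k) = 2 * (r - 1) + 1 + (\<Sum>k=2..<r - 1. b k)" by linarith
    also have "(\<Sum>k=2..<r - 1. b k) = (\<Sum>k=2..<r - 1. r)" by (intro sum.cong refl) (auto simp: b_def)
    finally show ?thesis by (simp add: numeral_3_eq_3 numeral_2_eq_2)
  qed
  have int: "int (2 * (r - 1) + (r - 3) * r + 1) = 2 * (int r - 1) + (int r - 3) * int r + 1"
    using r by (simp add: of_nat_diff)
  obtain X :: "nat set" and B where X: "uniform_bi_hypergraph r X B" "one_realization X B {r, r - 1}"
    "card X = (\<Sum>k<r. b k)" using ex by auto
  have "int (card X) = int r * (int r - 1) - 1"
    unfolding X(3) total int by (simp add: algebra_simps)
  then show ?thesis using X by blast
qed

lemma sized_twist_frame: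
  fixes b :: "nat \<Rightarrow> nat"
  assumes r: "4 \<le> r" and b01: "b 0 = r - 1" "b 1 = r - 1" and b12: "b r = 1" "b (r + 1) = 1"
    and core: "\<And>k. k < r - 1 \<Longrightarrow> b k = r - 1 \<or> b k = r" and big: "\<exists>k<r - 1. b k = r"
    and Y: "b (r - 1) = 0 \<or> b (r - 1) = r - 1"
    and pp: "p \<or> p'" "b (r - 1) = 0 \<Longrightarrow> p' \<and> \<not> p"
    and hit: "\<And>k k'. 2 \<le> k \<Longrightarrow> k < r - 1 \<Longrightarrow> 2 \<le> k' \<Longrightarrow> k' < r - 1 \<Longrightarrow> k \<noteq> k' \<Longrightarrow>
      b k = r - 1 \<Longrightarrow> b k' = r - 1 \<Longrightarrow> b (r - 1) \<noteq> 0"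
  defines "m \<equiv> (if b (r - 1) = 0 then r - 1 else r)"
  shows "\<exists>(X :: nat set) B. realizes r X B ({m + 2, m + 1} \<union> (if p then {m} else {}) \<union> (if p' then {r - 1} else {})) \<and>
    card X = (\<Sum>k<r + 2. b k)"
proof -
  obtain X :: "nat set" and g i where X: "finite X" "\<forall>x\<in>X. g x < r + 2"
    and i: "\<And>k. k < r + 2 \<Longrightarrow> bij_betw i (cls X g k) {..<b k}" and cX: "card X = (\<Sum>k<r + 2. b k)"
    using blocks_exist[of "r + 2" b] by blast
  have c: "card (cls X g k) = b k" if "k < r + 2" for k using bij_betw_same_card[OF i[OF that]] by simp
  have "card (cls X g 0) \<noteq> 0" using c[of 0] b01 r by simp
  then obtain x0 where x0: "x0 \<in> X" "g x0 = 0" by (auto simp: card_eq_0_iff)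
  obtain y1 y2 where y: "cls X g r = {y1}" "cls X g (r + 1) = {y2}"
    using c[of r] c[of "r + 1"] b12 by (auto simp: card_1_singleton_iff)
  have cY: "cls X g (r - 1) = {} \<longleftrightarrow> b (r - 1) = 0"
  proof -
    have "cls X g (r - 1) = {} \<longleftrightarrow> card (cls X g (r - 1)) = 0" using X(1) by (subst card_0_eq) auto
    then show ?thesis using c[of "r - 1"] by simp
  qed
  \<comment> \<open>The index serves as \<open>d\<close>: a block of \<open>r - 1\<close> vertices
    sends one vertex to each core class.\<close>
  have "twist_frame X g i r x0 y1 y2 p p'"
  proof
    show "finite X" "4 \<le> r" "x0 \<in> X" "g x0 = 0" "cls X g r = {y1}" "cls X g (r + 1) = {y2}" "p \<or> p'"
      by fact+
    show "g x \<le> r + 1" if "x \<in> X" for x using X that by fastforce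
    show "card (cls X g k) = r - 1 \<or> card (cls X g k) = r" if "k < r - 1" for k
      using core[OF that] c[of k] that by auto
    show "card (cls X g 0) = r - 1" "card (cls X g 1) = r - 1" using c b01 r by auto
    obtain k where "k < r - 1" "b k = r" using big by blast
    then show "\<exists>k<r - 1. card (cls X g k) = r" using c[of k] by auto
    show "cls X g (r - 1) = {} \<or> card (cls X g (r - 1)) = r - 1"
      unfolding cY using Y c[of "r - 1"] by auto
    have iY: "bij_betw i (cls X g (r - 1)) {..<b (r - 1)}" by (rule i) simp
    then show "inj_on i (cls X g (r - 1))" by (rule bij_betw_imp_inj_on)
    show "i x < r - 1" if "x \<in> X" "g x = r - 1" for x
      using bij_betw_apply[OF iY, of x] that Y by auto
    show "p' \<and> \<not> p" if "cls X g (r - 1) = {}" by (rule pp(2)[OF iffD1[OF cY that]])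
    show "\<exists>z\<in>X. g z = r - 1 \<and> (i z = k \<or> i z = k')"
      if h: "2 \<le> k" "k < r - 1" "2 \<le> k'" "k' < r - 1" "k \<noteq> k'"
        "card (cls X g k) = r - 1" "card (cls X g k') = r - 1" for k k'
    proof -
      have "k < r + 2" "k' < r + 2" using h by auto
      then have "b k = r - 1" "b k' = r - 1" using c h(6,7) by metis+
      then have "b (r - 1) \<noteq> 0" by (rule hit[OF h(1-5)])
      then have "k \<in> {..<b (r - 1)}" using Y h by auto
      then have "k \<in> i ` cls X g (r - 1)" using iY unfolding bij_betw_def by simp
      then show ?thesis by blast
    qed
  qed
  from twist_frame.twist_frame_realization[OF this, unfolded cY, folded m_def]
  obtain B where "realizes r X B ({m + 2, m + 1} \<union> (if p then {m} else {}) \<union> (if p' then {r - 1} else {}))"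
    by (rule exE)
  then show ?thesis using cX by (intro exI[of _ X] exI[of _ B] conjI) (rule conjunct1, assumption, rule conjunct2, assumption, assumption)
qed

lemma realization_three:
  assumes r: "4 \<le> r"
  shows "\<exists>(X :: nat set) B. realizes r X B {r + 1, r, r - 1} \<and>
    card X = (if r = 4 then 12 else r * (r - 1) - 1)"
proof -
  \<comment> \<open>Without a block, \<open>hit\<close> allows only one class of size
    \<open>r - 1\<close> besides 0 and 1. For \<open>r = 4\<close> class 2 is the only candidate for
    the class of size \<open>r\<close> required by \<open>big\<close>; the additional vertex gives
    the exceptional value 12.\<close>
  define b where "b = (\<lambda>k. if k < 2 then r - 1 else if k = 2 then (if r = 4 then r else r - 1)
    else if k < r - 1 then r else if k = r - 1 then 0 else (1::nat))"
  have br: "b (r - 1) = 0" using r by (auto simp: b_def)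
  have mr: "(if b (r - 1) = 0 then r - 1 else r) = r - 1" using br by simp
  have ex: "\<exists>(X :: nat set) B. realizes r X B ({(if b (r - 1) = 0 then r - 1 else r) + 2, (if b (r - 1) = 0 then r - 1 else r) + 1} \<union>
      (if False then {if b (r - 1) = 0 then r - 1 else r} else {}) \<union> (if True then {r - 1} else {})) \<and>
    card X = (\<Sum>k<r + 2. b k)"
  proof (rule sized_twist_frame)
    show "\<exists>k<r - 1. b k = r"
    proof (cases "r = 4")
      case True then show ?thesis by (intro exI[of _ 2]) (simp add: b_def)
    next
      case False then show ?thesis using r by (intro exI[of _ 3]) (auto simp: b_def)
    qed
  qed (use r in \<open>auto simp: b_def split: if_splits\<close>)
  have S: "{(r - 1) + 2, (r - 1) + 1} \<union> (if False then {r - 1} else {}) \<union> (if True then {r - 1} else {}) = {r + 1, r, r - 1}"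
    using r by auto
  have total: "(\<Sum>k<r + 2. b k) = (if r = 4 then 12 else r * (r - 1) - 1)"
  proof -
    obtain q where q: "r = q + 4" using r by (metis add.commute le_Suc_ex)
    have "(\<Sum>k<r - 1. b k) = (\<Sum>k<3. b k) + (r - 1 - 3) * r"
      using r by (intro sum_lessThan_split) (auto simp: b_def)
    moreover have "(\<Sum>k<3. b k) = 2 * (r - 1) + (if r = 4 then r else r - 1)"
      by (simp add: b_def numeral_3_eq_3)
    moreover have "(\<Sum>k<r + 2. b k) = (\<Sum>k<r - 1. b k) + b (r - 1) + b r + b (r + 1)"
      unfolding q by (simp add: numeral_eq_Suc)
    moreover have "b r = 1" "b (r + 1) = 1" using r by (auto simp: b_def)
    ultimately have sum: "(\<Sum>k<r + 2. b k) = 2 * (r - 1) + (if r = 4 then r else r - 1) + (r - 1 - 3) * r + 2"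
      using br by simp
    show ?thesis unfolding sum unfolding q by (auto simp: algebra_simps)
  qed
  show ?thesis using ex unfolding mr S total .
qed

lemma realization_two_above:
  assumes r: "4 \<le> r" and pp: "p \<or> p'"
  shows "\<exists>(X :: nat set) B. realizes r X B ({r + 2, r + 1} \<union> (if p then {r} else {}) \<union> (if p' then {r - 1} else {})) \<and>
    card X = r * (r - 1) + 3"
proof -
  \<comment> \<open>The block reaches every core class, so one core class of size \<open>r\<close>
    suffices.\<close>
  define b where "b = (\<lambda>k. if k = 2 then r else if k < r then r - 1 else (1::nat))"
  have br: "b (r - 1) \<noteq> 0" using r by (simp add: b_def)
  have mr: "(if b (r - 1) = 0 then r - 1 else r) = r" using br by simp
  have ex: "\<exists>(X :: nat set) B. realizes r X B ({(if b (r - 1) = 0 then r - 1 else r) + 2, (if b (r - 1) = 0 then r - 1 else r) + 1} \<union>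
      (if p then {if b (r - 1) = 0 then r - 1 else r} else {}) \<union> (if p' then {r - 1} else {})) \<and>
    card X = (\<Sum>k<r + 2. b k)"
  proof (rule sized_twist_frame)
    show "\<exists>k<r - 1. b k = r" using r by (intro exI[of _ 2]) (auto simp: b_def)
  qed (use r pp in \<open>auto simp: b_def split: if_splits\<close>)
  have total: "(\<Sum>k<r + 2. b k) = r * (r - 1) + 3"
  proof -
    obtain q where q: "r = q + 4" using r by (metis add.commute le_Suc_ex)
    have "(\<Sum>k<r. b k) = (\<Sum>k<3. b k) + (r - 3) * (r - 1)"
      using r by (intro sum_lessThan_split) (auto simp: b_def)
    moreover have "(\<Sum>k<3. b k) = 2 * (r - 1) + r"
      using r by (simp add: b_def numeral_3_eq_3)
    moreover have "(\<Sum>k<r + 2. b k) = (\<Sum>k<r. b k) + b r + b (r + 1)" by simp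
    moreover have "b r = 1" "b (r + 1) = 1" using r by (auto simp: b_def)
    ultimately have sum: "(\<Sum>k<r + 2. b k) = 2 * (r - 1) + r + (r - 3) * (r - 1) + 2" by simp
    show ?thesis unfolding sum unfolding q by (simp add: algebra_simps)
  qed
  show ?thesis using ex unfolding mr total .
qed

section \<open>Matching the bounds with the constructions\<close>

context realized
begin

lemma top_bound:
  assumes N: "N \<in> S" "r < N"
  shows "(int N - 2) * int r - (int N - int r - 1) * int (r div 2) + 2 \<le> int (card X) \<or>
    N - 1 \<in> S \<and> (\<exists>t. 1 \<le> t \<and> 2 * t < r \<and> (int N - 3) * int r + 2 - int t * (int N - int r - 3) \<le> int (card X))"
proof -
  obtain c where c: "proper B c" "card (c ` X) = N" using ex_colouring[OF N(1)] by blast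
  show ?thesis
  proof (cases "\<forall>u\<in>c ` X. \<forall>v\<in>c ` X. u \<noteq> v \<longrightarrow> r \<le> card (cls X c u) + card (cls X c v)")
    case True
    then show ?thesis using no_small_pair_bound[OF c(1,2) N(2)] by blast
  next
    case False
    then obtain u' v' where uv': "u' \<in> c ` X" "v' \<in> c ` X" "u' \<noteq> v'"
      "card (cls X c u') + card (cls X c v') < r" by (auto simp: not_le)
    obtain u v where uv: "u \<in> c ` X" "v \<in> c ` X" "u \<noteq> v"
      "card (cls X c u) + card (cls X c v) < r" "card (cls X c u) \<le> card (cls X c v)"
    proof (cases "card (cls X c u') \<le> card (cls X c v')")
      case True then show ?thesis using that[of u' v'] uv' by blast
    next
      case False then show ?thesis using that[of v' u'] uv' by linarith
    qed
    have "N - 1 \<in> S"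
      using card_in[OF merge_proper(1)[OF c(1) uv(1-4)]] merge_proper(2)[OF c(1) uv(1-4)] c(2) by simp
    then show ?thesis using small_pair_bound[OF c(1,2) N(2) uv] by blast
  qed
qed

end

lemma delta_eqI:
  assumes "\<exists>(X :: nat set) B. realizes r X B S \<and> int (card X) = D"
    and "\<And>(X :: nat set) B. uniform_bi_hypergraph r X B \<Longrightarrow> one_realization X B S \<Longrightarrow> D \<le> int (card X)"
  shows "int (delta r S) = D"
proof -
  obtain X :: "nat set" and B where X: "uniform_bi_hypergraph r X B" "one_realization X B S" "int (card X) = D"
    using assms(1) by blast
  have "delta r S = card X"
    unfolding delta_def
  proof (rule Least_equality)
    show "\<exists>(X' :: nat set) B. uniform_bi_hypergraph r X' B \<and> one_realization X' B S \<and> card X' = card X"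
      using X by blast
    fix m assume "\<exists>(X' :: nat set) B. uniform_bi_hypergraph r X' B \<and> one_realization X' B S \<and> card X' = m"
    then obtain X' :: "nat set" and B' where "uniform_bi_hypergraph r X' B'" "one_realization X' B' S" "card X' = m"
      by blast
    then show "card X \<le> m" using assms(2)[of X' B'] X(3) by simp
  qed
  then show ?thesis using X(3) by simp
qed

theorem theorem1p1:
  fixes s r :: nat and n :: "nat \<Rightarrow> nat" and S :: "nat set"
  assumes "s \<ge> 2" and "r \<ge> 4"
    and "\<forall>i j. 1 \<le> i \<and> i < j \<and> j \<le> s \<longrightarrow> n i > n j"
    and "n s \<ge> 2"
    and "S = n ` {1..s}"
    and "\<exists>(X :: nat set) B. uniform_bi_hypergraph r X B \<and> one_realization X B S"
  shows "n s \<ge> r - 1 \<and>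
    int (delta r S) =
      (if n 1 > n 2 + 1
         then (int (n 1) - 2) * int r - (int (n 1) - int r - 1) * int (r div 2) + 2
       else if n 1 = n 2 + 1 \<and> n 2 + 1 > r + 2
         then (int (n 1) - 3) * int r - (int (n 1) - int r - 3) * int (r div 2) + 2
       else if n 1 = r \<or> (s \<ge> 3 \<and> n 1 = n 3 + 2 \<and> n 3 + 2 = r + 1 \<and> r + 1 > 5)
         then int r * (int r - 1) - 1
       else (int (n 1) - 2) * (int r - 1) + 3)"
proof -
  have r4: "4 \<le> r" and s2: "2 \<le> s" by fact+
  have dec: "n j < n i" if "1 \<le> i" "i < j" "j \<le> s" for i j using assms(3) that by blast
  have dec': "n j \<le> n i" if "1 \<le> i" "i \<le> j" "j \<le> s" for i j
    using dec[of i j] that by (cases "i = j") auto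
  have inS: "n i \<in> S" if "1 \<le> i" "i \<le> s" for i using assms(5) that by auto
  have S2: "2 \<le> k" if "k \<in> S" for k
    using that dec'[of _ s] assms(4,5) by fastforce
  have realized: "realized r X B S" if "uniform_bi_hypergraph r X B" "one_realization X B S"
    for X :: "nat set" and B
    using that r4 S2 inS[of 1] s2 by unfold_locales auto
  obtain X0 :: "nat set" and B0 where "uniform_bi_hypergraph r X0 B0" "one_realization X0 B0 S"
    using assms(6) by blast
  then interpret R: realized r X0 B0 S by (rule realized)
  have ge: "r - 1 \<le> k" if "k \<in> S" for k using R.S_ge[OF that] .
  define N where "N = n 1"
  define M where "M = n 2"
  have NM: "M < N" "N \<in> S" "M \<in> S" unfolding N_def M_def using dec[of 1 2] inS s2 by auto
  have rest: "k = N \<or> k = M \<or> 3 \<le> s \<and> k \<le> n 3" if k: "k \<in> S" for k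
  proof -
    obtain i where i: "i \<in> {1..s}" "k = n i" using k assms(5) by auto
    then consider "i = 1" | "i = 2" | "3 \<le> i" by fastforce
    then show ?thesis using i dec'[of 3 i] unfolding N_def M_def by cases auto
  qed
  have n3: "n 3 < M" "n 3 \<in> S" if "3 \<le> s" using that dec[of 2 3] inS[of 3] unfolding M_def by auto
  have leM: "k = N \<or> k \<le> M" if "k \<in> S" for k using rest[OF that] n3 by fastforce
  have S_sub: "S \<subseteq> {r - 1..N}" using ge leM NM by fastforce
  have rM: "r - 1 \<le> M" using ge NM by blast
  then have rN: "r \<le> N" using NM by linarith
  define h where "h = r div 2"
  have h: "2 \<le> h" "2 * h \<le> r" "r \<le> 2 * h + 1" using r4 unfolding h_def by auto
  define F1 where "F1 = (int N - 2) * int r - (int N - int r - 1) * int h + 2"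
  define F2 where "F2 = (int N - 3) * int r - (int N - int r - 3) * int h + 2"
  define F3 where "F3 = int r * (int r - 1) - 1"
  define F4 where "F4 = (int N - 2) * (int r - 1) + 3"
  have top: "F1 \<le> int (card X) \<or> N - 1 \<in> S \<and>
      (\<exists>t. 1 \<le> t \<and> 2 * t < r \<and> (int N - 3) * int r + 2 - int t * (int N - int r - 3) \<le> int (card X))"
    if "uniform_bi_hypergraph r X B" "one_realization X B S" "r < N" for X :: "nat set" and B
    using realized.top_bound[OF realized[OF that(1,2)] NM(2) that(3)] unfolding F1_def h_def by blast
  have bottom: "F3 \<le> int (card X)"
    if "uniform_bi_hypergraph r X B" "one_realization X B S" "r - 1 \<in> S" for X :: "nat set" and B
    using realized.min_colours_bound[OF realized[OF that(1,2)] that(3)] unfolding F3_def .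
  \<comment> \<open>Here \<open>N - r - 3\<close> is negative, so the small pair bound is least at
    \<open>t = 1\<close>, where it equals \<open>F4\<close>; and \<open>F1\<close> is at least
    \<open>F4\<close>.\<close>
  have pairF4: "F4 \<le> int (card X)"
    if X: "uniform_bi_hypergraph r X B" "one_realization X B S" and Nr: "N = r + 1 \<or> N = r + 2"
    for X :: "nat set" and B
  proof -
    have "r < N" using Nr by auto
    from top[OF X this] show ?thesis
    proof
      assume "F1 \<le> int (card X)"
      moreover have "F4 \<le> F1" using Nr
      proof
        assume N: "N = r + 1"
        show ?thesis unfolding F1_def F4_def N using r4 by (simp add: algebra_simps)
      next
        assume N: "N = r + 2"
        show ?thesis unfolding F1_def F4_def N using r4 h by (simp add: algebra_simps)
      qed
      ultimately show ?thesis by linarith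
    next
      assume "N - 1 \<in> S \<and> (\<exists>t. 1 \<le> t \<and> 2 * t < r \<and>
        (int N - 3) * int r + 2 - int t * (int N - int r - 3) \<le> int (card X))"
      then obtain t where t: "1 \<le> t" "(int N - 3) * int r + 2 - int t * (int N - int r - 3) \<le> int (card X)"
        by blast
      from Nr show ?thesis
      proof
        assume N: "N = r + 1"
        show ?thesis using t unfolding F4_def N by (simp add: algebra_simps)
      next
        assume N: "N = r + 2"
        show ?thesis using t unfolding F4_def N by (simp add: algebra_simps)
      qed
    qed
  qed
  have "int (delta r S) = (if M + 1 < N then F1 else if N = M + 1 \<and> r + 2 < M + 1 then F2
     else if N = r \<or> 3 \<le> s \<and> N = n 3 + 2 \<and> n 3 + 2 = r + 1 \<and> 5 < r + 1 then F3 else F4)"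
  proof -
    consider (gap) "M + 1 < N" | (adj) "N = M + 1" "r + 2 < N" | (min) "N = M + 1" "N = r"
      | (one) "N = M + 1" "N = r + 1" | (two) "N = M + 1" "N = r + 2"
      using NM rN by linarith
    then show ?thesis
    proof cases
      case gap
      then have "r < N" using rM by linarith
      have "N - 1 \<notin> S" using leM[of "N - 1"] gap by auto
      then have "int (delta r S) = F1"
        using realization_blocks[OF r4 \<open>r < N\<close> S_sub NM(2), of False] top \<open>r < N\<close>
        unfolding F1_def h_def by (intro delta_eqI) auto
      then show ?thesis using gap by simp
    next
      case adj
      then have "r < N" "r + 2 \<le> N" "N - 1 \<in> S" using NM by auto
      have "int (delta r S) = F2"
      proof (rule delta_eqI)
        \<comment> \<open>The number \<open>N - 1\<close> is contributed by the merge, so only the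
          rest of \<open>S\<close> is realized by distributing blocks.\<close>
        have "S - {N - 1} \<subseteq> {r - 1..N}" "N \<in> S - {N - 1}" using S_sub NM by auto
        from realization_blocks[OF r4 \<open>r < N\<close> this, of True] \<open>r + 2 \<le> N\<close>
        obtain X :: "nat set" and B where X: "uniform_bi_hypergraph r X B"
          "one_realization X B ((S - {N - 1}) \<union> {N - 1})" and
          cX: "int (card X) = (int N - 2) * int r - (int N - int r - 1) * int h + 2 - (int r - 2 * int h)"
          unfolding h_def by auto
        have S: "(S - {N - 1}) \<union> {N - 1} = S" using \<open>N - 1 \<in> S\<close> by blast
        have "int (card X) = F2" unfolding cX F2_def by (simp add: algebra_simps)
        then show "\<exists>(X :: nat set) B. realizes r X B S \<and> int (card X) = F2"
          using X unfolding S by blast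
        fix X :: "nat set" and B assume X: "uniform_bi_hypergraph r X B" "one_realization X B S"
        from top[OF X \<open>r < N\<close>] show "F2 \<le> int (card X)"
        proof
          assume "F1 \<le> int (card X)"
          \<comment> \<open>The bounds agree for even \<open>r\<close>; for odd \<open>r\<close> a
            second block of size \<open>h\<close> saves one vertex.\<close>
          moreover have "F1 - F2 = int r - 2 * int h" unfolding F1_def F2_def by (simp add: algebra_simps)
          ultimately show ?thesis using h by linarith
        next
          assume "N - 1 \<in> S \<and> (\<exists>t. 1 \<le> t \<and> 2 * t < r \<and>
            (int N - 3) * int r + 2 - int t * (int N - int r - 3) \<le> int (card X))"
          then obtain t where t: "2 * t < r" "(int N - 3) * int r + 2 - int t * (int N - int r - 3) \<le> int (card X)"
            by blast
          have "int t * (int N - int r - 3) \<le> int h * (int N - int r - 3)"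
            using t h adj by (intro mult_right_mono) auto
          then show ?thesis using t(2) unfolding F2_def by (simp add: algebra_simps)
        qed
      qed
      then show ?thesis using adj by simp
    next
      case min
      have "k \<in> {r, r - 1}" if "k \<in> S" for k using ge[OF that] leM[OF that] min by auto
      then have S: "S = {r, r - 1}" using NM min by auto
      have "int (delta r S) = F3"
        using realization_smallest[OF r4] bottom unfolding S F3_def by (intro delta_eqI) blast+
      then show ?thesis using min by simp
    next
      case one
      show ?thesis
      proof (cases "r - 1 \<in> S")
        case False
        have "k \<in> {N, N - 1}" if "k \<in> S" for k
        proof -
          have "k \<noteq> r - 1" using that False by auto
          then show ?thesis using ge[OF that] leM[OF that] one by auto
        qed
        then have S: "S = {N, N - 1}" using NM one by auto
        have "int (delta r S) = F4"
          using realization_pair[OF r4, of N] one pairF4 unfolding S F4_def by (intro delta_eqI) auto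
        moreover have "\<not> (3 \<le> s \<and> N = n 3 + 2 \<and> n 3 + 2 = r + 1)"
        proof
          assume a: "3 \<le> s \<and> N = n 3 + 2 \<and> n 3 + 2 = r + 1"
          then have "n 3 = r - 1" by linarith
          then show False using False n3(2) a by simp
        qed
        ultimately show ?thesis using one by auto
      next
        case True
        have "k \<in> {r + 1, r, r - 1}" if "k \<in> S" for k using ge[OF that] leM[OF that] one by auto
        then have S: "S = {r + 1, r, r - 1}" using NM one True by auto
        have s3: "3 \<le> s" "n 3 = r - 1"
        proof -
          have "r - 1 \<noteq> N" "r - 1 \<noteq> M" using one r4 by auto
          then have *: "3 \<le> s \<and> r - 1 \<le> n 3" using rest[OF True] by blast
          then show "3 \<le> s" by blast
          then have "n 3 < M" by (rule n3(1))
          then show "n 3 = r - 1" using * one by linarith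
        qed
        \<comment> \<open>Both lower bounds \<open>F3\<close> and \<open>F4\<close> apply to this
          set, and \<open>F3 - F4\<close> equals \<open>r - 5\<close>; so \<open>F4\<close> decides
          only for \<open>r = 4\<close>.\<close>
        show ?thesis
        proof (cases "r = 4")
          case True
          have "int (delta r S) = F4"
          proof (rule delta_eqI)
            show "\<exists>(X :: nat set) B. realizes r X B S \<and> int (card X) = F4"
              using realization_three[OF r4] True one unfolding S F4_def by auto
          qed (use pairF4 one in blast)
          then show ?thesis using one True by simp
        next
          case r5: False
          have int: "int (r * (r - 1) - 1) = F3"
          proof -
            have "1 \<le> r * (r - 1)" using r4 by simp
            then show ?thesis unfolding F3_def using r4 by (simp add: of_nat_diff)
          qed
          have "int (delta r S) = F3"
          proof (rule delta_eqI)
            obtain X :: "nat set" and B where "uniform_bi_hypergraph r X B"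
              "one_realization X B {r + 1, r, r - 1}" "card X = r * (r - 1) - 1"
              using realization_three[OF r4] r5 by auto
            then show "\<exists>(X :: nat set) B. realizes r X B S \<and> int (card X) = F3"
              using int unfolding S by metis
          qed (use bottom True in blast)
          then show ?thesis using one s3 r5 r4 by simp
        qed
      qed
    next
      case two
      have "\<exists>(X :: nat set) B. realizes r X B S \<and> int (card X) = F4"
      proof (cases "r \<in> S \<or> r - 1 \<in> S")
        case False
        have "k \<in> {N, N - 1}" if "k \<in> S" for k
        proof -
          have "k \<noteq> r" "k \<noteq> r - 1" using that False by auto
          then show ?thesis using ge[OF that] leM[OF that] two by auto
        qed
        then have S: "S = {N, N - 1}" using NM two by auto
        show ?thesis using realization_pair[OF r4, of N] two unfolding S F4_def by auto
      next
        case True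
        have "k \<in> {r + 2, r + 1} \<union> (if r \<in> S then {r} else {}) \<union> (if r - 1 \<in> S then {r - 1} else {})"
          if "k \<in> S" for k
        proof -
          have "k = r + 2 \<or> k = r + 1 \<or> k = r \<or> k = r - 1" using ge[OF that] leM[OF that] two by linarith
          then show ?thesis using that by auto
        qed
        moreover have "{r + 2, r + 1} \<subseteq> S" using NM two by auto
        ultimately have S: "{r + 2, r + 1} \<union> (if r \<in> S then {r} else {}) \<union> (if r - 1 \<in> S then {r - 1} else {}) = S"
          by (intro equalityI subsetI) (auto split: if_splits)
        have F4: "int (r * (r - 1) + 3) = F4"
          unfolding F4_def two(2) using r4 by (simp add: of_nat_diff)
        show ?thesis using realization_two_above[OF r4 True] F4 unfolding S by metis
      qed
      then have "int (delta r S) = F4" by (rule delta_eqI) (use pairF4 two in blast)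
      moreover have "\<not> (N = n 3 + 2 \<and> n 3 + 2 = r + 1)" using two by simp
      ultimately show ?thesis using two by auto
    qed
  qed
  moreover have "r - 1 \<le> n s" using ge inS[of s] s2 by simp
  ultimately show ?thesis
    unfolding N_def M_def F1_def F2_def F3_def F4_def h_def by simp
qed

end
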